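(* Let $G$ be a Polish group acting in a continuous manner on a Polish space $(X,\tau_X)$ equipped with an atomless $\sigma$-finite infinite Borel measure $\lambda$ which is locally finite on $\tau_X$. Then the orbit full group $[\mathcal{R}_G]$, equipped with the topology $\tau_m^o$ of orbital convergence in measure, is a Polish group. Moreover, if the action is measure-preserving and essentially free, then $G$ topologically embeds in $[\mathcal{R}_G]$ (that is, the homomorphism sending $g\in G$ to the bijection $x\mapsto g\cdot x$ is a homeomorphism onto its image in $([\mathcal{R}_G],\tau_m^o)$).
   Context: A Borel measure on a topological space is locally finite if every point has an open neighbourhood of finite measure. $\mathrm{Aut}(X,\lambda)$ is the group of Borel bijections $T$ of $X$ with $\lambda(T(A))=\lambda(T^{-1}(A))=\lambda(A)$ for every Borel $A$, where two bijections are identified when they coincide on a conull set. An action of $G$ on $(X,\lambda)$ is essentially free if there is a conull $G$-invariant subset $A\subseteq X$ such that $g\cdot x\neq x$ for all $g\in G\setminus\{e_G\}$ and all $x\in A$. For a Borel action of a Polish group $(G,\tau_G)$ on $(X,\lambda)$, the orbit full group is $[\mathcal{R}_G]=\{T\in\mathrm{Aut}(X,\lambda) : T(x)\in G\cdot x \text{ for almost all } x\in X\}$. $\mathrm{L}^0(X,\lambda,G)$ is the space of Lebesgue-measurable maps $X\to G$ modulo a.e. equality, with the topology of convergence in measure, induced by the metric $\tilde d(f,g)=\int_X d(f(x),g(x))\,d\mu(x)$, where $d$ is any compatible bounded metric on $G$ and $\mu$ any probability measure equivalent to $\lambda$ (the topology does not depend on these choices). For $f\in \mathrm{L}^0(X,\lambda,G)$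 put $\Phi(f)(x)=f(x)\cdot x$, and let $\widetilde{[\mathcal{R}_G]}$ be the set of $f$ with $\Phi(f)\in\mathrm{Aut}(X,\lambda)$. Then $\Phi$ maps $\widetilde{[\mathcal{R}_G]}$ onto $[\mathcal{R}_G]$, and the topology of orbital convergence in measure $\tau_m^o$ on $[\mathcal{R}_G]$ is the quotient topology, via $\Phi$, of the topology of convergence in measure on $\widetilde{[\mathcal{R}_G]}$. *)

theory Defs
  imports "HOL-Probability.Probability_Measure" "HOL-Algebra.Group_Action"
begin

section \<open>Polish groups\<close>

definition polish_topology :: "'a topology \<Rightarrow> bool" where
  "polish_topology T \<longleftrightarrow> completely_metrizable_space T \<and> separable_space T"

definition polish_group :: "('a, 'b) monoid_scheme \<Rightarrow> 'a topology \<Rightarrow> bool" where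
  "polish_group G T \<longleftrightarrow>
     group G \<and> topspace T = carrier G \<and> polish_topology T \<and>
     continuous_map (prod_topology T T) T (\<lambda>(g, h). g \<otimes>\<^bsub>G\<^esub> h) \<and>
     continuous_map T T (\<lambda>g. inv\<^bsub>G\<^esub> g)"


section \<open>Measures\<close>

definition atomless :: "'a measure \<Rightarrow> bool" where
  "atomless M \<longleftrightarrow>
     \<not> (\<exists>A\<in>sets M. emeasure M A > 0 \<and>
          (\<forall>B\<in>sets M. B \<subseteq> A \<longrightarrow> emeasure M B = 0 \<or> emeasure M (A - B) = 0))"

definition locally_finite_measure :: "'a::topological_space measure \<Rightarrow> bool" where
  "locally_finite_measure M \<longleftrightarrow> (\<forall>x. \<exists>U. open U \<and> x \<in> U \<and> emeasure M U < \<infinity>)"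


section \<open>Maps modulo almost everywhere equality\<close>

text \<open>
  Elements of spaces of maps modulo almost everywhere equality are represented by the set of
  all functions that agree almost everywhere with a given one.  A function that agrees almost
  everywhere with a Lebesgue-measurable one is itself Lebesgue-measurable; the classes of
  automorphisms, however, also contain functions that are bijective only up to a null set.
\<close>

definition ae_class :: "'a measure \<Rightarrow> ('a \<Rightarrow> 'b) \<Rightarrow> ('a \<Rightarrow> 'b) set" where
  "ae_class M f = {g. AE x in M. g x = f x}"

definition ae_rep :: "('a \<Rightarrow> 'b) set \<Rightarrow> 'a \<Rightarrow> 'b" where
  "ae_rep F = (SOME f. f \<in> F)"

lemma ae_class_self: "f \<in> ae_class M f"
  by (simp add: ae_class_def)

lemma ae_class_eq_iff: "ae_class M f = ae_class M g \<longleftrightarrow> (AE x in M. f x = g x)"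
proof
  assume "ae_class M f = ae_class M g"
  then show "AE x in M. f x = g x"
    using ae_class_self[of f M] by (simp add: ae_class_def)
next
  assume fg: "AE x in M. f x = g x"
  have "(AE x in M. h x = f x) \<longleftrightarrow> (AE x in M. h x = g x)" for h
  proof
    assume "AE x in M. h x = f x"
    then show "AE x in M. h x = g x" using fg by eventually_elim simp
  next
    assume "AE x in M. h x = g x"
    then show "AE x in M. h x = f x" using fg by eventually_elim simp
  qed
  then show "ae_class M f = ae_class M g"
    by (simp add: ae_class_def)
qed

lemma AE_ae_rep: "AE x in M. ae_rep (ae_class M f) x = f x"
proof -
  have "ae_rep (ae_class M f) \<in> ae_class M f"
    unfolding ae_rep_def by (metis ae_class_self someI_ex)
  then show ?thesis by (simp add: ae_class_def)
qed


section \<open>The automorphism group of a measure space and orbit full groups\<close>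

definition mp_bijections :: "'x::topological_space measure \<Rightarrow> ('x \<Rightarrow> 'x) set" where
  "mp_bijections M =
     {T. bij T \<and> T \<in> borel \<rightarrow>\<^sub>M borel \<and> inv_into UNIV T \<in> borel \<rightarrow>\<^sub>M borel \<and>
         (\<forall>A\<in>sets borel. emeasure M (T ` A) = emeasure M A \<and>
                         emeasure M (T -` A) = emeasure M A)}"

definition Aut :: "'x::topological_space measure \<Rightarrow> ('x \<Rightarrow> 'x) set monoid" where
  "Aut M = \<lparr>carrier = ae_class M ` mp_bijections M,
            mult = (\<lambda>S T. ae_class M (ae_rep S \<circ> ae_rep T)),
            one = ae_class M id\<rparr>"

text \<open>
  The product does not depend on the representatives, although these need not be bijections:
\<close>

lemma Aut_mult_ae_class:
  assumes M: "sets M = sets borel" and T: "T \<in> mp_bijections M"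
  shows "ae_class M S \<otimes>\<^bsub>Aut M\<^esub> ae_class M T = ae_class M (S \<circ> T)"
proof -
  obtain N where N: "N \<in> null_sets M" "{x \<in> space M. ae_rep (ae_class M S) x \<noteq> S x} \<subseteq> N"
    using AE_ae_rep[of M S] by (auto simp: eventually_ae_filter)
  have sp: "space M = UNIV"
    using sets_eq_imp_space_eq[OF M] by simp
  have NB: "N \<in> sets borel" using N(1) M by auto
  have Tm: "T \<in> borel \<rightarrow>\<^sub>M borel" using T by (simp add: mp_bijections_def)
  have "T -` N \<in> sets borel"
    using measurable_sets[OF Tm NB] by simp
  moreover have "emeasure M (T -` N) = 0"
    using T NB N(1) by (auto simp: mp_bijections_def)
  ultimately have "T -` N \<in> null_sets M"
    using M by auto
  then have "AE x in M. T x \<notin> N"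
    using AE_not_in by fastforce
  then have "AE x in M. ae_rep (ae_class M S) (ae_rep (ae_class M T) x) = S (T x)"
    using AE_ae_rep[of M T]
  proof eventually_elim
    case (elim x)
    then show ?case using N(2) sp by auto
  qed
  then show ?thesis
    by (simp add: Aut_def ae_class_eq_iff)
qed

definition orbit_full_group ::
  "('g, 'b) monoid_scheme \<Rightarrow> ('g \<Rightarrow> 'x \<Rightarrow> 'x::topological_space) \<Rightarrow> 'x measure \<Rightarrow> ('x \<Rightarrow> 'x) set monoid"
  where
  "orbit_full_group G \<phi> M =
     (Aut M)\<lparr>carrier := ae_class M ` {T \<in> mp_bijections M. AE x in M. T x \<in> orbit G \<phi> x}\<rparr>"


section \<open>Convergence in measure\<close>

definition compatible_bounded_metric :: "('g::topological_space \<Rightarrow> 'g \<Rightarrow> real) \<Rightarrow> bool" where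
  "compatible_bounded_metric d \<longleftrightarrow>
     Metric_space UNIV d \<and> Metric_space.mtopology UNIV d = euclidean \<and> (\<exists>B. \<forall>g h. d g h \<le> B)"

definition equivalent_probability :: "'x measure \<Rightarrow> 'x measure \<Rightarrow> bool" where
  "equivalent_probability M \<mu> \<longleftrightarrow>
     prob_space \<mu> \<and> sets \<mu> = sets M \<and> null_sets \<mu> = null_sets M"

definition L0 :: "'x measure \<Rightarrow> ('x \<Rightarrow> 'g::topological_space) set set" where
  "L0 M = ae_class M ` (completion M \<rightarrow>\<^sub>M borel)"

text \<open>
  The integral is taken with respect to the completion, since representatives are only
  Lebesgue-measurable (and the integral of a non-measurable function is 0 by convention).
\<close>

definition L0_dist ::
  "('g \<Rightarrow> 'g \<Rightarrow> real) \<Rightarrow> 'x measure \<Rightarrow> ('x \<Rightarrow> 'g) set \<Rightarrow> ('x \<Rightarrow> 'g) set \<Rightarrow> real" where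
  "L0_dist d \<mu> F H = (\<integral>x. d (ae_rep F x) (ae_rep H x) \<partial>(completion \<mu>))"

definition L0_topology ::
  "'x measure \<Rightarrow> ('g::topological_space \<Rightarrow> 'g \<Rightarrow> real) \<Rightarrow> 'x measure \<Rightarrow> ('x \<Rightarrow> 'g) set topology" where
  "L0_topology M d \<mu> = Metric_space.mtopology (L0 M) (L0_dist d \<mu>)"


section \<open>Orbital convergence in measure\<close>

definition quotient_topology :: "'a topology \<Rightarrow> 'b set \<Rightarrow> ('a \<Rightarrow> 'b) \<Rightarrow> 'b topology" where
  "quotient_topology T Y f = topology (\<lambda>U. U \<subseteq> Y \<and> openin T {x \<in> topspace T. f x \<in> U})"

lemma openin_quotient_topology:
  "openin (quotient_topology T Y f) U \<longleftrightarrow> U \<subseteq> Y \<and> openin T {x \<in> topspace T. f x \<in> U}"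
proof -
  have "istopology (\<lambda>U. U \<subseteq> Y \<and> openin T {x \<in> topspace T. f x \<in> U})"
    unfolding istopology_def
  proof (intro conjI allI impI)
    fix S U assume S: "S \<subseteq> Y \<and> openin T {x \<in> topspace T. f x \<in> S}"
      and U: "U \<subseteq> Y \<and> openin T {x \<in> topspace T. f x \<in> U}"
    have "{x \<in> topspace T. f x \<in> S \<inter> U} =
        {x \<in> topspace T. f x \<in> S} \<inter> {x \<in> topspace T. f x \<in> U}"
      by blast
    then show "S \<inter> U \<subseteq> Y" "openin T {x \<in> topspace T. f x \<in> S \<inter> U}"
      using S U by (auto simp only: intro!: openin_Int)
  next
    fix K assume K: "\<forall>S\<in>K. S \<subseteq> Y \<and> openin T {x \<in> topspace T. f x \<in> S}"
    have "{x \<in> topspace T. f x \<in> \<Union>K} = (\<Union>S\<in>K. {x \<in> topspace T. f x \<in> S})"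
      by blast
    then show "\<Union>K \<subseteq> Y" "openin T {x \<in> topspace T. f x \<in> \<Union>K}"
      using K by (auto simp only: intro!: openin_Union)
  qed
  then show ?thesis
    by (simp add: quotient_topology_def topology_inverse')
qed

lemma quotient_map_quotient_topology:
  assumes "f ` topspace T = Y"
  shows "quotient_map T (quotient_topology T Y f) f"
proof -
  have "{x \<in> topspace T. f x \<in> Y} = topspace T"
    using assms by auto
  then have "openin (quotient_topology T Y f) Y"
    by (simp add: openin_quotient_topology)
  then have "topspace (quotient_topology T Y f) = Y"
    by (metis openin_quotient_topology openin_subset openin_topspace subset_antisym)
  then show ?thesis
    using assms by (auto simp: quotient_map_def openin_quotient_topology)
qed

definition orbit_map ::
  "('g \<Rightarrow> 'x \<Rightarrow> 'x) \<Rightarrow> 'x measure \<Rightarrow> ('x \<Rightarrow> 'g) set \<Rightarrow> ('x \<Rightarrow> 'x) set" where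
  "orbit_map \<phi> M F = ae_class M (\<lambda>x. \<phi> (ae_rep F x) x)"

definition orbit_cocycles ::
  "('g::topological_space \<Rightarrow> 'x \<Rightarrow> 'x::topological_space) \<Rightarrow> 'x measure \<Rightarrow> ('x \<Rightarrow> 'g) set set" where
  "orbit_cocycles \<phi> M = {F \<in> L0 M. orbit_map \<phi> M F \<in> carrier (Aut M)}"

definition orbital_topology ::
  "('g::topological_space, 'b) monoid_scheme \<Rightarrow> ('g \<Rightarrow> 'x \<Rightarrow> 'x::topological_space) \<Rightarrow> 'x measure \<Rightarrow>
     ('g \<Rightarrow> 'g \<Rightarrow> real) \<Rightarrow> 'x measure \<Rightarrow> ('x \<Rightarrow> 'x) set topology" where
  "orbital_topology G \<phi> M d \<mu> =
     quotient_topology (subtopology (L0_topology M d \<mu>) (orbit_cocycles \<phi> M))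
       (carrier (orbit_full_group G \<phi> M)) (orbit_map \<phi> M)"


section \<open>Measure-preserving and essentially free actions\<close>

definition measure_preserving_action ::
  "('g, 'b) monoid_scheme \<Rightarrow> ('g \<Rightarrow> 'x \<Rightarrow> 'x) \<Rightarrow> 'x measure \<Rightarrow> bool" where
  "measure_preserving_action G \<phi> M \<longleftrightarrow>
     (\<forall>g\<in>carrier G. \<forall>A\<in>sets M. emeasure M (\<phi> g ` A) = emeasure M A)"

definition essentially_free_action ::
  "('g, 'b) monoid_scheme \<Rightarrow> ('g \<Rightarrow> 'x \<Rightarrow> 'x) \<Rightarrow> 'x measure \<Rightarrow> bool" where
  "essentially_free_action G \<phi> M \<longleftrightarrow>
     (\<exists>A. (AE x in M. x \<in> A) \<and> (\<forall>g\<in>carrier G. \<phi> g ` A \<subseteq> A) \<and>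
          (\<forall>g\<in>carrier G - {\<one>\<^bsub>G\<^esub>}. \<forall>x\<in>A. \<phi> g x \<noteq> x))"

end

theory Submission
  imports Defs
begin

text \<open>
  Convergence in measure is handled through sequences: \<open>f n\<close> converges to \<open>f\<close> in measure iff every subsequence
  has a further subsequence converging almost everywhere, a condition that mentions neither the metric nor
  the probability measure.  The central fact is that \<open>f n \<circ> S n\<close> converges to \<open>f \<circ> S\<close> in measure whenever
  \<open>f n\<close> converges to \<open>f\<close>, \<open>S n\<close> to \<open>S\<close> and the \<open>S n\<close> preserve the locally finite measure.  It makes the
  space of cocycles (the \<open>f\<close> for which \<open>x \<mapsto> f x \<cdot> x\<close> is an automorphism) a topological group
  and shows that the graph of its inversion is closed in the square of \<open>L0 M\<close>, so that it is Polish.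

  The map sending a cocycle to its transformation is onto by measurable selection, and it is open
  because two cocycles of one transformation differ by a map into the stabilizers.  Hence the orbit
  full group is a Hausdorff topological group, so it is regular, and as a regular open continuous
  image of a Polish space it is Polish.  If the action is essentially free this map is a homeomorphism, and it
  sends the constant cocycles, which form a copy of \<open>G\<close>, to the transformations given by the action.
\<close>

section \<open>Open images of Polish spaces\<close>

text \<open>Two measures compete. Distances in \<open>L0 M\<close> are integrals against the
  probability measure \<open>\<mu>\<close>, whereas the transformations preserve the infinite
  measure \<open>M\<close>; pulling a set back along them may turn small
  \<open>\<mu>\<close>-measure into large. Exceptional sets that get pulled back are therefore
  estimated with \<open>M\<close>, inside open sets of finite measure supplied by local finiteness.
  Openness guarantees that \<open>S n x\<close> enters such a set once it converges to a point of
  it.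

  The inverses enter because cocycles need not form a closed subset of \<open>L0 M\<close>: a limit
  of measure preserving bijections need not be onto. On the half-line, let the n-th map shift [0,n)
  by 1, carry [n,n+1) back to [0,1) and fix the rest; the limit x \<mapsto> x+1 misses [0,1).
  Convergence of the inverses as well excludes such a loss of mass. Fatou's lemma gives only an
  inequality of measures for each of the two limits, and equality follows because they invert each
  other.\<close>

lemma regular_second_countable_imp_metrizable_space:
  assumes reg: "regular_space X" and sc: "second_countable X" and H: "Hausdorff_space X"
  shows "metrizable_space X"
proof -
  have "normal_space X"
    using assms second_countable_imp_Lindelof_space regular_Lindelof_imp_normal_space by blast
  obtain \<B> where \<B>: "countable \<B>" "\<And>V. V \<in> \<B> \<Longrightarrow> openin X V"
    and base: "\<And>U x. openin X U \<Longrightarrow> x \<in> U \<Longrightarrow> \<exists>V\<in>\<B>. x \<in> V \<and> V \<subseteq> U"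
    using sc by (auto simp: second_countable_def)
  \<comment> \<open>Urysohn's metrization argument: one separating function for each of the
    countably many pairs of nested basic sets embeds \<open>X\<close> into a countable power of the
    reals.\<close>
  define I where "I = {(U, V). U \<in> \<B> \<and> V \<in> \<B> \<and> X closure_of U \<subseteq> V}"
  have "countable I"
    by (rule countable_subset[of _ "\<B> \<times> \<B>"]) (auto simp: I_def \<B>(1))
  have "\<exists>f. continuous_map X euclideanreal f \<and> f ` (X closure_of fst p) \<subseteq> {0} \<and>
          f ` (topspace X - snd p) \<subseteq> {1}" if "p \<in> I" for p
  proof -
    have "closedin X (topspace X - snd p)" "disjnt (X closure_of fst p) (topspace X - snd p)"
      using that \<B>(2) by (auto simp: I_def disjnt_iff)
    then show ?thesis
      using \<open>normal_space X\<close> unfolding normal_space_iff_Urysohn_alt by auto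
  qed
  then obtain f where contf: "\<And>p. p \<in> I \<Longrightarrow> continuous_map X euclideanreal (f p)"
    and f0: "\<And>p. p \<in> I \<Longrightarrow> f p ` (X closure_of fst p) \<subseteq> {0}"
    and f1: "\<And>p. p \<in> I \<Longrightarrow> f p ` (topspace X - snd p) \<subseteq> {1}"
    by metis
  define e where "e x = (\<lambda>p\<in>I. f p x)" for x
  define P where "P = product_topology (\<lambda>p. euclideanreal) I"
  have sep: "\<exists>p\<in>I. f p x = 0 \<and> (\<forall>y\<in>topspace X - U. f p y = 1)" if U: "openin X U" "x \<in> U" for x U
  proof -
    obtain V where V: "V \<in> \<B>" "x \<in> V" "V \<subseteq> U"
      using base U by meson
    have xX: "x \<in> topspace X" using U openin_subset by blast
    obtain W C where "openin X W" "closedin X C" "x \<in> W" "W \<subseteq> C" "C \<subseteq> V"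
      using reg V \<B>(2) unfolding neighbourhood_base_of_closedin[symmetric] neighbourhood_base_of
      by metis
    moreover then obtain W' where "W' \<in> \<B>" "x \<in> W'" "W' \<subseteq> W"
      using base by meson
    moreover have "X closure_of W' \<subseteq> C"
      by (meson calculation closure_of_minimal order_trans)
    ultimately have "(W', V) \<in> I" and "x \<in> X closure_of W'"
      using V(1) xX closure_of_subset[OF openin_subset[OF \<B>(2)], of W'] by (auto simp: I_def)
    then show ?thesis
      using f0[of "(W',V)"] f1[of "(W',V)"] V(3) by (intro bexI[of _ "(W',V)"]) auto
  qed
  have inj: "inj_on e (topspace X)"
  proof (rule inj_onI, rule ccontr)
    fix x y assume xy: "x \<in> topspace X" "y \<in> topspace X" "e x = e y" "x \<noteq> y"
    then have "openin X (topspace X - {y})"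
      using H by (simp add: closedin_Hausdorff_singleton openin_diff)
    then obtain p where "p \<in> I" "f p x = 0" "f p y = 1"
      using sep[of "topspace X - {y}" x] xy by auto
    then show False
      using fun_cong[OF xy(3), of p] by (simp add: e_def)
  qed
  then obtain e' where e': "\<And>x. x \<in> topspace X \<Longrightarrow> e' (e x) = x"
    by (metis inv_into_f_f)
  have "continuous_map (subtopology P (e ` topspace X)) X e'"
    unfolding continuous_map_def
  proof (intro conjI allI impI)
    show "e' \<in> topspace (subtopology P (e ` topspace X)) \<rightarrow> topspace X"
      using e' by auto
    fix U assume U: "openin X U"
    show "openin (subtopology P (e ` topspace X)) {y \<in> topspace (subtopology P (e ` topspace X)). e' y \<in> U}"
    proof (subst openin_subopen, clarsimp simp: e')
      fix x assume x: "x \<in> topspace X" "x \<in> U" "e x \<in> topspace P"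
      obtain p where p: "p \<in> I" "f p x = 0" "\<And>y. y \<in> topspace X - U \<Longrightarrow> f p y = 1"
        using sep[OF U x(2)] by auto
      \<comment> \<open>Coordinate \<open>p\<close> vanishes at \<open>x\<close> and equals 1 off
        \<open>U\<close>, so any point of \<open>X\<close> whose coordinate stays below 1 lies in
        \<open>U\<close>.\<close>
      define W where "W = {z \<in> topspace P. z p \<in> {..<1}}"
      have "continuous_map P euclideanreal (\<lambda>z. z p)"
        unfolding P_def using p(1) by (rule continuous_map_product_projection)
      then have "openin P W"
        unfolding W_def by (rule openin_continuous_map_preimage) auto
      then have "openin (subtopology P (e ` topspace X)) (e ` topspace X \<inter> W)"
        by (rule openin_subtopology_Int2)
      moreover have "e x \<in> e ` topspace X \<inter> W"
        using x p by (simp add: W_def e_def)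
      moreover have "e ` topspace X \<inter> W \<subseteq> {y \<in> topspace P. y \<in> e ` topspace X \<and> e' y \<in> U}"
      proof clarsimp
        fix y assume y: "y \<in> topspace X" "e y \<in> W"
        then have "f p y < 1" using p(1) by (simp add: W_def e_def)
        then show "e y \<in> topspace P \<and> e' (e y) \<in> U"
          using p(3)[of y] y e'[of y] by (auto simp: W_def)
      qed
      ultimately show "\<exists>T. openin (subtopology P (e ` topspace X)) T \<and> e x \<in> T \<and>
          T \<subseteq> {y \<in> topspace P. y \<in> e ` topspace X \<and> e' y \<in> U}"
        by blast
    qed
  qed
  moreover have "continuous_map X P e"
    unfolding P_def continuous_map_componentwise using contf by (auto simp: e_def)
  ultimately have "homeomorphic_maps X (subtopology P (e ` topspace X)) e e'"
    using e' by (auto simp: homeomorphic_maps_def continuous_map_in_subtopology)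
  moreover have "metrizable_space (subtopology P (e ` topspace X))"
  proof -
    have "metrizable_space P"
      unfolding P_def metrizable_space_product_topology
      using \<open>countable I\<close> by (auto intro: countable_subset metrizable_space_euclidean)
    then show ?thesis by (rule metrizable_space_subtopology)
  qed
  ultimately show ?thesis
    using homeomorphic_metrizable_space homeomorphic_maps_imp_homeomorphic_space by blast
qed

text \<open>
  Inside a completion \<open>Z\<close> of \<open>Y\<close>, the image \<open>B\<close> of \<open>Y\<close> is the \<open>G\<^sub>\<delta>\<close> set of those \<open>z\<close> for which every basic
  open \<open>U\<close> with \<open>z \<in> W U\<close> contains the closures of arbitrarily small basic open \<open>V\<close> with \<open>z \<in> W V\<close>, where
  \<open>W U\<close> is the largest open subset of \<open>Z\<close> whose trace on \<open>B\<close> lies in the image of \<open>U\<close>: nested such \<open>V\<close>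
  shrink to a point that is mapped to \<open>z\<close>.
\<close>

lemma completely_metrizable_space_open_map_image:
  assumes X: "completely_metrizable_space X" "second_countable X" and Y: "metrizable_space Y"
    and cont: "continuous_map X Y f" and op: "open_map X Y f" and surj: "f ` topspace X = topspace Y"
  shows "completely_metrizable_space Y"
proof -
  obtain Mx dx where "Metric_space Mx dx" and mc: "Metric_space.mcomplete Mx dx"
    and Xeq: "X = Metric_space.mtopology Mx dx"
    using X(1) unfolding completely_metrizable_space_def by blast
  interpret Mx: Metric_space Mx dx by fact
  obtain c :: "'b \<Rightarrow> 'b \<Rightarrow> real" and Z where Z: "completely_metrizable_space Z" and c: "embedding_map Y Z c"
    and dense: "Z closure_of (c ` topspace Y) = topspace Z"
    using metrizable_space_completion[OF Y] by metis
  define B where "B = c ` topspace Y"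
  define h where "h = c \<circ> f"
  have BZ: "B \<subseteq> topspace Z"
    using dense by (metis B_def c embedding_map_def homeomorphic_imp_surjective_map inf_le1 topspace_subtopology)
  have hc: "continuous_map X (subtopology Z B) h"
    using c cont unfolding h_def B_def embedding_map_def
    by (meson continuous_map_compose homeomorphic_imp_continuous_map)
  have ho: "open_map X (subtopology Z B) h"
    using c op unfolding h_def B_def embedding_map_def
    by (meson open_map_compose homeomorphic_imp_open_map)
  have hs: "h ` topspace X = B"
    unfolding h_def B_def image_comp[symmetric] surj ..
  obtain \<B> where \<B>: "countable \<B>" "\<And>V. V \<in> \<B> \<Longrightarrow> openin X V"
    and base: "\<And>U x. openin X U \<Longrightarrow> x \<in> U \<Longrightarrow> \<exists>V\<in>\<B>. x \<in> V \<and> V \<subseteq> U"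
    using X(2) by (auto simp: second_countable_def)
  define W where "W U = topspace Z - Z closure_of (B - h ` U)" for U
  have Wopen: "openin Z (W U)" for U
    by (simp add: W_def openin_diff)
  have WB: "W U \<inter> B = h ` U" if "openin X U" for U
  proof -
    have "openin (subtopology Z B) (h ` U)"
      using ho that by (simp add: open_map_def)
    then obtain V where V: "openin Z V" "h ` U = V \<inter> B"
      by (auto simp: openin_subtopology)
    then have "V \<inter> Z closure_of (B - h ` U) = {}"
      by (subst openin_Int_closure_of_eq_empty) auto
    then show ?thesis
      using V openin_subset[OF V(1)] closure_of_subset[of "B - h ` U" Z] BZ
      unfolding W_def by blast
  qed
  \<comment> \<open>By density of \<open>B\<close>, an open part of \<open>W U\<close> missing this
    closure would contain a point of \<open>B\<close>, and such a point lies in the image of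
    \<open>U\<close>.\<close>
  have Wcl: "W U \<subseteq> Z closure_of (h ` U)" if "openin X U" for U
  proof -
    have "W U - Z closure_of (h ` U) = {}"
    proof (rule ccontr)
      assume ne: "W U - Z closure_of (h ` U) \<noteq> {}"
      have "openin Z (W U - Z closure_of (h ` U))"
        by (simp add: Wopen openin_diff)
      then have "(W U - Z closure_of (h ` U)) \<inter> B \<noteq> {}"
        using ne dense openin_subset[of Z "W U - Z closure_of (h ` U)"]
        unfolding B_def[symmetric] by (metis inf.orderE inf_bot_right inf_commute openin_Int_closure_of_eq_empty)
      moreover have "h ` U \<subseteq> Z closure_of (h ` U)"
        using WB[OF that] BZ by (intro closure_of_subset) auto
      ultimately show False
        using WB[OF that] by blast
    qed
    then show ?thesis by blast
  qed
  define J where "J U n = {V \<in> \<B>. X closure_of V \<subseteq> U \<and> (\<forall>x\<in>V. \<forall>y\<in>V. dx x y < inverse (Suc n))}" for U and n :: nat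
  \<comment> \<open>The implication "\<open>z\<close> in \<open>W U\<close> forces \<open>z\<close>
    in \<open>W V\<close> for some \<open>V\<close> in \<open>J U n\<close>", written as the union
    of a closed and an open set; closed sets are G-delta in the metrizable space
    \<open>Z\<close>.\<close>
  define Q where "Q U n = (topspace Z - W U) \<union> (\<Union>V\<in>J U n. W V)" for U n
  have small: "\<exists>V\<in>J U n. x \<in> V" if U: "openin X U" "x \<in> U" for U n x
  proof -
    obtain r where r: "r > 0" "Mx.mball x r \<subseteq> U" and xM: "x \<in> Mx"
      using U unfolding Xeq Mx.openin_mtopology by (meson subsetD)
    define s where "s = min (r / 2) (inverse (Suc n) / 2)"
    have "openin X (Mx.mball x s)" "x \<in> Mx.mball x s"
      using r(1) xM by (auto simp: Xeq s_def)
    then obtain V where V: "V \<in> \<B>" "x \<in> V" "V \<subseteq> Mx.mball x s"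
      using base by meson
    have "X closure_of V \<subseteq> Mx.mcball x s"
      using V(3) Mx.closedin_mcball[of x s] unfolding Xeq
      by (meson Mx.mball_subset_mcball closure_of_minimal order_trans)
    also have "\<dots> \<subseteq> Mx.mball x r"
      using r(1) by (auto simp: s_def)
    finally have "X closure_of V \<subseteq> U" using r(2) by auto
    moreover have "dx y z < inverse (Suc n)" if "y \<in> V" "z \<in> V" for y z
    proof -
      have "dx y x < s" "dx x z < s" "y \<in> Mx" "z \<in> Mx"
        using that V(3) by (auto simp: Mx.commute)
      moreover have "s \<le> inverse (Suc n) / 2" by (simp add: s_def)
      ultimately show ?thesis
        using Mx.triangle[of y x z] xM by linarith
    qed
    ultimately show ?thesis
      using V by (auto simp: J_def)
  qed
  \<comment> \<open>The last intersection provides the first set of the nested sequence, since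
    \<open>topspace X\<close> itself need not be a member of the base.\<close>
  define T where "T = W (topspace X) \<inter> (\<Inter>U\<in>\<B>. \<Inter>n. Q U n) \<inter> (\<Inter>n. \<Union>V\<in>J (topspace X) n. W V)"
  have Bsub: "b \<in> \<Union> (W ` J U n)" if U: "openin X U" "b \<in> h ` U" for b U n
  proof -
    obtain x where "x \<in> U" "b = h x" using U(2) by blast
    then obtain V where V: "V \<in> J U n" "x \<in> V" using small[OF U(1)] by meson
    then have "b \<in> W V" using WB[of V] \<B>(2) \<open>b = h x\<close> by (auto simp: J_def)
    then show ?thesis using V by auto
  qed
  have "T = B"
  proof
    show "B \<subseteq> T"
    proof
      fix b assume b: "b \<in> B"
      then have "b \<in> W (topspace X)"
        using WB[of "topspace X"] hs by auto
      moreover have "b \<in> Q U n" if "U \<in> \<B>" for U n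
        using b WB[OF \<B>(2)[OF that]] BZ Bsub[OF \<B>(2)[OF that], of b n] by (auto simp: Q_def)
      moreover have "b \<in> (\<Union>V\<in>J (topspace X) n. W V)" for n
        using Bsub[of "topspace X" b n] b hs by auto
      ultimately show "b \<in> T" by (auto simp: T_def)
    qed
    show "T \<subseteq> B"
    proof
      fix z assume z: "z \<in> T"
      define good where "good U n \<longleftrightarrow> U \<in> \<B> \<and> z \<in> W U \<and> (\<forall>x\<in>U. \<forall>y\<in>U. dx x y < inverse (Suc n))" for U and n :: nat
      have "\<exists>V. good V 0"
      proof -
        obtain V where "V \<in> J (topspace X) 0" "z \<in> W V" using z unfolding T_def by blast
        then show ?thesis by (intro exI[of _ V]) (simp add: good_def J_def)
      qed
      moreover have "\<exists>V. good V (Suc n) \<and> X closure_of V \<subseteq> U" if "good U n" for U n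
      proof -
        have "z \<in> Q U (Suc n)" using z that by (auto simp: T_def good_def)
        then show ?thesis using that by (auto simp: Q_def good_def J_def)
      qed
      ultimately have "\<exists>S. \<forall>n. good (S n) n \<and> X closure_of (S (Suc n)) \<subseteq> S n"
        by (intro dependent_nat_choice) auto
      then obtain S where S: "\<And>n. good (S n) n" "\<And>n. X closure_of (S (Suc n)) \<subseteq> S n"
        by blast
      have SX: "openin X (S n)" for n using S(1) \<B>(2) by (auto simp: good_def)
      have dec: "S (Suc n) \<subseteq> S n" for n
        using S(2) SX by (meson closure_of_subset openin_subset order_trans)
      have decm: "S n \<subseteq> S m" if "m \<le> n" for m n
        using dec that by (rule lift_Suc_antimono_le)
      \<comment> \<open>\<open>z\<close> lies in the closure of the image of \<open>S n\<close>, so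
        that image cannot be empty.\<close>
      have ne: "S n \<noteq> {}" for n
        using S(1)[of n] Wcl[OF SX[of n]] by (auto simp: good_def)
      then have "\<forall>n. \<exists>x. x \<in> S n" by blast
      then obtain a where a: "\<And>n. a n \<in> S n" by metis
      have "range a \<subseteq> Mx" using a SX openin_subset[of X] by (fastforce simp: Xeq)
      have "Mx.MCauchy a"
        unfolding Mx.MCauchy_def
      proof (intro conjI allI impI)
        show "range a \<subseteq> Mx" by fact
        fix \<epsilon> :: real assume "\<epsilon> > 0"
        then obtain N where N: "inverse (Suc N) < \<epsilon>" using reals_Archimedean by blast
        have "dx (a n) (a n') < \<epsilon>" if "N \<le> n" "N \<le> n'" for n n'
        proof -
          have "a n \<in> S N" "a n' \<in> S N" using a decm that by blast+
          then show ?thesis using S(1)[of N] N by (force simp: good_def)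
        qed
        then show "\<exists>N. \<forall>n n'. N \<le> n \<longrightarrow> N \<le> n' \<longrightarrow> dx (a n) (a n') < \<epsilon>" by blast
      qed
      then obtain x where x: "limitin X a x sequentially"
        using mc by (auto simp: Mx.mcomplete_def Xeq)
      have xS: "x \<in> S n" for n
      proof -
        have "\<forall>\<^sub>F k in sequentially. a k \<in> S (Suc n)"
          unfolding eventually_sequentially using a decm by blast
        then have "\<forall>\<^sub>F k in sequentially. a k \<in> X closure_of S (Suc n)"
          by eventually_elim (use closure_of_subset[OF openin_subset[OF SX]] in blast)
        then have "x \<in> X closure_of S (Suc n)"
          by (rule limitin_closedin[OF x closedin_closure_of]) simp
        then show ?thesis using S(2) by auto
      qed
      have xX: "x \<in> topspace X" using xS SX openin_subset by blast
      have "h x = z"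
      proof (rule ccontr)
        assume ne: "h x \<noteq> z"
        have hx: "h x \<in> topspace Z" using hs BZ xX by auto
        have zZ: "z \<in> topspace Z" using z Wopen openin_subset by (fastforce simp: T_def)
        have "Hausdorff_space Z"
          using Z by (simp add: completely_metrizable_imp_metrizable_space metrizable_imp_Hausdorff_space)
        then obtain V1 V2 where V: "openin Z V1" "openin Z V2" "h x \<in> V1" "z \<in> V2" "disjnt V1 V2"
          using ne hx zZ unfolding Hausdorff_space_def by metis
        have "openin X {y \<in> topspace X. h y \<in> V1}"
          using hc V(1) by (auto simp: continuous_map_in_subtopology intro: openin_continuous_map_preimage)
        moreover have "x \<in> {y \<in> topspace X. h y \<in> V1}" using xX V by auto
        ultimately obtain r where r: "r > 0" "Mx.mball x r \<subseteq> {y \<in> topspace X. h y \<in> V1}"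
          unfolding Xeq Mx.openin_mtopology by blast
        obtain N where N: "inverse (Suc N) < r" using r(1) reals_Archimedean by blast
        have "S N \<subseteq> Mx.mball x r"
        proof
          fix y assume y: "y \<in> S N"
          then have "dx x y < inverse (Suc N)" using xS[of N] S(1)[of N] by (auto simp: good_def)
          then show "y \<in> Mx.mball x r"
            using N y xS[of N] SX[of N] openin_subset[OF SX[of N]] by (auto simp: Xeq)
        qed
        then have "h ` S N \<subseteq> V1" using r(2) by auto
        then have "V2 \<inter> h ` S N = {}" using V(5) by (auto simp: disjnt_iff)
        then have "V2 \<inter> Z closure_of (h ` S N) = {}"
          using V(2) by (simp add: openin_Int_closure_of_eq_empty)
        then show False
          using Wcl[OF SX[of N]] S(1)[of N] V(4) by (auto simp: good_def)
      qed
      then show "z \<in> B" using hs xX by auto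
    qed
  qed
  moreover have "gdelta_in Z T"
  proof -
    have J: "openin Z (\<Union>V\<in>J U n. W V)" for U n
      using Wopen by blast
    have Q: "gdelta_in Z (Q U n)" for U n
      unfolding Q_def
      using closed_imp_gdelta_in[OF completely_metrizable_imp_metrizable_space[OF Z]] Wopen J
      by (intro gdelta_in_Un open_imp_gdelta_in[OF J]) blast
    have Q2: "gdelta_in Z (\<Inter>n. Q U n)" for U
      by (rule gdelta_in_Inter) (auto simp: Q)
    have 3: "gdelta_in Z (\<Inter>n. \<Union>V\<in>J (topspace X) n. W V)"
      by (rule gdelta_in_Inter) (auto intro: open_imp_gdelta_in J)
    \<comment> \<open>Over an empty base the inner intersection is \<open>UNIV\<close> instead of a
      subset of \<open>Z\<close>, hence the case distinction.\<close>
    have 2: "gdelta_in Z (W (topspace X) \<inter> (\<Inter>U\<in>\<B>. \<Inter>n. Q U n))"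
    proof (cases "\<B> = {}")
      case True
      then show ?thesis using open_imp_gdelta_in[OF Wopen] by simp
    next
      case False
      then have "gdelta_in Z (\<Inter>U\<in>\<B>. \<Inter>n. Q U n)"
        by (intro gdelta_in_Inter) (auto simp: Q2 \<B>(1))
      then show ?thesis using open_imp_gdelta_in[OF Wopen] gdelta_in_Int by blast
    qed
    show ?thesis unfolding T_def by (rule gdelta_in_Int[OF 2 3])
  qed
  ultimately have "completely_metrizable_space (subtopology Z B)"
    using Z completely_metrizable_space_gdelta_in by blast
  then show ?thesis
    using c homeomorphic_completely_metrizable_space homeomorphic_map_imp_homeomorphic_space
    unfolding B_def embedding_map_def by metis
qed

text \<open>Openness pushes a countable base forward. With regularity this gives metrizability,
  hence the metrizable completion in which the preceding G-delta argument takes place.\<close>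

lemma polish_space_open_map_image:
  assumes X: "completely_metrizable_space X" "second_countable X"
    and Y: "regular_space Y" "Hausdorff_space Y"
    and cont: "continuous_map X Y f" and op: "open_map X Y f" and surj: "f ` topspace X = topspace Y"
  shows "completely_metrizable_space Y" "separable_space Y"
proof -
  have "second_countable Y"
    using second_countable_open_map_image[OF cont op surj X(2)] .
  then show "separable_space Y" "completely_metrizable_space Y"
    using completely_metrizable_space_open_map_image[OF X _ cont op surj]
      regular_second_countable_imp_metrizable_space[OF Y(1) _ Y(2)] second_countable_imp_separable_space
    by auto
qed

section \<open>Measurable selection\<close>

lemma ex_dense_sequence:
  obtains q :: "nat \<Rightarrow> 'a::{metric_space, second_countable_topology}"
  where "\<And>x e. e > 0 \<Longrightarrow> \<exists>i. dist (q i) x < e"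
proof -
  obtain D :: "'a set" where D: "countable D" "\<And>X. open X \<Longrightarrow> X \<noteq> {} \<Longrightarrow> \<exists>d\<in>D. d \<in> X"
    using countable_dense_setE by blast
  then have "D \<noteq> {}" using open_UNIV by blast
  have "\<exists>i. dist (from_nat_into D i) x < e" if "e > 0" for x e
  proof -
    obtain d where "d \<in> D" "d \<in> ball x e"
      using D(2)[of "ball x e"] \<open>e > 0\<close> by auto
    then show ?thesis
      using from_nat_into_surj[OF D(1)] by (metis mem_ball dist_commute)
  qed
  then show ?thesis using that by blast
qed

text \<open>Each of the countably many basic preimages is measurable for \<open>M\<close> up to a
  null set. Giving \<open>f\<close> a single constant value on the union of these null sets repairs
  all of them at once.\<close>

lemma completion_ex_borel_measurable_second_countable:
  fixes f :: "'a \<Rightarrow> 'b::second_countable_topology"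
  assumes f: "f \<in> borel_measurable (completion M)"
  shows "\<exists>h\<in>borel_measurable M. AE x in M. f x = h x"
proof -
  obtain B :: "'b set set" where B: "countable B" "topological_basis B"
    using ex_countable_basis by blast
  have "\<exists>N\<in>null_sets M. \<exists>S\<in>sets M. (f -` U \<inter> space M) - N = S - N" if "U \<in> B" for U
  proof -
    have "f -` U \<inter> space M \<in> sets (completion M)"
      using measurable_sets[OF f, of U] topological_basis_open[OF B(2) that] by simp
    then obtain S N N' where "f -` U \<inter> space M = S \<union> N" "S \<in> sets M" "N \<subseteq> N'" "N' \<in> null_sets M"
      by (rule sets_completionE)
    then show ?thesis by (intro bexI[of _ N'] bexI[of _ S]) auto
  qed
  then obtain N S where N: "\<And>U. U \<in> B \<Longrightarrow> N U \<in> null_sets M" and S: "\<And>U. U \<in> B \<Longrightarrow> S U \<in> sets M"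
    and fS: "\<And>U. U \<in> B \<Longrightarrow> (f -` U \<inter> space M) - N U = S U - N U"
    by metis
  define Z where "Z = (\<Union>U\<in>B. N U)"
  have Z: "Z \<in> null_sets M"
    unfolding Z_def using B(1) N by (rule null_sets_UN')
  define h where "h x = (if x \<in> Z then undefined else f x)" for x
  have "h \<in> borel_measurable M"
    unfolding borel_eq_countable_basis[OF B]
  proof (rule measurable_measure_of)
    fix U assume U: "U \<in> B"
    have "h -` U \<inter> space M = (S U - Z) \<union> (if undefined \<in> U then Z else {})"
    proof -
      have "(f -` U \<inter> space M) - Z = S U - Z"
        using fS[OF U] U by (auto simp: Z_def)
      moreover have "Z \<subseteq> space M" using Z sets.sets_into_space by blast
      ultimately show ?thesis
        by (fastforce simp: h_def split: if_splits)
    qed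
    then show "h -` U \<inter> space M \<in> sets M"
      using S[OF U] Z by auto
  qed auto
  moreover have "AE x in M. f x = h x"
    using AE_not_in[OF Z] by eventually_elim (simp add: h_def)
  ultimately show ?thesis by blast
qed

text \<open>
  The capacity argument: closed sets of the form \<open>\<Inter>k. closure (fst ` (R \<inter> UNIV \<times> L k))\<close>, with the
  \<open>L k\<close> shrinking to a totally bounded set, approximate the projection from the inside.
\<close>

lemma closed_projection_inner_approx:
  fixes R :: "('y::metric_space \<times> 'g::{complete_space, second_countable_topology}) set"
  assumes \<nu>: "sets \<nu> = sets borel" "finite_measure \<nu>" and R: "closed R"
    and a: "a < outer_measure_of \<nu> (fst ` R)"
  shows "\<exists>K. closed K \<and> K \<subseteq> fst ` R \<and> a \<le> emeasure \<nu> K"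
proof -
  interpret finite_measure \<nu> by fact
  have sp: "space \<nu> = UNIV" using sets_eq_imp_space_eq[OF \<nu>(1)] by simp
  obtain q :: "nat \<Rightarrow> 'g" where q: "\<And>x e. e > 0 \<Longrightarrow> \<exists>i. dist (q i) x < e"
    using ex_dense_sequence by blast
  define C where "C k n = (\<Union>i\<le>n. cball (q i) (inverse (Suc k)))" for k n :: nat
  have C: "closed (C k n)" for k n by (auto simp: C_def)
  define p where "p L = fst ` (R \<inter> UNIV \<times> L)" for L
  \<comment> \<open>Outer measure is continuous along increasing unions even of nonmeasurable sets,
    and measurability of projections is not yet known. Hence some \<open>C k n\<close> can be
    intersected with \<open>L\<close> while the projection keeps outer measure above
    \<open>a\<close>.\<close>
  have "\<exists>L. \<forall>k. (closed (L k) \<and> a < outer_measure_of \<nu> (p (L k))) \<and>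
         (L (Suc k) \<subseteq> L k \<and> (\<exists>n. L (Suc k) \<subseteq> C k n))"
  proof (rule dependent_nat_choice)
    show "\<exists>L. closed L \<and> a < outer_measure_of \<nu> (p L)"
      using a by (intro exI[of _ UNIV]) (simp add: p_def)
    fix L :: "'g set" and k assume L: "closed L \<and> a < outer_measure_of \<nu> (p L)"
    have "(\<Union>n. p (L \<inter> C k n)) = p L"
    proof
      show "p L \<subseteq> (\<Union>n. p (L \<inter> C k n))"
      proof
        fix y assume "y \<in> p L"
        then obtain h where h: "(y, h) \<in> R" "h \<in> L" by (auto simp: p_def)
        obtain i where "dist (q i) h < inverse (Suc k)" using q[of "inverse (Suc k)" h] by auto
        then have "h \<in> C k i" by (auto simp: C_def intro!: bexI[of _ i])
        then show "y \<in> (\<Union>n. p (L \<inter> C k n))" using h by (force simp: p_def)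
      qed
    qed (auto simp: p_def)
    moreover have "incseq (\<lambda>n. p (L \<inter> C k n))"
      by (fastforce simp: incseq_def p_def C_def)
    ultimately have "(SUP n. outer_measure_of \<nu> (p (L \<inter> C k n))) = outer_measure_of \<nu> (p L)"
      using SUP_outer_measure_of_incseq[of "\<lambda>n. p (L \<inter> C k n)" \<nu>] by (simp add: sp)
    then have "a < (SUP n. outer_measure_of \<nu> (p (L \<inter> C k n)))"
      using L by simp
    then obtain n where "a < outer_measure_of \<nu> (p (L \<inter> C k n))"
      unfolding less_SUP_iff by blast
    then show "\<exists>L'. (closed L' \<and> a < outer_measure_of \<nu> (p L')) \<and> L' \<subseteq> L \<and> (\<exists>n. L' \<subseteq> C k n)"
      using L C by (intro exI[of _ "L \<inter> C k n"]) auto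
  qed
  then obtain L where L: "\<And>k. a < outer_measure_of \<nu> (p (L k))" "\<And>k. L (Suc k) \<subseteq> L k"
    "\<And>k. \<exists>n. L (Suc k) \<subseteq> C k n"
    by blast
  have Ldec: "L n \<subseteq> L m" if "m \<le> n" for m n
    using L(2) that by (rule lift_Suc_antimono_le)
  define K where "K = (\<Inter>k. closure (p (L k)))"
  have "a \<le> emeasure \<nu> (closure (p (L k)))" for k
  proof -
    have "a \<le> outer_measure_of \<nu> (p (L k))" using L(1)[of k] by simp
    also have "\<dots> \<le> outer_measure_of \<nu> (closure (p (L k)))"
      by (intro outer_measure_of_mono closure_subset)
    also have "\<dots> = emeasure \<nu> (closure (p (L k)))"
      by (rule outer_measure_of_eq) (simp add: \<nu>(1))
    finally show ?thesis .
  qed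
  moreover have "(INF k. emeasure \<nu> (closure (p (L k)))) = emeasure \<nu> K"
    unfolding K_def
  proof (rule INF_emeasure_decseq)
    show "decseq (\<lambda>k. closure (p (L k)))"
      unfolding decseq_def p_def using Ldec by (intro allI impI closure_mono) blast
  qed (auto simp: \<nu>(1))
  ultimately have "a \<le> emeasure \<nu> K"
    by (metis INF_greatest)
  moreover have "K \<subseteq> fst ` R"
  proof
    fix y assume y: "y \<in> K"
    have "\<exists>z h. (z, h) \<in> R \<and> h \<in> L k \<and> dist z y < inverse (Suc k)" for k
    proof -
      have "y \<in> closure (p (L k))" using y by (auto simp: K_def)
      then obtain z where "z \<in> p (L k)" "dist z y < inverse (Suc k)"
        using closure_approachable[of y "p (L k)"] by (metis inverse_positive_iff_positive of_nat_0_less_iff zero_less_Suc)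
      moreover from this obtain h where "(z, h) \<in> R" "h \<in> L k" by (auto simp: p_def)
      ultimately show ?thesis by blast
    qed
    then obtain z h where zh: "\<And>k. (z k, h k) \<in> R" "\<And>k. h k \<in> L k" "\<And>k. dist (z k) y < inverse (Suc k)"
      by metis
    \<comment> \<open>For \<open>i > k\<close> the point \<open>h i\<close> lies in
      \<open>L (Suc k)\<close>, hence in finitely many balls of radius
      \<open>inverse (Suc k)\<close>. Total boundedness and completeness yield a convergent
      subsequence, whose limit lies over \<open>y\<close> because \<open>R\<close> is
      closed.\<close>
    have "compact (closure (range h))"
      unfolding compact_eq_totally_bounded
    proof (intro conjI allI impI)
      show "complete (closure (range h))"
        using complete_eq_closed by blast
      fix e :: real assume "0 < e"
      then obtain k where k: "inverse (Suc k) < e / 2" using reals_Archimedean[of "e/2"] by auto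
      obtain n where n: "L (Suc k) \<subseteq> C k n" using L(3) by blast
      have "range h \<subseteq> (\<Union>x\<in>h ` {..k} \<union> q ` {..n}. cball x (e / 2))"
      proof clarify
        fix i
        show "h i \<in> (\<Union>x\<in>h ` {..k} \<union> q ` {..n}. cball x (e / 2))"
        proof (cases "i \<le> k")
          case True
          then show ?thesis using \<open>0 < e\<close> by (intro UN_I[of "h i"]) auto
        next
          case False
          then have "h i \<in> C k n" using zh(2)[of i] Ldec[of "Suc k" i] n by auto
          then show ?thesis using k by (force simp: C_def)
        qed
      qed
      then have "closure (range h) \<subseteq> (\<Union>x\<in>h ` {..k} \<union> q ` {..n}. cball x (e / 2))"
        by (intro closure_minimal) auto
      also have "\<dots> \<subseteq> (\<Union>x\<in>h ` {..k} \<union> q ` {..n}. ball x e)"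
        using \<open>0 < e\<close> by (intro UN_mono) auto
      finally show "\<exists>F. finite F \<and> closure (range h) \<subseteq> (\<Union>x\<in>F. ball x e)"
        by (intro exI[of _ "h ` {..k} \<union> q ` {..n}"]) auto
    qed
    then obtain l r where lr: "strict_mono (r :: nat \<Rightarrow> nat)" "(h \<circ> r) \<longlonglongrightarrow> l"
      by (metis compact_imp_seq_compact seq_compactE closure_subset range_subsetD)
    have "(\<lambda>k. dist (z k) y) \<longlonglongrightarrow> 0"
      using zh(3) by (intro tendsto_sandwich[OF _ _ tendsto_const LIMSEQ_inverse_real_of_nat])
        (auto intro!: always_eventually less_imp_le)
    then have "z \<longlonglongrightarrow> y" by (simp add: tendsto_dist_iff[of z])
    then have "(\<lambda>k. (z (r k), h (r k))) \<longlonglongrightarrow> (y, l)"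
      using lr LIMSEQ_subseq_LIMSEQ[of z y r] by (intro tendsto_Pair) (auto simp: o_def)
    then have "(y, l) \<in> R"
      using closed_sequentially[OF R, of "\<lambda>k. (z (r k), h (r k))"] zh(1) by blast
    then show "y \<in> fst ` R" by force
  qed
  moreover have "closed K" by (auto simp: K_def)
  ultimately show ?thesis by blast
qed

text \<open>A measurable hull from outside and a countable union of closed sets from inside have the
  same finite measure, so the projection is squeezed up to a null set.\<close>

lemma closed_projection_measurable:
  fixes R :: "('y::metric_space \<times> 'g::{complete_space, second_countable_topology}) set"
  assumes \<nu>: "sets \<nu> = sets borel" "finite_measure \<nu>" and R: "closed R"
  shows "fst ` R \<in> sets (completion \<nu>)"
proof -
  interpret finite_measure \<nu> by fact
  have sp: "space \<nu> = UNIV" using sets_eq_imp_space_eq[OF \<nu>(1)] by simp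
  define m where "m = outer_measure_of \<nu> (fst ` R)"
  obtain E where E: "E \<in> sets \<nu>" "fst ` R \<subseteq> E" "m = emeasure \<nu> E"
    unfolding m_def using outer_measure_of_attain[of "fst ` R" \<nu>] sp by auto
  \<comment> \<open>When \<open>m = 0\<close> there is no \<open>a\<close> below \<open>m\<close> to
    approximate with, and the empty set does.\<close>
  have "\<exists>K. closed K \<and> K \<subseteq> fst ` R \<and> m \<le> emeasure \<nu> K + inverse (of_nat (Suc n))" for n
  proof (cases "m = 0")
    case True
    then show ?thesis by (intro exI[of _ "{}"]) auto
  next
    case False
    have "m < \<infinity>" by (simp add: E(3) emeasure_eq_measure)
    have "m - inverse (of_nat (Suc n)) < m"
      using False \<open>m < \<infinity>\<close> by (intro ennreal_between) (auto simp: zero_less_iff_neq_zero)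
    then obtain K where "closed K" "K \<subseteq> fst ` R" "m - inverse (of_nat (Suc n)) \<le> emeasure \<nu> K"
      using closed_projection_inner_approx[OF \<nu> R] unfolding m_def by blast
    then show ?thesis by (auto simp: ennreal_minus_le_iff add.commute)
  qed
  then obtain K where K: "\<And>n. closed (K n)" "\<And>n. K n \<subseteq> fst ` R"
    "\<And>n. m \<le> emeasure \<nu> (K n) + inverse (of_nat (Suc n))"
    by metis
  have KB: "(\<Union>n. K n) \<in> sets \<nu>" using K(1) by (auto simp: \<nu>(1))
  have "m \<le> emeasure \<nu> (\<Union>n. K n)"
  proof (rule ennreal_le_epsilon)
    fix e :: real assume "0 < e"
    then obtain n where n: "inverse (real (Suc n)) < e" using reals_Archimedean by blast
    have "m \<le> emeasure \<nu> (K n) + inverse (of_nat (Suc n))" by (rule K(3))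
    also have "\<dots> \<le> emeasure \<nu> (\<Union>n. K n) + ennreal e"
    proof (rule add_mono)
      show "emeasure \<nu> (K n) \<le> emeasure \<nu> (\<Union>n. K n)" using KB by (intro emeasure_mono) auto
      have "inverse (of_nat (Suc n)) = ennreal (inverse (real (Suc n)))"
        by (metis inverse_ennreal ennreal_of_nat_eq_real_of_nat of_nat_0_less_iff zero_less_Suc)
      then show "inverse (of_nat (Suc n)) \<le> ennreal e" using n by (simp add: ennreal_leI)
    qed
    finally show "m \<le> emeasure \<nu> (\<Union>n. K n) + ennreal e" .
  qed
  moreover have "emeasure \<nu> (\<Union>n. K n) \<le> m"
    unfolding E(3) using E K(2) by (intro emeasure_mono) blast+
  ultimately have "emeasure \<nu> (\<Union>n. K n) = emeasure \<nu> E"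
    using E(3) by simp
  then have "E - (\<Union>n. K n) \<in> null_sets \<nu>"
  proof (intro null_setsI)
    have "(\<Union>n. K n) \<subseteq> E" using K(2) E(2) by blast
    moreover have "emeasure \<nu> (\<Union>n. K n) \<noteq> \<infinity>" by (simp add: emeasure_eq_measure)
    ultimately show "emeasure \<nu> (E - (\<Union>n. K n)) = 0"
      using KB E(1) \<open>emeasure \<nu> (\<Union>n. K n) = emeasure \<nu> E\<close>
      by (subst emeasure_Diff) auto
  qed (use KB E(1) in auto)
  moreover have "(\<Union>n. K n) \<subseteq> fst ` R" using K(2) by blast
  ultimately show ?thesis
    using KB E(2)
    by (intro sets_completionI[of _ "\<Union>n. K n" "fst ` R - (\<Union>n. K n)" "E - (\<Union>n. K n)"]) blast+
qed

text \<open>The value is approximated by successive balls around the dense points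
  \<open>q i\<close>. At every stage the least index is taken for which some point of
  \<open>R\<close> above \<open>y\<close> remains; measurability of the projections makes this
  choice measurable, and the centres converge to a point of the closed fibre.\<close>

theorem measurable_selection_closed:
  fixes R :: "('y::metric_space \<times> 'g::{complete_space, second_countable_topology}) set"
  assumes \<nu>: "sets \<nu> = sets borel" "finite_measure \<nu>" and R: "closed R"
  shows "\<exists>f\<in>borel_measurable borel. AE y in \<nu>. y \<in> fst ` R \<longrightarrow> (y, f y) \<in> R"
proof -
  have sp: "space \<nu> = UNIV" using sets_eq_imp_space_eq[OF \<nu>(1)] by simp
  obtain q :: "nat \<Rightarrow> 'g" where q: "\<And>x e. e > 0 \<Longrightarrow> \<exists>i. dist (q i) x < e"
    using ex_dense_sequence by blast
  \<comment> \<open>A finite word of indices stands for an intersection of balls, the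
    \<open>k\<close>-th letter choosing the centre of the ball of radius
    \<open>inverse (Suc k)\<close>.\<close>
  define cl where "cl l = (\<Inter>k<length l. cball (q (l ! k)) (inverse (Suc k)))" for l :: "nat list"
  have cl_append: "cl (l @ [i]) = cl l \<inter> cball (q i) (inverse (Suc (length l)))" for l i
  proof -
    have "{..<length (l @ [i])} = insert (length l) {..<length l}" by auto
    then show ?thesis by (auto simp: cl_def nth_append)
  qed
  define P where "P l = fst ` (R \<inter> UNIV \<times> cl l)" for l
  have P: "P l \<in> sets (completion \<nu>)" for l
  proof -
    have "closed (cl l)" by (auto simp: cl_def)
    then show ?thesis
      unfolding P_def by (intro closed_projection_measurable \<nu> closed_Int R closed_Times) auto
  qed
  have Pex: "\<exists>i. y \<in> P (l @ [i])" if y: "y \<in> P l" for y l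
  proof -
    obtain h where h: "(y, h) \<in> R" "h \<in> cl l" using y by (auto simp: P_def)
    obtain i where "dist (q i) h < inverse (Suc (length l))"
      using q[of "inverse (Suc (length l))" h] by auto
    then have "h \<in> cl (l @ [i])" using h by (auto simp: cl_append)
    then show ?thesis using h by (force simp: P_def)
  qed
  define s where "s y = rec_nat [] (\<lambda>n l. l @ [LEAST i. y \<in> P (l @ [i])])" for y
  have s0: "s y 0 = []" and sS: "s y (Suc n) = s y n @ [LEAST i. y \<in> P (s y n @ [i])]" for y n
    by (simp_all add: s_def)
  have len: "length (s y n) = n" for y n by (induction n) (simp_all add: s0 sS)
  have nth: "s y n ! k = s y (Suc k) ! k" if "k < n" for y n k
    using that
  proof (induction n)
    case (Suc n)
    show ?case
    proof (cases "k = n")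
      case False
      then show ?thesis using Suc by (simp add: sS[of y n] nth_append len)
    qed simp
  qed simp
  \<comment> \<open>Words form a countable set, so it is enough that each word is chosen on a
    measurable set of points \<open>y\<close>. For \<open>y\<close> outside the projection the
    choice is meaningless but still measurable.\<close>
  have meas: "{y. s y n = l} \<in> sets (completion \<nu>)" for n l
  proof (induction n arbitrary: l)
    case 0
    then show ?case using sets.top[of "completion \<nu>"] by (cases l) (auto simp: s0 sp)
  next
    case (Suc n)
    show ?case
    proof (cases l rule: rev_cases)
      case Nil
      then show ?thesis by (simp add: sS)
    next
      case (snoc l' i)
      have "(\<lambda>y. LEAST i. y \<in> P (l' @ [i])) \<in> measurable (completion \<nu>) (count_space UNIV)"
        using P by (intro measurable_Least) (auto simp: pred_def sp)
      from measurable_sets[OF this, of "{i}"]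
      have "{y. (LEAST i. y \<in> P (l' @ [i])) = i} \<in> sets (completion \<nu>)"
        by (simp add: sp vimage_def)
      moreover have "{y. s y (Suc n) = l} = {y. s y n = l'} \<inter> {y. (LEAST i. y \<in> P (l' @ [i])) = i}"
        by (auto simp: snoc sS)
      ultimately show ?thesis using Suc by auto
    qed
  qed
  define f where "f n y = q (s y (Suc n) ! n)" for n y
  have f: "f n \<in> borel_measurable (completion \<nu>)" for n
  proof (rule measurableI)
    fix A :: "'g set" assume "A \<in> sets borel"
    have "f n -` A \<inter> space (completion \<nu>) = (\<Union>l\<in>{l. q (l ! n) \<in> A}. {y. s y (Suc n) = l})"
      by (auto simp: f_def sp)
    then show "f n -` A \<inter> space (completion \<nu>) \<in> sets (completion \<nu>)"
      using meas by (auto intro!: sets.countable_UN')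
  qed auto
  have lim: "\<exists>h. (\<lambda>n. f n y) \<longlonglongrightarrow> h \<and> (y, h) \<in> R" if y: "y \<in> fst ` R" for y
  proof -
    have "y \<in> P (s y n)" for n
    proof (induction n)
      case 0
      then show ?case using y by (force simp: s0 P_def cl_def)
    next
      case (Suc n)
      then show ?case unfolding sS by (rule LeastI_ex[OF Pex])
    qed
    then have "\<forall>n. \<exists>h. (y, h) \<in> R \<and> h \<in> cl (s y n)" by (force simp: P_def)
    then obtain h where h: "\<And>n. (y, h n) \<in> R" "\<And>n. h n \<in> cl (s y n)" by metis
    \<comment> \<open>The witnesses \<open>h n\<close> may change with \<open>n\<close>, but all
      later ones lie in the ball chosen at stage \<open>k\<close>; this makes them a Cauchy
      sequence.\<close>
    have d: "dist (f k y) (h n) \<le> inverse (Suc k)" if "k < n" for k n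
    proof -
      have "dist (q (s y n ! k)) (h n) \<le> inverse (Suc k)"
        using h(2)[of n] that by (auto simp: cl_def len)
      then show ?thesis using nth[OF that, of y] by (simp add: f_def)
    qed
    have "Cauchy h"
    proof (rule metric_CauchyI)
      fix e :: real assume "0 < e"
      then obtain k where k: "inverse (Suc k) < e / 2" using reals_Archimedean[of "e/2"] by auto
      have "dist (h m) (h n) < e" if "Suc k \<le> m" "Suc k \<le> n" for m n
      proof -
        have "dist (h m) (h n) \<le> dist (f k y) (h m) + dist (f k y) (h n)"
          by (metis dist_triangle dist_commute)
        then show ?thesis using d[of k m] d[of k n] that k by auto
      qed
      then show "\<exists>M. \<forall>m\<ge>M. \<forall>n\<ge>M. dist (h m) (h n) < e" by blast
    qed
    then obtain l where l: "h \<longlonglongrightarrow> l" using Cauchy_convergent_iff convergent_def by blast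
    have "(\<lambda>n. (y, h n)) \<longlonglongrightarrow> (y, l)" using l by (intro tendsto_Pair) auto
    then have "(y, l) \<in> R" using closed_sequentially[OF R, of "\<lambda>n. (y, h n)"] h(1) by blast
    moreover have "(\<lambda>n. f n y) \<longlonglongrightarrow> l"
    proof (rule tendsto_dist_iff[THEN iffD2])
      have "dist (f n y) l \<le> inverse (Suc n) + dist (h (Suc n)) l" for n
        using d[of n "Suc n"] dist_triangle[of "f n y" l "h (Suc n)"] by auto
      moreover have "(\<lambda>n. inverse (Suc n) + dist (h (Suc n)) l) \<longlonglongrightarrow> 0 + 0"
        using l LIMSEQ_Suc[of h l]
        by (intro tendsto_add LIMSEQ_inverse_real_of_nat) (simp add: tendsto_dist_iff[symmetric])
      ultimately show "(\<lambda>n. dist (f n y) l) \<longlonglongrightarrow> 0"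
        by (intro tendsto_sandwich[of "\<lambda>n. 0" "\<lambda>n. dist (f n y) l" _ "\<lambda>n. inverse (Suc n) + dist (h (Suc n)) l"]) auto
    qed
    ultimately show ?thesis by blast
  qed
  define A where "A = fst ` R"
  have A: "A \<in> sets (completion \<nu>)" unfolding A_def by (intro closed_projection_measurable \<nu> R)
  define g where "g y = (if y \<in> A then SOME h. (\<lambda>n. f n y) \<longlonglongrightarrow> h \<and> (y, h) \<in> R else q 0)" for y
  have g: "(\<lambda>n. f n y) \<longlonglongrightarrow> g y \<and> (y, g y) \<in> R" if "y \<in> A" for y
    using someI_ex[OF lim[of y]] that by (auto simp: g_def A_def)
  have "g \<in> borel_measurable (completion \<nu>)"
  proof (rule borel_measurable_LIMSEQ_metric[where f = "\<lambda>n y. if y \<in> A then f n y else q 0"])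
    show "(\<lambda>y. if y \<in> A then f n y else q 0) \<in> borel_measurable (completion \<nu>)" for n
      using f A by (intro measurable_If_set) (auto simp: sp)
    show "(\<lambda>n. if y \<in> A then f n y else q 0) \<longlonglongrightarrow> g y" for y
      using g[of y] by (cases "y \<in> A") (auto simp: g_def)
  qed
  \<comment> \<open>The selector is measurable only for the completion; changing it on a null set
    makes it Borel, at the price of an almost everywhere conclusion.\<close>
  then obtain h where h: "h \<in> borel_measurable \<nu>" "AE y in \<nu>. g y = h y"
    using completion_ex_borel_measurable_second_countable by blast
  have "AE y in \<nu>. y \<in> fst ` R \<longrightarrow> (y, h y) \<in> R"
    using h(2)
  proof eventually_elim
    case (elim y)
    then show ?case using g[of y] by (simp add: A_def)
  qed
  moreover have "h \<in> borel_measurable borel" using h(1) measurable_cong_sets[OF \<nu>(1) refl] by auto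
  ultimately show ?thesis by blast
qed

section \<open>Convergence in measure\<close>

definition conv_measure :: "'x measure \<Rightarrow> (nat \<Rightarrow> 'x \<Rightarrow> 'z::topological_space) \<Rightarrow> ('x \<Rightarrow> 'z) \<Rightarrow> bool" where
  "conv_measure M f g \<longleftrightarrow>
     (\<forall>r :: nat \<Rightarrow> nat. strict_mono r \<longrightarrow>
       (\<exists>s :: nat \<Rightarrow> nat. strict_mono s \<and> (AE x in M. (\<lambda>n. f (r (s n)) x) \<longlonglongrightarrow> g x)))"

text \<open>A diagonal choice, used to pass to a subsequence along which measures are bounded by
  \<open>(1/2) ^ j\<close> and Borel-Cantelli applies.\<close>

lemma strict_mono_eventually_choice:
  fixes P :: "nat \<Rightarrow> nat \<Rightarrow> bool"
  assumes "\<forall>j. \<forall>\<^sub>F n in sequentially. P j n"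
  shows "\<exists>r. strict_mono r \<and> (\<forall>j. P j (r j))"
proof -
  have "\<exists>r. \<forall>j. P j (r j) \<and> r j < r (Suc j)"
  proof (rule dependent_nat_choice)
    show "\<exists>n. P 0 n"
      using assms[rule_format, of 0] by (auto simp: eventually_sequentially)
    show "\<exists>m. P (Suc j) m \<and> n < m" for n j
    proof -
      obtain N where "\<And>m. N \<le> m \<Longrightarrow> P (Suc j) m"
        using assms[rule_format, of "Suc j"] by (auto simp: eventually_sequentially)
      then show ?thesis by (intro exI[of _ "max N (Suc n)"]) auto
    qed
  qed
  then show ?thesis by (auto simp: strict_mono_Suc_iff)
qed

lemma strict_mono_tendsto:
  assumes "strict_mono (r :: nat \<Rightarrow> nat)" "f \<longlonglongrightarrow> l"
  shows "(\<lambda>n. f (r n)) \<longlonglongrightarrow> l"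
  using LIMSEQ_subseq_LIMSEQ[OF assms(2,1)] by (simp add: o_def)

lemma strict_mono_o':
  assumes "strict_mono (r :: nat \<Rightarrow> nat)" "strict_mono (s :: nat \<Rightarrow> nat)"
  shows "strict_mono (\<lambda>n. r (s n))"
  using strict_mono_o[OF assms] by (simp add: o_def)

text \<open>Borel-Cantelli for a measure that may be infinite. The offset \<open>k\<close> serves
  families whose bound holds only once the index has passed a parameter of the family.\<close>

lemma AE_eventually_notin:
  fixes A :: "nat \<Rightarrow> 'a set"
  assumes A: "\<And>n. A n \<in> sets N" and le: "\<And>n. k \<le> n \<Longrightarrow> emeasure N (A n) \<le> ennreal ((1/2) ^ n)"
  shows "AE x in N. \<forall>\<^sub>F n in sequentially. x \<notin> A n"
proof -
  have fin: "emeasure N (A (n + k)) < \<infinity>" for n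
    using le[of "n + k"] by (auto intro: le_less_trans)
  have "AE x in N. \<forall>\<^sub>F n in sequentially. x \<in> space N - A (n + k)"
  proof (rule borel_cantelli_AE1)
    have "measure N (A (n + k)) \<le> (1/2) ^ n" for n
    proof -
      have "measure N (A (n + k)) \<le> (1/2) ^ (n + k)"
        using le[of "n + k"] by (simp add: measure_def enn2real_leI)
      also have "\<dots> \<le> (1/2) ^ n" by (rule power_decreasing) auto
      finally show ?thesis .
    qed
    then show "summable (\<lambda>n. measure N (A (n + k)))"
      by (intro summable_comparison_test'[OF summable_geometric[of "1/2::real"]]) auto
  qed (use A fin in auto)
  then show ?thesis
  proof eventually_elim
    case (elim x)
    then have "\<forall>\<^sub>F n in sequentially. x \<notin> A (n + k)"
      by eventually_elim simp
    then show ?case using eventually_sequentially_seg[of "\<lambda>n. x \<notin> A n" k] by simp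
  qed
qed

text \<open>Dominated convergence with the indicator of \<open>V\<close> as majorant: the common set
  of finite measure is what turns almost everywhere convergence into small measure.\<close>

lemma eventually_emeasure_le:
  assumes B: "\<And>n. B n \<in> sets N" "\<And>n. B n \<subseteq> V" and V: "V \<in> sets N" "emeasure N V < \<infinity>"
    and ae: "AE x in N. \<forall>\<^sub>F n in sequentially. x \<notin> B n" and e: "e > 0"
  shows "\<forall>\<^sub>F n in sequentially. emeasure N (B n) \<le> ennreal e"
proof -
  have fin: "emeasure N (B n) < \<infinity>" for n
    using emeasure_mono[OF B(2) V(1)] V(2) by (rule le_less_trans)
  have "(\<lambda>n. \<integral>x. indicator (B n) x \<partial>N) \<longlonglongrightarrow> (\<integral>x. (0::real) \<partial>N)"
  proof (rule integral_dominated_convergence[where w = "indicator V"])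
    show "integrable N (indicat_real V)" using V by auto
    show "AE x in N. (\<lambda>n. indicat_real (B n) x) \<longlonglongrightarrow> 0"
      using ae
    proof eventually_elim
      case (elim x)
      then have "\<forall>\<^sub>F n in sequentially. indicat_real (B n) x = 0"
        by eventually_elim simp
      then show ?case by (rule tendsto_eventually)
    qed
    show "AE x in N. norm (indicat_real (B n) x) \<le> indicat_real V x" for n
      using B(2)[of n] by (auto simp: indicator_def)
  qed (use B in auto)
  then have "(\<lambda>n. measure N (B n)) \<longlonglongrightarrow> 0"
    using B(1) sets.sets_into_space[OF B(1)] by (simp add: Int_absorb2)
  then have "\<forall>\<^sub>F n in sequentially. measure N (B n) < e"
    using e by (rule order_tendstoD)
  then show ?thesis
    by eventually_elim (use fin in \<open>auto simp: emeasure_eq_ennreal_measure less_top ennreal_leI\<close>)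
qed

lemma conv_measure_AE:
  assumes "AE x in M. (\<lambda>n. f n x) \<longlonglongrightarrow> g x"
  shows "conv_measure M f g"
  unfolding conv_measure_def
proof (intro allI impI exI conjI)
  fix r :: "nat \<Rightarrow> nat" assume "strict_mono r"
  then show "AE x in M. (\<lambda>n. f (r (id n)) x) \<longlonglongrightarrow> g x"
    using assms by (auto elim: eventually_mono dest: strict_mono_tendsto)
qed (auto simp: strict_mono_def)

lemma conv_measure_const: "conv_measure M (\<lambda>n. f) f"
  by (rule conv_measure_AE) simp

lemma conv_measureD:
  assumes "conv_measure M f g" "strict_mono (r :: nat \<Rightarrow> nat)"
  obtains s :: "nat \<Rightarrow> nat" where "strict_mono s" "AE x in M. (\<lambda>n. f (r (s n)) x) \<longlonglongrightarrow> g x"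
  using assms by (auto simp: conv_measure_def)

lemma conv_measureD2:
  assumes f: "conv_measure M f g" and f': "conv_measure M f' g'" and r: "strict_mono (r :: nat \<Rightarrow> nat)"
  obtains s :: "nat \<Rightarrow> nat" where "strict_mono s" "AE x in M. (\<lambda>n. f (r (s n)) x) \<longlonglongrightarrow> g x"
    "AE x in M. (\<lambda>n. f' (r (s n)) x) \<longlonglongrightarrow> g' x"
proof -
  obtain s where s: "strict_mono s" "AE x in M. (\<lambda>n. f (r (s n)) x) \<longlonglongrightarrow> g x"
    using conv_measureD[OF f r] .
  obtain t where t: "strict_mono t" "AE x in M. (\<lambda>n. f' (r (s (t n))) x) \<longlonglongrightarrow> g' x"
    using conv_measureD[OF f' strict_mono_o'[OF r s(1)]] .
  have "AE x in M. (\<lambda>n. f (r (s (t n))) x) \<longlonglongrightarrow> g x"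
    using s(2) by eventually_elim (rule strict_mono_tendsto[OF t(1)])
  then show ?thesis using that[of "\<lambda>n. s (t n)"] t(2) strict_mono_o'[OF s(1) t(1)] by auto
qed

lemma conv_measure_cong_AE:
  assumes f: "\<And>n. AE x in M. f n x = f' n x" and g: "AE x in M. g x = g' x"
    and "conv_measure M f g"
  shows "conv_measure M f' g'"
  unfolding conv_measure_def
proof (intro allI impI)
  fix r :: "nat \<Rightarrow> nat" assume "strict_mono r"
  then obtain s where s: "strict_mono s" "AE x in M. (\<lambda>n. f (r (s n)) x) \<longlonglongrightarrow> g x"
    using conv_measureD[OF assms(3)] by metis
  have "AE x in M. \<forall>n. f n x = f' n x"
    using f by (simp add: AE_all_countable)
  then have "AE x in M. (\<lambda>n. f' (r (s n)) x) \<longlonglongrightarrow> g' x"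
    using s(2) g by eventually_elim simp
  then show "\<exists>s. strict_mono s \<and> (AE x in M. (\<lambda>n. f' (r (s n)) x) \<longlonglongrightarrow> g' x)"
    using s(1) by blast
qed

text \<open>The extra argument \<open>x\<close> admits maps that depend on the point, such as
  \<open>\<lambda>x a b. \<phi> a x\<close>, which turns a cocycle into its transformation.\<close>

lemma conv_measure_map2:
  assumes f: "conv_measure M f g" and f': "conv_measure M f' g'"
    and F: "\<And>x u v a b. u \<longlonglongrightarrow> a \<Longrightarrow> v \<longlonglongrightarrow> b \<Longrightarrow> (\<lambda>n. F x (u n) (v n)) \<longlonglongrightarrow> F x a b"
  shows "conv_measure M (\<lambda>n x. F x (f n x) (f' n x)) (\<lambda>x. F x (g x) (g' x))"
  unfolding conv_measure_def
proof (intro allI impI)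
  fix r :: "nat \<Rightarrow> nat" assume r: "strict_mono r"
  obtain s where s: "strict_mono s" "AE x in M. (\<lambda>n. f (r (s n)) x) \<longlonglongrightarrow> g x"
    "AE x in M. (\<lambda>n. f' (r (s n)) x) \<longlonglongrightarrow> g' x"
    by (rule conv_measureD2[OF f f' r])
  have "AE x in M. (\<lambda>n. F x (f (r (s n)) x) (f' (r (s n)) x)) \<longlonglongrightarrow> F x (g x) (g' x)"
    using s(2,3) by eventually_elim (rule F)
  then show "\<exists>s. strict_mono s \<and> (AE x in M. (\<lambda>n. F x (f (r (s n)) x) (f' (r (s n)) x)) \<longlonglongrightarrow> F x (g x) (g' x))"
    using s(1) by blast
qed

lemma conv_measure_unique:
  fixes g :: "'x \<Rightarrow> 'z::t2_space"
  assumes "conv_measure M f g" "conv_measure M f g'"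
  shows "AE x in M. g x = g' x"
proof -
  obtain s :: "nat \<Rightarrow> nat" where "AE x in M. (\<lambda>n. f (id (s n)) x) \<longlonglongrightarrow> g x"
    "AE x in M. (\<lambda>n. f (id (s n)) x) \<longlonglongrightarrow> g' x"
    by (rule conv_measureD2[OF assms strict_mono_id])
  then show ?thesis
    by eventually_elim (rule LIMSEQ_unique)
qed

lemma tendsto_subseq_of_subseq:
  fixes a :: "nat \<Rightarrow> 'z::topological_space"
  assumes "\<And>r :: nat \<Rightarrow> nat. strict_mono r \<Longrightarrow> \<exists>s :: nat \<Rightarrow> nat. strict_mono s \<and> (\<lambda>n. a (r (s n))) \<longlonglongrightarrow> l"
  shows "a \<longlonglongrightarrow> l"
proof (rule topological_tendstoI, rule ccontr)
  fix S assume S: "open S" "l \<in> S" "\<not> (\<forall>\<^sub>F n in sequentially. a n \<in> S)"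
  then have inf: "infinite {n. a n \<notin> S}"
    by (simp add: not_eventually frequently_cofinite flip: cofinite_eq_sequentially)
  define r where "r = enumerate {n. a n \<notin> S}"
  have r: "strict_mono r" "\<And>n. a (r n) \<notin> S"
    using strict_mono_enumerate[OF inf] enumerate_in_set[OF inf] by (auto simp: r_def)
  obtain s where "(\<lambda>n. a (r (s n))) \<longlonglongrightarrow> l" using assms[OF r(1)] by blast
  then have "\<forall>\<^sub>F n in sequentially. a (r (s n)) \<in> S"
    using S(1,2) by (rule topological_tendstoD)
  then show False using r(2) by (auto simp: eventually_sequentially)
qed

text \<open>Convergence of the integrals yields almost everywhere convergent subsequences;
  conversely, dominated convergence with the constant \<open>B\<close> applies along subsequences.
  \<open>N\<close> and \<open>M\<close> need to agree only in their null sets.\<close>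

lemma conv_measure_iff_integral:
  assumes "finite_measure N" and eq: "sets N = sets M" "null_sets N = null_sets M"
    and m: "\<And>n. (\<lambda>x. D (f n x) (g x)) \<in> borel_measurable N"
    and bd: "\<And>y z. 0 \<le> D y z" "\<And>y z. D y z \<le> (B::real)"
    and D: "\<And>u a. (\<lambda>n. D (u n) a) \<longlonglongrightarrow> 0 \<longleftrightarrow> u \<longlonglongrightarrow> a"
  shows "(\<lambda>n. \<integral>x. D (f n x) (g x) \<partial>N) \<longlonglongrightarrow> 0 \<longleftrightarrow> conv_measure M f g"
proof -
  interpret finite_measure N by fact
  have AE_eq: "(AE x in N. P x) \<longleftrightarrow> (AE x in M. P x)" for P
    using eq sets_eq_imp_space_eq[OF eq(1)] by (simp add: eventually_ae_filter)
  have int: "integrable N (\<lambda>x. D (f n x) (g x))" for n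
    using bd by (intro integrable_const_bound[of _ B]) (auto simp: m)
  show ?thesis
  proof
    assume L: "(\<lambda>n. \<integral>x. D (f n x) (g x) \<partial>N) \<longlonglongrightarrow> 0"
    show "conv_measure M f g"
      unfolding conv_measure_def
    proof (intro allI impI)
      fix r :: "nat \<Rightarrow> nat" assume r: "strict_mono r"
      have "\<exists>s. strict_mono s \<and> (AE x in N. (\<lambda>n. D (f (r (s n)) x) (g x)) \<longlonglongrightarrow> 0)"
      proof (rule tendsto_L1_AE_subseq)
        show "integrable N (\<lambda>x. D (f (r n) x) (g x))" for n by (rule int)
        show "(\<lambda>n. \<integral>x. norm (D (f (r n) x) (g x)) \<partial>N) \<longlonglongrightarrow> 0"
          using strict_mono_tendsto[OF r L] bd(1) by simp
      qed
      then show "\<exists>s. strict_mono s \<and> (AE x in M. (\<lambda>n. f (r (s n)) x) \<longlonglongrightarrow> g x)"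
        by (simp add: D AE_eq)
    qed
  next
    assume C: "conv_measure M f g"
    show "(\<lambda>n. \<integral>x. D (f n x) (g x) \<partial>N) \<longlonglongrightarrow> 0"
    proof (rule tendsto_subseq_of_subseq)
      fix r :: "nat \<Rightarrow> nat" assume r: "strict_mono r"
      obtain s where s: "strict_mono s" "AE x in M. (\<lambda>n. f (r (s n)) x) \<longlonglongrightarrow> g x"
        using conv_measureD[OF C r] .
      have "(\<lambda>n. \<integral>x. D (f (r (s n)) x) (g x) \<partial>N) \<longlonglongrightarrow> (\<integral>x. 0 \<partial>N)"
      proof (rule integral_dominated_convergence[where w = "\<lambda>x. B"])
        show "AE x in N. (\<lambda>n. D (f (r (s n)) x) (g x)) \<longlonglongrightarrow> 0"
          using s(2) by (simp add: D AE_eq)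
      qed (use m bd in auto)
      then show "\<exists>s. strict_mono s \<and> (\<lambda>n. \<integral>x. D (f (r (s n)) x) (g x) \<partial>N) \<longlonglongrightarrow> 0"
        using s(1) by auto
    qed
  qed
qed

section \<open>Composition with measure preserving maps\<close>

definition mp_map :: "'x::topological_space measure \<Rightarrow> ('x \<Rightarrow> 'x) \<Rightarrow> bool" where
  "mp_map M S \<longleftrightarrow> S \<in> borel \<rightarrow>\<^sub>M borel \<and> (\<forall>A\<in>sets borel. emeasure M (S -` A) = emeasure M A)"

locale locally_finite_borel =
  fixes M \<mu> :: "'x::polish_space measure"
  assumes sets_M [simp, measurable_cong]: "sets M = sets borel"
    and locally_finite: "locally_finite_measure M"
    and equiv: "equivalent_probability M \<mu>"
begin

lemma space_M [simp]: "space M = UNIV"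
  using sets_eq_imp_space_eq[OF sets_M] by simp

lemma sets_mu [simp, measurable_cong]: "sets \<mu> = sets borel"
  using equiv by (simp add: equivalent_probability_def)

lemma space_mu [simp]: "space \<mu> = UNIV"
  using sets_eq_imp_space_eq[OF sets_mu] by simp

lemma prob_mu: "prob_space \<mu>"
  using equiv by (simp add: equivalent_probability_def)

lemma AE_mu_iff: "(AE x in \<mu>. P x) \<longleftrightarrow> (AE x in M. P x)"
  using equiv by (simp add: equivalent_probability_def eventually_ae_filter)

text \<open>Lindelof reduces the neighbourhoods of finite measure to countably many, and finite
  unions make them increase. Keeping the sets open lets them trap convergent sequences.\<close>

lemma ex_open_exhaustion:
  obtains U :: "nat \<Rightarrow> 'x set" where "\<And>n. open (U n)" "incseq U" "(\<Union>n. U n) = UNIV"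
    "\<And>n. emeasure M (U n) < \<infinity>"
proof -
  obtain V where V: "\<And>x. open (V x)" "\<And>x. x \<in> V x" "\<And>x. emeasure M (V x) < \<infinity>"
    using locally_finite unfolding locally_finite_measure_def by metis
  obtain F where F: "F \<subseteq> range V" "countable F" "\<Union>F = \<Union>(range V)"
    using Lindelof[of "range V"] V(1) by auto
  have ne: "F \<noteq> {}" and cov: "\<Union>F = UNIV" using F(3) V(2) by auto
  define U where "U n = (\<Union>i\<le>n. from_nat_into F i)" for n :: nat
  have FF: "from_nat_into F i \<in> F" for i by (rule from_nat_into[OF ne])
  have op: "open (from_nat_into F i)" "emeasure M (from_nat_into F i) < \<infinity>" for i
  proof -
    obtain x where "from_nat_into F i = V x" using FF[of i] F(1) by blast
    then show "open (from_nat_into F i)" "emeasure M (from_nat_into F i) < \<infinity>"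
      using V(1,3)[of x] by simp_all
  qed
  show ?thesis
  proof
    show "open (U n)" for n unfolding U_def using op by blast
    show "incseq U" by (fastforce simp: U_def incseq_def)
    have "(\<Union>n. U n) = (\<Union>i. from_nat_into F i)" by (auto simp: U_def)
    then show "(\<Union>n. U n) = UNIV" using range_from_nat_into[OF ne F(2)] cov by simp
    show "emeasure M (U n) < \<infinity>" for n
    proof -
      have "emeasure M (U n) \<le> (\<Sum>i\<le>n. emeasure M (from_nat_into F i))"
        unfolding U_def using op(1) by (intro emeasure_subadditive_finite) auto
      also have "\<dots> < \<infinity>" using op(2) by simp
      finally show ?thesis .
    qed
  qed
qed

text \<open>Outer regularity holds for finite measures, so \<open>M\<close> is first cut down to
  \<open>U\<close> by a density; nothing is claimed about \<open>V\<close> outside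
  \<open>U\<close>.\<close>

lemma open_approx:
  assumes U: "open U" "emeasure M U < \<infinity>" and A: "A \<in> sets borel" and e: "e > 0"
  obtains V where "open V" "A \<subseteq> V" "emeasure M (U \<inter> V - A) \<le> ennreal e"
proof -
  define N where "N = density M (indicator U)"
  have N: "emeasure N B = emeasure M (U \<inter> B)" if "B \<in> sets borel" for B
    unfolding N_def using that U(1)
    by (subst emeasure_density) (auto simp: indicator_inter_arith[symmetric] intro!: borel_measurable_indicator)
  have sN: "sets N = sets borel" and spN: "space N = UNIV" by (simp_all add: N_def)
  have fin: "emeasure N (space N) \<noteq> \<infinity>" using N[of UNIV] U by (simp add: spN)
  have finA: "emeasure N A < \<infinity>"
    using fin emeasure_mono[of A "space N" N] by (simp add: spN sN less_top[symmetric] neq_top_trans)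
  have "(INF V\<in>{V. A \<subseteq> V \<and> open V}. emeasure N V) < emeasure N A + ennreal e"
    using finA e ennreal_add_left_cancel_less[of "emeasure N A" 0 "ennreal e"]
    by (subst outer_regular[OF sN fin A, symmetric]) simp
  then obtain V where V: "A \<subseteq> V" "open V" "emeasure N V < emeasure N A + ennreal e"
    unfolding INF_less_iff by blast
  have "U \<inter> V - A = U \<inter> (V - A)" by auto
  then have "emeasure M (U \<inter> V - A) = emeasure N (V - A)"
    using V(2) A by (simp add: N)
  also have "\<dots> = emeasure N V - emeasure N A"
    using V A finA by (intro emeasure_Diff) (auto simp: sN)
  also have "\<dots> \<le> ennreal e"
    using V(3) finA by (auto simp: ennreal_minus_le_iff less_top less_imp_le)
  finally show ?thesis using V that by blast
qed

text \<open>
  The values \<open>S n x\<close> eventually stay in a set of finite measure on which \<open>f\<close> and \<open>g\<close> can be controlled;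
  the exceptional sets are pulled back by the measure preserving maps \<open>S n\<close> without growing, so that
  the Borel--Cantelli lemma applies along a subsequence.
\<close>

lemma AE_subseq_compose:
  fixes f :: "nat \<Rightarrow> 'x \<Rightarrow> 'z::{metric_space, second_countable_topology}"
  assumes S: "\<And>n. mp_map M (S n)" and T [measurable]: "T \<in> borel \<rightarrow>\<^sub>M borel"
    and ST: "AE x in M. (\<lambda>n. S n x) \<longlonglongrightarrow> T x"
    and f [measurable]: "\<And>n. f n \<in> borel \<rightarrow>\<^sub>M borel" and g [measurable]: "g \<in> borel \<rightarrow>\<^sub>M borel"
    and fg: "AE x in M. (\<lambda>n. f n x) \<longlonglongrightarrow> g x"
  obtains r :: "nat \<Rightarrow> nat" where "strict_mono r" "AE x in M. (\<lambda>n. f (r n) (S (r n) x)) \<longlonglongrightarrow> g (T x)"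
proof -
  interpret \<mu>: prob_space \<mu> by (rule prob_mu)
  obtain U where U: "\<And>n. open (U n)" "incseq U" "(\<Union>n. U n) = UNIV" "\<And>n. emeasure M (U n) < \<infinity>"
    using ex_open_exhaustion by blast
  have [measurable]: "S n \<in> borel \<rightarrow>\<^sub>M borel" and Spres: "A \<in> sets borel \<Longrightarrow> emeasure M (S n -` A) = emeasure M A" for n A
    using S by (auto simp: mp_map_def)
  have SA: "S n -` A \<in> sets borel" if "A \<in> sets borel" for n A
    using measurable_sets[of "S n" borel borel A] that by simp
  have UB [measurable]: "U n \<in> sets borel" for n using U(1) by simp
  obtain W0 :: "'z set set" where W0: "countable W0" "topological_basis W0"
    using ex_countable_basis by blast
  have "W0 \<noteq> {}" using topological_basisE[OF W0(2) open_UNIV UNIV_I] by blast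
  define W where "W = from_nat_into W0"
  have Wop [measurable]: "W i \<in> sets borel" for i
    using topological_basis_open[OF W0(2) from_nat_into[OF \<open>W0 \<noteq> {}\<close>]] by (simp add: W_def)
  have Wb: "\<exists>i. y \<in> W i \<and> W i \<subseteq> Q" if Q: "open Q" "y \<in> Q" for y Q
  proof -
    obtain B where "B \<in> W0" "y \<in> B" "B \<subseteq> Q"
      using topological_basisE[OF W0(2) Q] by blast
    then show ?thesis using from_nat_into_surj[OF W0(1)] by (metis W_def)
  qed
  \<comment> \<open>As \<open>g\<close> is merely measurable, \<open>A i\<close> need not be open
    and convergence to a point of it says nothing. It is replaced by open supersets
    \<open>V i j\<close>, which \<open>S n x\<close> enters eventually, and whose excess over
    \<open>A i\<close> inside \<open>U j\<close> is small.\<close>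
  define A where "A i = g -` W i" for i
  have A [measurable]: "A i \<in> sets borel" for i
    unfolding A_def using measurable_sets[OF g Wop] by simp
  have "\<exists>V. open V \<and> A i \<subseteq> V \<and> emeasure M (U j \<inter> V - A i) \<le> ennreal ((1/2) ^ j)" for i j
  proof -
    have "0 < (1/2 :: real) ^ j" by simp
    from open_approx[OF U(1)[of j] U(4)[of j] A[of i] this] show ?thesis by blast
  qed
  then obtain V where V: "\<And>i j. open (V i j)" "\<And>i j. A i \<subseteq> V i j"
    "\<And>i j. emeasure M (U j \<inter> V i j - A i) \<le> ennreal ((1/2) ^ j)"
    by metis
  have VB [measurable]: "V i j \<in> sets borel" for i j using V(1) by simp
  \<comment> \<open>\<open>P\<close> consists of points \<open>x\<close> and is never pulled back,
    so \<open>\<mu>\<close> may measure it. \<open>D\<close> and the excess of \<open>V i j\<close>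
    over \<open>A i\<close> contain values \<open>S n x\<close>; they are pulled back along
    \<open>S n\<close> and must be measured by the preserved \<open>M\<close>.\<close>
  define P where "P i j n = {x. T x \<in> V i j \<and> S n x \<notin> V i j}" for i j n
  define D where "D j n = {y \<in> U j. dist (f n y) (g y) > inverse (Suc j)}" for j n :: nat
  have Pm: "P i j n \<in> sets borel" for i j n
  proof -
    have "{x \<in> space borel. T x \<in> V i j \<and> S n x \<notin> V i j} \<in> sets borel" by measurable
    then show ?thesis by (simp add: P_def)
  qed
  have Dm: "D j n \<in> sets borel" for j n
  proof -
    have "{y \<in> space borel. y \<in> U j \<and> dist (f n y) (g y) > inverse (Suc j)} \<in> sets borel" by measurable
    then show ?thesis by (simp add: D_def)
  qed
  have evP: "\<forall>\<^sub>F n in sequentially. emeasure \<mu> (P i j n) \<le> ennreal ((1/2) ^ j)" for i j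
  proof (rule eventually_emeasure_le[where V = UNIV])
    have "AE x in M. \<forall>\<^sub>F n in sequentially. x \<notin> P i j n"
      using ST
    proof eventually_elim
      case (elim x)
      show ?case
      proof (cases "T x \<in> V i j")
        case True
        then have "\<forall>\<^sub>F n in sequentially. S n x \<in> V i j"
          using topological_tendstoD[OF elim V(1)] by blast
        then show ?thesis by eventually_elim (simp add: P_def)
      qed (simp add: P_def)
    qed
    then show "AE x in \<mu>. \<forall>\<^sub>F n in sequentially. x \<notin> P i j n"
      by (simp add: AE_mu_iff)
  qed (use Pm \<mu>.emeasure_space_1 in \<open>auto\<close>)
  have evD: "\<forall>\<^sub>F n in sequentially. emeasure M (D j n) \<le> ennreal ((1/2) ^ j)" for j
  proof (rule eventually_emeasure_le[where V = "U j"])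
    show "AE x in M. \<forall>\<^sub>F n in sequentially. x \<notin> D j n"
      using fg
    proof eventually_elim
      case (elim x)
      then have "\<forall>\<^sub>F n in sequentially. dist (f n x) (g x) < inverse (Suc j)"
        by (rule tendstoD) simp
      then show ?case by eventually_elim (simp add: D_def)
    qed
  qed (use Dm U in \<open>auto simp: D_def\<close>)
  \<comment> \<open>Only the finitely many \<open>i \<le> j\<close> are treated at stage
    \<open>j\<close>, so that one index can serve them all; each fixed \<open>i\<close> is covered
    from stage \<open>i\<close> on.\<close>
  have "\<forall>\<^sub>F n in sequentially. emeasure M (D j n) \<le> ennreal ((1/2) ^ j) \<and>
      (\<forall>i\<in>{..j}. emeasure \<mu> (P i j n) \<le> ennreal ((1/2) ^ j))" for j
    using evD evP by (intro eventually_conj) (auto simp: eventually_ball_finite_distrib)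
  then have "\<forall>j. \<forall>\<^sub>F n in sequentially. emeasure M (D j n) \<le> ennreal ((1/2) ^ j) \<and>
      (\<forall>i\<in>{..j}. emeasure \<mu> (P i j n) \<le> ennreal ((1/2) ^ j))"
    by blast
  from strict_mono_eventually_choice[OF this] obtain r where r: "strict_mono r"
    "\<And>j. emeasure M (D j (r j)) \<le> ennreal ((1/2) ^ j) \<and>
      (\<forall>i\<in>{..j}. emeasure \<mu> (P i j (r j)) \<le> ennreal ((1/2) ^ j))"
    by blast
  have 1: "AE x in M. \<forall>i. \<forall>\<^sub>F j in sequentially. x \<notin> S (r j) -` (U j \<inter> V i j - A i)"
    unfolding AE_all_countable
  proof
    fix i
    show "AE x in M. \<forall>\<^sub>F j in sequentially. x \<notin> S (r j) -` (U j \<inter> V i j - A i)"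
      by (rule AE_eventually_notin[where k = 0]) (use V(3) in \<open>auto intro!: SA simp: Spres\<close>)
  qed
  have 2: "AE x in M. \<forall>\<^sub>F j in sequentially. x \<notin> S (r j) -` D j (r j)"
    by (rule AE_eventually_notin[where k = 0]) (use r(2) Dm in \<open>auto intro!: SA simp: Spres\<close>)
  have 3: "AE x in M. \<forall>i. \<forall>\<^sub>F j in sequentially. x \<notin> P i j (r j)"
    unfolding AE_all_countable
  proof
    fix i
    have "AE x in \<mu>. \<forall>\<^sub>F j in sequentially. x \<notin> P i j (r j)"
      by (rule AE_eventually_notin[where k = i]) (use r(2) Pm in auto)
    then show "AE x in M. \<forall>\<^sub>F j in sequentially. x \<notin> P i j (r j)"
      by (simp add: AE_mu_iff)
  qed
  have "AE x in M. (\<lambda>n. f (r n) (S (r n) x)) \<longlonglongrightarrow> g (T x)"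
    using 1 2 3 ST
  proof eventually_elim
    case (elim x)
    have Sr: "(\<lambda>n. S (r n) x) \<longlonglongrightarrow> T x" using strict_mono_tendsto[OF r(1) elim(4)] .
    obtain k where k: "T x \<in> U k" using U(3) by blast
    have "\<forall>\<^sub>F j in sequentially. S (r j) x \<in> U k"
      using topological_tendstoD[OF Sr U(1) k] .
    then have inU: "\<forall>\<^sub>F j in sequentially. S (r j) x \<in> U j"
      using eventually_ge_at_top[of k] by eventually_elim (use U(2) in \<open>auto simp: incseq_def\<close>)
    have g: "(\<lambda>j. g (S (r j) x)) \<longlonglongrightarrow> g (T x)"
    proof (rule topological_tendstoI)
      fix Q assume "open Q" "g (T x) \<in> Q"
      then obtain i where i: "g (T x) \<in> W i" "W i \<subseteq> Q" using Wb by blast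
      then have TV: "T x \<in> V i j" for j using V(2)[of i j] unfolding A_def by blast
      have "\<forall>\<^sub>F j in sequentially. x \<notin> P i j (r j)"
        "\<forall>\<^sub>F j in sequentially. x \<notin> S (r j) -` (U j \<inter> V i j - A i)" using elim by auto
      with inU have "\<forall>\<^sub>F j in sequentially. S (r j) x \<in> A i"
        by eventually_elim (use TV in \<open>auto simp: P_def\<close>)
      then show "\<forall>\<^sub>F j in sequentially. g (S (r j) x) \<in> Q"
        by eventually_elim (use i in \<open>auto simp: A_def\<close>)
    qed
    have "\<forall>\<^sub>F j in sequentially. dist (f (r j) (S (r j) x)) (g (S (r j) x)) \<le> inverse (Suc j)"
      using elim(2) inU by eventually_elim (auto simp: D_def)
    then have "(\<lambda>j. dist (f (r j) (S (r j) x)) (g (S (r j) x))) \<longlonglongrightarrow> 0"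
      by (intro tendsto_sandwich[OF _ _ tendsto_const LIMSEQ_inverse_real_of_nat]) auto
    then have "(\<lambda>j. dist (f (r j) (S (r j) x)) (g (S (r j) x)) + dist (g (S (r j) x)) (g (T x))) \<longlonglongrightarrow> 0 + 0"
      using g by (intro tendsto_add) (auto simp: tendsto_dist_iff[symmetric])
    then have "(\<lambda>j. dist (f (r j) (S (r j) x)) (g (S (r j) x)) + dist (g (S (r j) x)) (g (T x))) \<longlonglongrightarrow> 0"
      by simp
    from tendsto_sandwich[OF _ _ tendsto_const this]
    have "(\<lambda>j. dist (f (r j) (S (r j) x)) (g (T x))) \<longlonglongrightarrow> 0"
      by (simp add: dist_triangle)
    then show ?case by (simp add: tendsto_dist_iff[symmetric])
  qed
  then show ?thesis using that r(1) by blast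
qed

lemma conv_measure_compose:
  fixes f :: "nat \<Rightarrow> 'x \<Rightarrow> 'z::{metric_space, second_countable_topology}"
  assumes S: "\<And>n. mp_map M (S n)" and T: "T \<in> borel \<rightarrow>\<^sub>M borel" and ST: "conv_measure M S T"
    and f: "\<And>n. f n \<in> borel \<rightarrow>\<^sub>M borel" and g: "g \<in> borel \<rightarrow>\<^sub>M borel" and fg: "conv_measure M f g"
  shows "conv_measure M (\<lambda>n x. f n (S n x)) (\<lambda>x. g (T x))"
  unfolding conv_measure_def
proof (intro allI impI)
  fix r :: "nat \<Rightarrow> nat" assume r: "strict_mono r"
  obtain s :: "nat \<Rightarrow> nat" where s: "strict_mono s" "AE x in M. (\<lambda>n. S (r (s n)) x) \<longlonglongrightarrow> T x"
    "AE x in M. (\<lambda>n. f (r (s n)) x) \<longlonglongrightarrow> g x"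
    by (rule conv_measureD2[OF ST fg r])
  obtain t :: "nat \<Rightarrow> nat" where t: "strict_mono t" "AE x in M. (\<lambda>n. f (r (s (t n))) (S (r (s (t n))) x)) \<longlonglongrightarrow> g (T x)"
    by (rule AE_subseq_compose[OF S T s(2) f g s(3)])
  show "\<exists>s. strict_mono s \<and> (AE x in M. (\<lambda>n. f (r (s n)) (S (r (s n)) x)) \<longlonglongrightarrow> g (T x))"
    using t(2) strict_mono_o'[OF s(1) t(1)] by (intro exI[of _ "\<lambda>n. s (t n)"]) auto
qed

lemma emeasure_vimage_limit_le:
  assumes S: "\<And>n. mp_map M (S n)" and T: "T \<in> borel \<rightarrow>\<^sub>M borel" and ST: "conv_measure M S T"
    and A: "A \<in> sets borel"
  shows "emeasure M (T -` A) \<le> emeasure M A"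
proof -
  have "conv_measure M (\<lambda>n x. indicat_real A (S n x)) (\<lambda>x. indicat_real A (T x))"
    using A by (intro conv_measure_compose[OF S T ST _ _ conv_measure_const]) auto
  then obtain s :: "nat \<Rightarrow> nat" where
    s: "AE x in M. (\<lambda>n. indicat_real A (S (id (s n)) x)) \<longlonglongrightarrow> indicat_real A (T x)"
    by (rule conv_measureD[OF _ strict_mono_id])
  have Sm: "S n \<in> borel \<rightarrow>\<^sub>M borel" for n using S by (auto simp: mp_map_def)
  have TA: "T -` A \<in> sets borel" and SA: "S n -` A \<in> sets borel" for n
    using measurable_sets[OF T A] measurable_sets[OF Sm A] by simp_all
  have "emeasure M (T -` A) = (\<integral>\<^sup>+x. indicator (T -` A) x \<partial>M)"
    using TA by simp
  also have "\<dots> \<le> (\<integral>\<^sup>+x. liminf (\<lambda>n. indicator (S (s n) -` A) x) \<partial>M)"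
  proof (rule nn_integral_mono_AE)
    show "AE x in M. (indicator (T -` A) x :: ennreal) \<le> liminf (\<lambda>n. indicator (S (s n) -` A) x)"
      using s
    proof eventually_elim
      case (elim x)
      show ?case
      proof (cases "T x \<in> A")
        case True
        then have "\<forall>\<^sub>F n in sequentially. indicat_real A (S (s n) x) > 0"
          using order_tendstoD(1)[OF elim, of 0] by (simp add: indicator_def)
        then have "\<forall>\<^sub>F n in sequentially. 1 \<le> (indicator (S (s n) -` A) x :: ennreal)"
          by eventually_elim (auto simp: indicator_def split: if_splits)
        then have "1 \<le> liminf (\<lambda>n. indicator (S (s n) -` A) x :: ennreal)"
          by (rule Liminf_bounded)
        then show ?thesis using True by simp
      qed simp
    qed
  qed
  also have "\<dots> \<le> liminf (\<lambda>n. \<integral>\<^sup>+x. indicator (S (s n) -` A) x \<partial>M)"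
    using SA by (intro nn_integral_liminf) auto
  also have "\<dots> = emeasure M A"
    using S A SA by (simp add: mp_map_def Liminf_const)
  finally show ?thesis .
qed

text \<open>Composing with the fixed map \<open>T'\<close> gives \<open>T' (S n x)\<close> close to
  \<open>x\<close> off a small set; substituting \<open>S' n y\<close> for \<open>x\<close> makes
  \<open>T' y\<close> close to \<open>S' n y\<close>. Since smallness is only available on sets of
  finite measure, \<open>y\<close> is confined to \<open>U j\<close>.\<close>

lemma AE_subseq_inverse:
  assumes S: "\<And>n. mp_map M (S n)" and S': "\<And>n. mp_map M (S' n)" and T: "mp_map M T" and T': "mp_map M T'"
    and inv: "\<And>n x. S n (S' n x) = x" "\<And>x. T' (T x) = x"
    and ST: "AE x in M. (\<lambda>n. S n x) \<longlonglongrightarrow> T x"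
  obtains r :: "nat \<Rightarrow> nat" where "strict_mono r" "AE x in M. (\<lambda>n. S' (r n) x) \<longlonglongrightarrow> T' x"
proof -
  have [measurable]: "S n \<in> borel \<rightarrow>\<^sub>M borel" "S' n \<in> borel \<rightarrow>\<^sub>M borel" "T \<in> borel \<rightarrow>\<^sub>M borel" "T' \<in> borel \<rightarrow>\<^sub>M borel" for n
    using S S' T T' by (auto simp: mp_map_def)
  have vm: "h -` A \<in> sets borel" if "h \<in> borel \<rightarrow>\<^sub>M borel" "A \<in> sets borel" for h :: "'x \<Rightarrow> 'x" and A
    using measurable_sets[OF that] by simp
  have pres: "emeasure M (S n -` A) = emeasure M A" "emeasure M (S' n -` A) = emeasure M A"
    "emeasure M (T -` A) = emeasure M A" if "A \<in> sets borel" for n A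
    using S S' T that by (auto simp: mp_map_def)
  obtain U where U: "\<And>n. open (U n)" "incseq U" "(\<Union>n. U n) = UNIV" "\<And>n. emeasure M (U n) < \<infinity>"
    using ex_open_exhaustion by blast
  have UB [measurable]: "U n \<in> sets borel" for n using U(1) by simp
  obtain q :: "nat \<Rightarrow> nat" where q: "strict_mono q" "AE x in M. (\<lambda>n. T' (S (q n) x)) \<longlonglongrightarrow> T' (T x)"
    by (rule AE_subseq_compose[OF S _ ST, of "\<lambda>n. T'" T']) auto
  define D where "D j n = {x. dist (T' (S (q n) x)) x > inverse (Suc j)}" for j n :: nat
  have Dm: "D j n \<in> sets borel" for j n
  proof -
    have "{x \<in> space borel. dist (T' (S (q n) x)) x > inverse (Suc j)} \<in> sets borel" by measurable
    then show ?thesis by (simp add: D_def)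
  qed
  have ev1: "\<forall>\<^sub>F n in sequentially. emeasure M (T -` U j \<inter> D j n) \<le> ennreal ((1/2) ^ j / 2)" for j
  proof (rule eventually_emeasure_le[where V = "T -` U j"])
    show "AE x in M. \<forall>\<^sub>F n in sequentially. x \<notin> T -` U j \<inter> D j n"
      using q(2)
    proof eventually_elim
      case (elim x)
      then have "(\<lambda>n. T' (S (q n) x)) \<longlonglongrightarrow> x" by (simp add: inv)
      then have "\<forall>\<^sub>F n in sequentially. dist (T' (S (q n) x)) x < inverse (Suc j)"
        by (rule tendstoD) simp
      then show ?case by eventually_elim (simp add: D_def)
    qed
  qed (use Dm vm U in \<open>auto simp: pres\<close>)
  have ev2: "\<forall>\<^sub>F n in sequentially. emeasure M (T -` U j - S (q n) -` U j) \<le> ennreal ((1/2) ^ j / 2)" for j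
  proof (rule eventually_emeasure_le[where V = "T -` U j"])
    show "AE x in M. \<forall>\<^sub>F n in sequentially. x \<notin> T -` U j - S (q n) -` U j"
      using ST
    proof eventually_elim
      case (elim x)
      show ?case
      proof (cases "T x \<in> U j")
        case True
        have "\<forall>\<^sub>F n in sequentially. S (q n) x \<in> U j"
          using topological_tendstoD[OF strict_mono_tendsto[OF q(1) elim] U(1) True] .
        then show ?thesis by eventually_elim simp
      qed simp
    qed
  qed (use vm U in \<open>auto simp: pres\<close>)
  \<comment> \<open>Openness of \<open>U j\<close> controls the points that \<open>T\<close> sends
    into \<open>U j\<close> and \<open>S n\<close> does not. The opposite difference has the same
    measure, because both preimages of \<open>U j\<close> have the same finite measure.\<close>
  have sw: "emeasure M (S n -` U j - T -` U j) = emeasure M (T -` U j - S n -` U j)" for j n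
  proof -
    have fin: "emeasure M (S n -` U j \<inter> T -` U j) \<noteq> \<infinity>"
      using emeasure_mono[of "S n -` U j \<inter> T -` U j" "S n -` U j" M] U(4)[of j] vm
      by (auto simp: pres top_unique)
    have "emeasure M (S n -` U j - T -` U j) = emeasure M (S n -` U j) - emeasure M (S n -` U j \<inter> T -` U j)"
      using fin vm by (subst emeasure_Diff[symmetric]) (auto intro!: arg_cong[where f = "emeasure M"])
    moreover have "emeasure M (T -` U j - S n -` U j) = emeasure M (T -` U j) - emeasure M (S n -` U j \<inter> T -` U j)"
      using fin vm by (subst emeasure_Diff[symmetric]) (auto intro!: arg_cong[where f = "emeasure M"])
    ultimately show ?thesis by (simp add: pres)
  qed
  have "\<forall>\<^sub>F n in sequentially. emeasure M (U j \<inter> S' (q n) -` D j n) \<le> ennreal ((1/2) ^ j)" for j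
    using ev1[of j] ev2[of j]
  proof eventually_elim
    case (elim n)
    \<comment> \<open>Written as a single preimage under \<open>S' (q n)\<close>, the bad set of
      points \<open>y\<close> has the measure of the corresponding set of points
      \<open>x\<close>.\<close>
    have "U j \<inter> S' (q n) -` D j n = S' (q n) -` (S (q n) -` U j \<inter> D j n)"
      using inv(1) by auto
    then have "emeasure M (U j \<inter> S' (q n) -` D j n) = emeasure M (S (q n) -` U j \<inter> D j n)"
      using vm Dm by (simp only:) (rule pres(2), auto)
    also have "\<dots> \<le> emeasure M ((S (q n) -` U j - T -` U j) \<union> (T -` U j \<inter> D j n))"
      using vm Dm by (intro emeasure_mono) auto
    also have "\<dots> \<le> emeasure M (S (q n) -` U j - T -` U j) + emeasure M (T -` U j \<inter> D j n)"
      using vm Dm by (intro emeasure_subadditive) auto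
    also have "\<dots> \<le> ennreal ((1/2) ^ j / 2) + ennreal ((1/2) ^ j / 2)"
      using elim by (intro add_mono) (auto simp: sw)
    also have "\<dots> = ennreal ((1/2) ^ j)"
      by (simp flip: ennreal_plus)
    finally show ?case .
  qed
  then have "\<forall>j. \<forall>\<^sub>F n in sequentially. emeasure M (U j \<inter> S' (q n) -` D j n) \<le> ennreal ((1/2) ^ j)"
    by blast
  from strict_mono_eventually_choice[OF this]
  obtain r where r: "strict_mono r" "\<And>j. emeasure M (U j \<inter> S' (q (r j)) -` D j (r j)) \<le> ennreal ((1/2) ^ j)"
    by blast
  have "AE x in M. \<forall>\<^sub>F j in sequentially. x \<notin> U j \<inter> S' (q (r j)) -` D j (r j)"
    by (rule AE_eventually_notin[where k = 0]) (use r(2) vm Dm in auto)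
  then have "AE x in M. (\<lambda>j. S' (q (r j)) x) \<longlonglongrightarrow> T' x"
  proof eventually_elim
    case (elim x)
    obtain k where k: "x \<in> U k" using U(3) by blast
    have "\<forall>\<^sub>F j in sequentially. x \<in> U j"
      using eventually_ge_at_top[of k] by eventually_elim (use k U(2) in \<open>auto simp: incseq_def\<close>)
    with elim have "\<forall>\<^sub>F j in sequentially. dist (T' x) (S' (q (r j)) x) \<le> inverse (Suc j)"
      by eventually_elim (auto simp: D_def inv)
    then have "(\<lambda>j. dist (T' x) (S' (q (r j)) x)) \<longlonglongrightarrow> 0"
      by (intro tendsto_sandwich[OF _ _ tendsto_const LIMSEQ_inverse_real_of_nat]) auto
    then show ?case
      by (simp add: tendsto_dist_iff[of "\<lambda>j. S' (q (r j)) x"] dist_commute)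
  qed
  then show ?thesis using that[OF strict_mono_o'[OF q(1) r(1)]] by blast
qed

lemma conv_measure_inverse:
  assumes S: "\<And>n. mp_map M (S n)" and S': "\<And>n. mp_map M (S' n)" and T: "mp_map M T" and T': "mp_map M T'"
    and inv: "\<And>n x. S n (S' n x) = x" "\<And>x. T' (T x) = x"
    and ST: "conv_measure M S T"
  shows "conv_measure M S' T'"
  unfolding conv_measure_def
proof (intro allI impI)
  fix r :: "nat \<Rightarrow> nat" assume r: "strict_mono r"
  obtain s :: "nat \<Rightarrow> nat" where s: "strict_mono s" "AE x in M. (\<lambda>n. S (r (s n)) x) \<longlonglongrightarrow> T x"
    by (rule conv_measureD[OF ST r])
  obtain t :: "nat \<Rightarrow> nat" where t: "strict_mono t" "AE x in M. (\<lambda>n. S' (r (s (t n))) x) \<longlonglongrightarrow> T' x"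
    by (rule AE_subseq_inverse[of "\<lambda>n. S (r (s n))" "\<lambda>n. S' (r (s n))", OF S S' T T' inv s(2)])
  show "\<exists>s. strict_mono s \<and> (AE x in M. (\<lambda>n. S' (r (s n)) x) \<longlonglongrightarrow> T' x)"
    using t(2) strict_mono_o'[OF s(1) t(1)] by (intro exI[of _ "\<lambda>n. s (t n)"]) auto
qed

end

section \<open>The space of measurable maps\<close>

lemma continuous_map_sequentially_from_metrizable:
  assumes X: "metrizable_space X" and f: "f \<in> topspace X \<rightarrow> topspace Y"
    and seq: "\<And>\<sigma> l. range \<sigma> \<subseteq> topspace X \<Longrightarrow> limitin X \<sigma> l sequentially \<Longrightarrow> limitin Y (\<lambda>n. f (\<sigma> n)) (f l) sequentially"
  shows "continuous_map X Y f"
  unfolding continuous_map_closedin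
proof (intro conjI ballI allI impI)
  obtain A d where "Metric_space A d" and Xeq: "X = Metric_space.mtopology A d"
    using X unfolding metrizable_space_def by blast
  interpret Metric_space A d by fact
  fix C assume C: "closedin Y C"
  show "closedin X {x \<in> topspace X. f x \<in> C}"
    unfolding Xeq metric_closedin_iff_sequentially_closed
  proof (intro conjI allI impI)
    fix \<sigma> l assume \<sigma>: "range \<sigma> \<subseteq> {x \<in> topspace mtopology. f x \<in> C} \<and> limitin mtopology \<sigma> l sequentially"
    then have "limitin Y (\<lambda>n. f (\<sigma> n)) (f l) sequentially"
      by (intro seq) (auto simp: Xeq)
    moreover have "\<forall>\<^sub>F n in sequentially. f (\<sigma> n) \<in> C"
      using \<sigma> by (intro always_eventually) blast
    ultimately have "f l \<in> C"
      using limitin_closedin[OF _ C] trivial_limit_sequentially by blast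
    then show "l \<in> {x \<in> topspace mtopology. f x \<in> C}"
      using \<sigma> limitin_topspace by fastforce
  qed auto
qed (use f in auto)

lemma metrizable_topology_eqI:
  assumes X: "metrizable_space X" and Y: "metrizable_space Y" and eq: "topspace X = topspace Y"
    and lim: "\<And>\<sigma> l. range \<sigma> \<subseteq> topspace X \<Longrightarrow> l \<in> topspace X \<Longrightarrow>
      limitin X \<sigma> l sequentially \<longleftrightarrow> limitin Y \<sigma> l sequentially"
  shows "X = Y"
proof -
  have 1: "continuous_map X Y (\<lambda>x. x)"
    by (rule continuous_map_sequentially_from_metrizable[OF X])
      (use eq lim limitin_topspace in \<open>fastforce+\<close>)
  have 2: "continuous_map Y X (\<lambda>x. x)"
    by (rule continuous_map_sequentially_from_metrizable[OF Y])
      (use eq lim limitin_topspace in \<open>fastforce+\<close>)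
  show ?thesis
  proof (rule topology_eq[THEN iffD2], intro allI iffI)
    fix S
    show "openin Y S" if S: "openin X S"
    proof -
      have "openin Y {x \<in> topspace Y. x \<in> S}" using openin_continuous_map_preimage[OF 2 S] .
      moreover have "{x \<in> topspace Y. x \<in> S} = S" using openin_subset[OF S] eq by auto
      ultimately show ?thesis by simp
    qed
    show "openin X S" if S: "openin Y S"
    proof -
      have "openin X {x \<in> topspace X. x \<in> S}" using openin_continuous_map_preimage[OF 1 S] .
      moreover have "{x \<in> topspace X. x \<in> S} = S" using openin_subset[OF S] eq by auto
      ultimately show ?thesis by simp
    qed
  qed
qed

lemma (in Metric_space) second_countable_of_dense:
  assumes C: "countable C" "C \<subseteq> M" and dense: "\<And>x e. x \<in> M \<Longrightarrow> e > 0 \<Longrightarrow> \<exists>c\<in>C. d c x < e"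
  shows "second_countable mtopology"
  unfolding second_countable_def
proof (intro exI conjI ballI allI impI)
  let ?B = "(\<lambda>(c, n). mball c (inverse (Suc n))) ` (C \<times> (UNIV :: nat set))"
  show "countable ?B" using C(1) by blast
  show "openin mtopology V" if "V \<in> ?B" for V using that by auto
  fix U x assume U: "openin mtopology U \<and> x \<in> U"
  then obtain r where r: "r > 0" "mball x r \<subseteq> U" and xM: "x \<in> M"
    unfolding openin_mtopology by (meson subsetD)
  obtain n where n: "inverse (Suc n) < r / 2" using reals_Archimedean[of "r / 2"] r(1) by auto
  obtain c where c: "c \<in> C" "d c x < inverse (Suc n)" using dense[OF xM, of "inverse (Suc n)"] by auto
  have cM: "c \<in> M" using c C(2) by auto
  have "mball c (inverse (Suc n)) \<subseteq> mball x r"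
  proof
    fix y assume y: "y \<in> mball c (inverse (Suc n))"
    then have "d x y \<le> d c x + d c y" using triangle[of x c y] commute[of x c] xM cM by auto
    then show "y \<in> mball x r" using y c n xM by auto
  qed
  then have "mball c (inverse (Suc n)) \<subseteq> U" using r(2) by blast
  moreover have "x \<in> mball c (inverse (Suc n))" using c cM xM by auto
  ultimately show "\<exists>V\<in>?B. x \<in> V \<and> V \<subseteq> U" using c(1) by (intro bexI[of _ "mball c (inverse (Suc n))"]) auto
qed

context
  fixes d :: "'g::topological_space \<Rightarrow> 'g \<Rightarrow> real"
  assumes d: "compatible_bounded_metric d"
begin

lemma compatible_metric: "Metric_space UNIV d" and compatible_mtopology: "Metric_space.mtopology UNIV d = euclidean"
  and compatible_bounded: "\<exists>B. \<forall>g h. d g h \<le> B"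
  using d by (auto simp: compatible_bounded_metric_def)

lemma compatible_tendsto_iff: "(\<lambda>n. d (u n) a) \<longlonglongrightarrow> 0 \<longleftrightarrow> u \<longlonglongrightarrow> a"
  using Metric_space.limitin_metric_dist_null[OF compatible_metric, of u a sequentially]
  by (simp add: compatible_mtopology)

end

lemma compatible_continuous:
  fixes d :: "'g::metric_space \<Rightarrow> 'g \<Rightarrow> real"
  assumes d: "compatible_bounded_metric d"
  shows "continuous_on UNIV (\<lambda>p. d (fst p) (snd p))"
  unfolding continuous_on_sequentially
proof (intro allI ballI impI)
  interpret Metric_space UNIV d by (rule compatible_metric[OF d])
  fix p :: "nat \<Rightarrow> 'g \<times> 'g" and a assume "(\<forall>n. p n \<in> UNIV) \<and> p \<longlonglongrightarrow> a"
  then have p: "p \<longlonglongrightarrow> a" ..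
  have 1: "(\<lambda>n. d (fst (p n)) (fst a)) \<longlonglongrightarrow> 0" "(\<lambda>n. d (snd (p n)) (snd a)) \<longlonglongrightarrow> 0"
    unfolding compatible_tendsto_iff[OF d] by (intro tendsto_intros p)+
  have S: "(\<lambda>n. d (fst (p n)) (fst a) + d (snd (p n)) (snd a)) \<longlonglongrightarrow> 0"
    using tendsto_add[OF 1] by simp
  have bd: "\<bar>d (fst (p n)) (snd (p n)) - d (fst a) (snd a)\<bar> \<le> d (fst (p n)) (fst a) + d (snd (p n)) (snd a)" for n
    using triangle[of "fst (p n)" "fst a" "snd (p n)"] triangle[of "fst a" "snd a" "snd (p n)"]
      triangle[of "fst a" "fst (p n)" "snd a"] triangle[of "fst (p n)" "snd (p n)" "snd a"]
      commute[of "fst a" "fst (p n)"] commute[of "snd a" "snd (p n)"] unfolding abs_if by simp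
  have "(\<lambda>n. d (fst (p n)) (snd (p n)) - d (fst a) (snd a)) \<longlonglongrightarrow> 0"
    by (rule Lim_null_comparison[OF _ S]) (simp add: bd)
  then show "((\<lambda>p. d (fst p) (snd p)) \<circ> p) \<longlonglongrightarrow> d (fst a) (snd a)"
    by (simp add: o_def LIM_zero_iff)
qed

text \<open>\<open>ae_rep\<close> picks an arbitrary member of a class, which inherits measurability
  from a Borel member only through completeness.\<close>

lemma (in complete_measure) measurable_AE_eq:
  assumes f: "f \<in> M \<rightarrow>\<^sub>M N" and ae: "AE x in M. f x = g x" and g: "g \<in> space M \<rightarrow> space N"
  shows "g \<in> M \<rightarrow>\<^sub>M N"
proof (rule measurableI)
  fix A assume A: "A \<in> sets N"
  show "g -` A \<inter> space M \<in> sets M"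
  proof (rule in_sets_AE)
    show "f -` A \<inter> space M \<in> sets M" using f A by (rule measurable_sets)
    show "AE x in M. (x \<in> f -` A \<inter> space M) = (x \<in> g -` A \<inter> space M)"
      using ae by eventually_elim auto
  qed auto
qed (use g in auto)

text \<open>Truncation gives boundedness and keeps the Cauchy sequences of \<open>dist\<close>,
  hence completeness, which an arbitrary compatible metric may lack. Properties of
  \<open>L0 M\<close> are proved with this metric and then transferred.\<close>

lemma compatible_truncated_dist:
  "compatible_bounded_metric (\<lambda>x y :: 'g::metric_space. min 1 (dist x y))"
proof -
  interpret Met: Metric_space UNIV "\<lambda>x y :: 'g. min 1 (dist x y)"
  proof
    show "min 1 (dist x z) \<le> min 1 (dist x y) + min 1 (dist y z)" for x y z :: 'g
      by (smt (verit) dist_triangle zero_le_dist)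
  qed (auto simp: dist_commute min_def split: if_splits)
  have "openin Met.mtopology S \<longleftrightarrow> open S" for S :: "'g set"
  proof -
    have "(\<exists>r>0. Met.mball x r \<subseteq> S) \<longleftrightarrow> (\<exists>e>0. ball x e \<subseteq> S)" for x
    proof
      assume "\<exists>r>0. Met.mball x r \<subseteq> S"
      then obtain r where "r > 0" "Met.mball x r \<subseteq> S" by blast
      moreover have "ball x r \<subseteq> Met.mball x r" by (auto simp: Met.mball_def)
      ultimately show "\<exists>e>0. ball x e \<subseteq> S" by blast
    next
      assume "\<exists>e>0. ball x e \<subseteq> S"
      then obtain e where "e > 0" "ball x e \<subseteq> S" by blast
      moreover have "Met.mball x (min 1 e) \<subseteq> ball x e"
      proof
        fix y assume "y \<in> Met.mball x (min 1 e)"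
        then have "min 1 (dist x y) < min 1 e" by (simp only: Met.in_mball)
        then show "y \<in> ball x e" by (auto simp: min_def split: if_splits)
      qed
      ultimately show "\<exists>r>0. Met.mball x r \<subseteq> S"
        by (intro exI[of _ "min 1 e"]) auto
    qed
    then show ?thesis
      unfolding Met.openin_mtopology open_contains_ball by (auto simp: Ball_def)
  qed
  then have "Met.mtopology = euclidean"
    by (simp add: topology_eq)
  then show ?thesis
    unfolding compatible_bounded_metric_def using Met.Metric_space_axioms by (auto intro: exI[of _ 1])
qed

context locally_finite_borel
begin

lemma AE_completion_mu_iff: "(AE x in completion \<mu>. P x) \<longleftrightarrow> (AE x in M. P x)"
  by (simp add: AE_completion_iff AE_mu_iff)

text \<open>Borel representatives compose with Borel maps, which Lebesgue-measurable ones need not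
  do.\<close>

lemma mem_L0_iff:
  fixes F :: "('x \<Rightarrow> 'g::second_countable_topology) set"
  shows "F \<in> L0 M \<longleftrightarrow> (\<exists>f\<in>borel \<rightarrow>\<^sub>M borel. F = ae_class M f)"
proof
  assume "F \<in> L0 M"
  then obtain f where f: "f \<in> borel_measurable (completion M)" "F = ae_class M f"
    by (auto simp: L0_def)
  obtain h where "h \<in> borel_measurable M" "AE x in M. f x = h x"
    using completion_ex_borel_measurable_second_countable[OF f(1)] by blast
  moreover have "borel_measurable M = borel \<rightarrow>\<^sub>M borel"
    by (rule measurable_cong_sets) simp_all
  ultimately show "\<exists>f\<in>borel \<rightarrow>\<^sub>M borel. F = ae_class M f"
    using f(2) by (auto simp: ae_class_eq_iff)
next
  assume "\<exists>f\<in>borel \<rightarrow>\<^sub>M borel. F = ae_class M f"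
  then obtain f :: "'x \<Rightarrow> 'g" where f: "f \<in> borel \<rightarrow>\<^sub>M borel" "F = ae_class M f" by blast
  have "f \<in> borel_measurable M" using f(1) measurable_cong_sets[OF sets_M refl] by blast
  then show "F \<in> L0 M"
    unfolding L0_def f(2) by (intro imageI measurable_completion)
qed

lemma ae_class_in_L0 [simp]:
  fixes f :: "'x \<Rightarrow> 'g::second_countable_topology"
  shows "f \<in> borel \<rightarrow>\<^sub>M borel \<Longrightarrow> ae_class M f \<in> L0 M"
  unfolding mem_L0_iff by blast

context
  fixes d :: "'g::polish_space \<Rightarrow> 'g \<Rightarrow> real"
  assumes d: "compatible_bounded_metric d"
begin

interpretation d: Metric_space UNIV d by (rule compatible_metric[OF d])

lemma measurable_d:
  assumes "f \<in> borel \<rightarrow>\<^sub>M borel" "g \<in> borel \<rightarrow>\<^sub>M borel"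
  shows "(\<lambda>x. d (f x) (g x)) \<in> borel \<rightarrow>\<^sub>M borel"
  by (rule borel_measurable_continuous_Pair[OF assms compatible_continuous[OF d]])

lemma integrable_d:
  assumes "f \<in> borel \<rightarrow>\<^sub>M borel" "g \<in> borel \<rightarrow>\<^sub>M borel"
  shows "integrable \<mu> (\<lambda>x. d (f x) (g x))"
proof -
  interpret prob_space \<mu> by (rule prob_mu)
  obtain B where "\<And>g h. d g h \<le> B" using compatible_bounded[OF d] by blast
  then have "AE x in \<mu>. norm (d (f x) (g x)) \<le> B" by simp
  moreover have "(\<lambda>x. d (f x) (g x)) \<in> borel_measurable \<mu>" using measurable_d[OF assms] by simp
  ultimately show ?thesis by (rule integrable_const_bound)
qed

lemma L0_dist_ae_class:
  assumes "f \<in> borel \<rightarrow>\<^sub>M borel" "g \<in> borel \<rightarrow>\<^sub>M borel"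
  shows "L0_dist d \<mu> (ae_class M f) (ae_class M g) = (\<integral>x. d (f x) (g x) \<partial>\<mu>)"
proof -
  have ae: "AE x in M. ae_rep (ae_class M f) x = f x" "AE x in M. ae_rep (ae_class M g) x = g x"
    by (rule AE_ae_rep[of M f], rule AE_ae_rep[of M g])
  have "AE x in completion \<mu>. d (ae_rep (ae_class M f) x) (ae_rep (ae_class M g) x) = d (f x) (g x)"
    unfolding AE_completion_mu_iff using ae
  proof eventually_elim
    case (elim x)
    then show ?case by (simp only:)
  qed
  moreover have m: "(\<lambda>x. d (f x) (g x)) \<in> borel_measurable \<mu>"
    using measurable_d[OF assms] by simp
  moreover from calculation have "(\<lambda>x. d (ae_rep (ae_class M f) x) (ae_rep (ae_class M g) x)) \<in> borel_measurable (completion \<mu>)"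
    by (intro completion.measurable_AE_eq[OF measurable_completion[OF m]]) (auto elim: eventually_mono)
  ultimately have "L0_dist d \<mu> (ae_class M f) (ae_class M g) = (\<integral>x. d (f x) (g x) \<partial>completion \<mu>)"
    unfolding L0_dist_def by (intro integral_cong_AE) (auto intro: measurable_completion)
  also have "\<dots> = (\<integral>x. d (f x) (g x) \<partial>\<mu>)"
    using m by (rule integral_completion)
  finally show ?thesis .
qed

lemma Metric_space_L0: "Metric_space (L0 M) (L0_dist d \<mu>)"
proof
  show "0 \<le> L0_dist d \<mu> F H" "L0_dist d \<mu> F H = L0_dist d \<mu> H F" for F H
    by (simp_all add: L0_dist_def d.commute)
  fix F H K :: "('x \<Rightarrow> 'g) set" assume "F \<in> L0 M" "H \<in> L0 M"
  then obtain f h where f: "f \<in> borel \<rightarrow>\<^sub>M borel" "F = ae_class M f" and h: "h \<in> borel \<rightarrow>\<^sub>M borel" "H = ae_class M h"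
    unfolding mem_L0_iff by blast
  show "L0_dist d \<mu> F H = 0 \<longleftrightarrow> F = H"
    using integral_nonneg_eq_0_iff_AE[OF integrable_d[OF f(1) h(1)]] f h
    by (simp add: L0_dist_ae_class ae_class_eq_iff AE_mu_iff)
  assume "K \<in> L0 M"
  then obtain k where k: "k \<in> borel \<rightarrow>\<^sub>M borel" "K = ae_class M k"
    unfolding mem_L0_iff by blast
  have "(\<integral>x. d (f x) (k x) \<partial>\<mu>) \<le> (\<integral>x. d (f x) (h x) + d (h x) (k x) \<partial>\<mu>)"
    using f h k by (intro integral_mono integrable_d Bochner_Integration.integrable_add) (auto intro: d.triangle)
  then show "L0_dist d \<mu> F K \<le> L0_dist d \<mu> F H + L0_dist d \<mu> H K"
    using f h k integrable_d by (simp add: L0_dist_ae_class Bochner_Integration.integral_add)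
qed

lemma topspace_L0 [simp]: "topspace (L0_topology M d \<mu>) = L0 M"
  unfolding L0_topology_def by (rule Metric_space.topspace_mtopology[OF Metric_space_L0])

lemma metrizable_L0: "metrizable_space (L0_topology M d \<mu>)"
  unfolding L0_topology_def by (rule Metric_space.metrizable_space_mtopology[OF Metric_space_L0])

lemma limitin_L0_iff:
  assumes f: "\<And>n. f n \<in> borel \<rightarrow>\<^sub>M borel" and g: "g \<in> borel \<rightarrow>\<^sub>M borel"
  shows "limitin (L0_topology M d \<mu>) (\<lambda>n. ae_class M (f n)) (ae_class M g) sequentially \<longleftrightarrow> conv_measure M f g"
proof -
  interpret prob_space \<mu> by (rule prob_mu)
  obtain B where B: "\<And>g h. d g h \<le> B" using compatible_bounded[OF d] by blast
  have "limitin (L0_topology M d \<mu>) (\<lambda>n. ae_class M (f n)) (ae_class M g) sequentially \<longleftrightarrow>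
      (\<lambda>n. \<integral>x. d (f n x) (g x) \<partial>\<mu>) \<longlonglongrightarrow> 0"
    unfolding L0_topology_def Metric_space.limitin_metric_dist_null[OF Metric_space_L0]
    using f g by (simp add: L0_dist_ae_class)
  also have "\<dots> \<longleftrightarrow> conv_measure M f g"
  proof (rule conv_measure_iff_integral[where B = B])
    show "finite_measure \<mu>" by (rule finite_measure_axioms)
    show "null_sets \<mu> = null_sets M" using equiv by (simp add: equivalent_probability_def)
    show "(\<lambda>x. d (f n x) (g x)) \<in> borel_measurable \<mu>" for n using measurable_d[OF f g] by simp
  qed (auto simp: B compatible_tendsto_iff[OF d])
  finally show ?thesis .
qed

end

text \<open>Both topologies are metrizable, and \<open>limitin_L0_iff\<close> gives them the same
  convergent sequences, since \<open>conv_measure\<close> does not depend on the metric.\<close>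

lemma L0_topology_cong:
  fixes d d' :: "'g::polish_space \<Rightarrow> 'g \<Rightarrow> real"
  assumes d: "compatible_bounded_metric d" and d': "compatible_bounded_metric d'"
  shows "L0_topology M d \<mu> = L0_topology M d' \<mu>"
proof (rule metrizable_topology_eqI[OF metrizable_L0[OF d] metrizable_L0[OF d']])
  fix \<sigma> :: "nat \<Rightarrow> ('x \<Rightarrow> 'g) set" and l
  assume "range \<sigma> \<subseteq> topspace (L0_topology M d \<mu>)" "l \<in> topspace (L0_topology M d \<mu>)"
  then have "\<forall>n. \<sigma> n \<in> L0 M" "l \<in> L0 M"
    by (auto simp: topspace_L0[OF d])
  then obtain f g where "\<And>n. f n \<in> borel \<rightarrow>\<^sub>M borel" "\<And>n. \<sigma> n = ae_class M (f n)"
    "g \<in> borel \<rightarrow>\<^sub>M borel" "l = ae_class M g"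
    unfolding mem_L0_iff by metis
  moreover from this have "\<sigma> = (\<lambda>n. ae_class M (f n))" by auto
  ultimately show "limitin (L0_topology M d \<mu>) \<sigma> l sequentially \<longleftrightarrow> limitin (L0_topology M d' \<mu>) \<sigma> l sequentially"
    using limitin_L0_iff[OF d, of f g] limitin_L0_iff[OF d', of f g] by simp
qed (simp add: topspace_L0[OF d] topspace_L0[OF d'])

end

section \<open>Completeness and second countability of the space of measurable maps\<close>

lemma Cauchy_of_eventually_geometric:
  fixes u :: "nat \<Rightarrow> 'a::metric_space"
  assumes "\<forall>\<^sub>F n in sequentially. dist (u n) (u (Suc n)) \<le> (1/2) ^ n"
  shows "Cauchy u"
proof -
  obtain N where N: "\<And>n. N \<le> n \<Longrightarrow> dist (u n) (u (Suc n)) \<le> (1/2) ^ n"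
    using assms by (auto simp: eventually_sequentially)
  \<comment> \<open>The subtracted tail of the geometric series is what makes the induction on
    \<open>k\<close> close.\<close>
  have bd: "dist (u n) (u (n + k)) \<le> 2 * (1/2) ^ n - 2 * (1/2) ^ (n + k)" if n: "N \<le> n" for n k
  proof (induction k)
    case (Suc k)
    have "dist (u n) (u (n + Suc k)) \<le> dist (u n) (u (n + k)) + dist (u (n + k)) (u (Suc (n + k)))"
      by (simp add: dist_triangle)
    also have "\<dots> \<le> (2 * (1/2) ^ n - 2 * (1/2) ^ (n + k)) + (1/2) ^ (n + k)"
      using Suc N[of "n + k"] n by (intro add_mono) auto
    finally show ?case by simp
  qed simp
  show ?thesis
  proof (rule metric_CauchyI)
    fix e :: real assume e: "0 < e"
    have "(\<lambda>n. 2 * (1/2 :: real) ^ n) \<longlonglongrightarrow> 2 * 0"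
      by (intro tendsto_mult LIMSEQ_realpow_zero tendsto_const) auto
    then have "\<forall>\<^sub>F n in sequentially. 2 * (1/2 :: real) ^ n < e / 2"
      by (rule order_tendstoD) (use e in simp)
    then obtain K where K: "N \<le> K" "2 * (1/2 :: real) ^ K < e / 2"
      unfolding eventually_sequentially by (meson max.cobounded1 max.cobounded2)
    have "dist (u K) (u m) < e / 2" if "K \<le> m" for m
    proof -
      have "dist (u K) (u m) \<le> 2 * (1/2) ^ K - 2 * (1/2) ^ m" using bd[OF K(1), of "m - K"] that by simp
      moreover have "0 < (1/2 :: real) ^ m" by simp
      ultimately show ?thesis using K(2) by linarith
    qed
    then have "dist (u m) (u n) < e" if "K \<le> m" "K \<le> n" for m n
      using that dist_triangle_half_r by blast
    then show "\<exists>M. \<forall>m\<ge>M. \<forall>n\<ge>M. dist (u m) (u n) < e" by blast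
  qed
qed

context locally_finite_borel
begin

text \<open>The Riesz-Fischer argument: a rapidly Cauchy subsequence is Cauchy at almost every
  point, its pointwise limit is a limit in measure, and a Cauchy sequence with a convergent
  subsequence converges.\<close>

lemma mcomplete_L0_truncated:
  "Metric_space.mcomplete (L0 M) (L0_dist (\<lambda>x y :: 'g::polish_space. min 1 (dist x y)) \<mu>)"
proof -
  define d where "d = (\<lambda>x y :: 'g. min 1 (dist x y))"
  have d: "compatible_bounded_metric d" unfolding d_def by (rule compatible_truncated_dist)
  interpret L: Metric_space "L0 M" "L0_dist d \<mu>" by (rule Metric_space_L0[OF d])
  interpret prob_space \<mu> by (rule prob_mu)
  have "\<exists>F. limitin L.mtopology \<sigma> F sequentially" if \<sigma>: "L.MCauchy \<sigma>" for \<sigma>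
  proof -
    have "\<forall>n. \<exists>f :: 'x \<Rightarrow> 'g. f \<in> borel \<rightarrow>\<^sub>M borel \<and> \<sigma> n = ae_class M f"
      using \<sigma> unfolding L.MCauchy_def mem_L0_iff[symmetric] by (metis mem_L0_iff range_subsetD)
    then obtain f :: "nat \<Rightarrow> 'x \<Rightarrow> 'g" where f [measurable]: "\<And>n. f n \<in> borel \<rightarrow>\<^sub>M borel"
      and \<sigma>f: "\<And>n. \<sigma> n = ae_class M (f n)" by metis
    \<comment> \<open>Powers of 1/4 because Markov's inequality divides by the threshold
      \<open>(1/2) ^ Suc j\<close>, which leaves the summable bound \<open>(1/2) ^ Suc j\<close> for
      the measure.\<close>
    have "\<exists>N. \<forall>m\<ge>N. \<forall>n\<ge>N. (\<integral>x. d (f m x) (f n x) \<partial>\<mu>) < (1/4) ^ Suc j" for j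
    proof -
      have "0 < (1/4 :: real) ^ Suc j" by simp
      then obtain N where "\<forall>n n'. N \<le> n \<longrightarrow> N \<le> n' \<longrightarrow> L0_dist d \<mu> (\<sigma> n) (\<sigma> n') < (1/4) ^ Suc j"
        using \<sigma> unfolding L.MCauchy_def by blast
      then show ?thesis using L0_dist_ae_class[OF d f f] unfolding \<sigma>f by auto
    qed
    then have "\<forall>j. \<forall>\<^sub>F n in sequentially. \<forall>m\<ge>n. (\<integral>x. d (f n x) (f m x) \<partial>\<mu>) < (1/4) ^ Suc j"
      unfolding eventually_sequentially by (meson order_trans)
    from strict_mono_eventually_choice[OF this]
    obtain r where r: "strict_mono r" "\<And>j m. r j \<le> m \<Longrightarrow> (\<integral>x. d (f (r j) x) (f m x) \<partial>\<mu>) < (1/4) ^ Suc j"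
      by blast
    define A where "A j = {x. (1/2) ^ Suc j \<le> d (f (r j) x) (f (r (Suc j)) x)}" for j
    have Am: "A j \<in> sets \<mu>" for j
    proof -
      note [measurable] = measurable_d[OF d f f]
      have "{x \<in> space \<mu>. (1/2) ^ Suc j \<le> d (f (r j) x) (f (r (Suc j)) x)} \<in> sets \<mu>" by measurable
      then show ?thesis by (simp add: A_def)
    qed
    have "emeasure \<mu> (A j) \<le> ennreal ((1/2) ^ j)" for j
    proof -
      have "prob {x \<in> space \<mu>. d (f (r j) x) (f (r (Suc j)) x) \<ge> (1/2) ^ Suc j} \<le>
          (\<integral>x. d (f (r j) x) (f (r (Suc j)) x) \<partial>\<mu>) / (1/2) ^ Suc j"
        by (intro integral_Markov_inequality_measure[where A = "{}"] integrable_d[OF d] f) (auto simp: d_def)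
      also have "\<dots> \<le> (1/4) ^ Suc j / (1/2) ^ Suc j"
        using r(2)[of j "r (Suc j)"] r(1) by (intro divide_right_mono) (auto simp: strict_mono_less_eq)
      also have "\<dots> = (1/2) ^ Suc j" by (simp flip: power_divide)
      also have "\<dots> \<le> (1/2) ^ j" by simp
      finally show ?thesis by (simp add: A_def emeasure_eq_measure ennreal_leI)
    qed
    then have "AE x in \<mu>. \<forall>\<^sub>F j in sequentially. x \<notin> A j"
      using Am by (intro AE_eventually_notin[where k = 0])
    then have cau: "AE x in \<mu>. Cauchy (\<lambda>j. f (r j) x)"
    proof eventually_elim
      case (elim x)
      then have "\<forall>\<^sub>F j in sequentially. dist (f (r j) x) (f (r (Suc j)) x) \<le> (1/2) ^ j"
      proof eventually_elim
        case (elim j)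
        then have "min 1 (dist (f (r j) x) (f (r (Suc j)) x)) < (1/2) ^ Suc j"
          unfolding A_def d_def by (simp only: mem_Collect_eq not_le)
        \<comment> \<open>The threshold is at most 1, so the truncation is inactive below it and the
          bound passes to \<open>dist\<close>.\<close>
        moreover have "(1/2 :: real) ^ Suc j \<le> 1"
          by (rule power_le_one) auto
        moreover from this have "(1/2 :: real) ^ Suc j \<le> (1/2) ^ j" by simp
        ultimately have "dist (f (r j) x) (f (r (Suc j)) x) < (1/2) ^ Suc j"
          by (simp only: min_def split: if_splits)
        then show ?case using \<open>(1/2 :: real) ^ Suc j \<le> (1/2) ^ j\<close> by linarith
      qed
      then show ?case by (rule Cauchy_of_eventually_geometric)
    qed
    define C where "C = {x. Cauchy (\<lambda>j. f (r j) x)}"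
    have C: "C \<in> sets borel"
      using sets_Collect_Cauchy[of "\<lambda>j. f (r j)" borel] f by (simp add: C_def)
    \<comment> \<open>A constant on the Borel set where the sequence is not Cauchy makes
      \<open>g\<close> an everywhere defined pointwise limit of Borel maps.\<close>
    define g where "g x = (if x \<in> C then lim (\<lambda>j. f (r j) x) else undefined)" for x
    have lim: "(\<lambda>j. f (r j) x) \<longlonglongrightarrow> g x" if "x \<in> C" for x
      using that by (simp add: C_def g_def Cauchy_convergent_iff convergent_LIMSEQ_iff)
    have g: "g \<in> borel \<rightarrow>\<^sub>M borel"
    proof (rule borel_measurable_LIMSEQ_metric[where f = "\<lambda>j x. if x \<in> C then f (r j) x else undefined"])
      show "(\<lambda>x. if x \<in> C then f (r j) x else undefined) \<in> borel \<rightarrow>\<^sub>M borel" for j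
        using f C by (intro measurable_If_set) auto
      show "(\<lambda>j. if x \<in> C then f (r j) x else undefined) \<longlonglongrightarrow> g x" for x
        using lim[of x] by (cases "x \<in> C") (auto simp: g_def)
    qed
    have "AE x in M. (\<lambda>j. f (r j) x) \<longlonglongrightarrow> g x"
      unfolding AE_mu_iff[symmetric] using cau by eventually_elim (rule lim, simp add: C_def)
    then have "limitin L.mtopology (\<lambda>j. ae_class M (f (r j))) (ae_class M g) sequentially"
      using limitin_L0_iff[OF d, of "\<lambda>j. f (r j)" g] f g by (simp add: L0_topology_def conv_measure_AE)
    then have "limitin L.mtopology (\<sigma> \<circ> r) (ae_class M g) sequentially"
      by (simp add: o_def \<sigma>f)
    then show ?thesis
      using L.MCauchy_convergent_subsequence[OF \<sigma> r(1)] by blast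
  qed
  then show ?thesis unfolding L.mcomplete_def d_def[symmetric] by blast
qed

lemma completely_metrizable_L0:
  fixes d :: "'g::polish_space \<Rightarrow> 'g \<Rightarrow> real"
  assumes d: "compatible_bounded_metric d"
  shows "completely_metrizable_space (L0_topology M d \<mu>)"
  unfolding L0_topology_cong[OF d compatible_truncated_dist]
  unfolding completely_metrizable_space_def L0_topology_def
  using mcomplete_L0_truncated Metric_space_L0[OF compatible_truncated_dist] by blast

text \<open>Step functions with values among the \<open>q i\<close> on finite unions of basic open
  sets form a countable dense family, because such unions approximate every Borel set in
  \<open>\<mu>\<close>.\<close>

lemma second_countable_L0:
  fixes d :: "'g::polish_space \<Rightarrow> 'g \<Rightarrow> real"
  assumes d: "compatible_bounded_metric d"
  shows "second_countable (L0_topology M d \<mu>)"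
proof -
  define \<delta> where "\<delta> = (\<lambda>x y :: 'g. min 1 (dist x y))"
  have \<delta>: "compatible_bounded_metric \<delta>" unfolding \<delta>_def by (rule compatible_truncated_dist)
  interpret L: Metric_space "L0 M" "L0_dist \<delta> \<mu>" by (rule Metric_space_L0[OF \<delta>])
  interpret prob_space \<mu> by (rule prob_mu)
  obtain q :: "nat \<Rightarrow> 'g" where q: "\<And>x e. e > 0 \<Longrightarrow> \<exists>i. dist (q i) x < e"
    using ex_dense_sequence by blast
  obtain B0 :: "'x set set" where B0: "countable B0" "topological_basis B0"
    using ex_countable_basis by blast
  have "B0 \<noteq> {}" using topological_basisE[OF B0(2) open_UNIV UNIV_I] by blast
  define B where "B = from_nat_into B0"
  have Bop [measurable]: "B i \<in> sets borel" for i
    using topological_basis_open[OF B0(2) from_nat_into[OF \<open>B0 \<noteq> {}\<close>]] by (simp add: B_def)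
  define E where "E I = (\<Union>i\<in>set I. B i)" for I :: "nat list"
  have E [measurable]: "E I \<in> sets borel" for I by (auto simp: E_def)
  \<comment> \<open>An open \<open>V\<close> around \<open>A\<close> costs \<open>e / 2\<close> by
    outer regularity, and exhausting \<open>V\<close> by finite unions of basic sets costs another
    \<open>e / 2\<close>.\<close>
  have approx: "\<exists>I. prob (A - E I) + prob (E I - A) < e" if A: "A \<in> sets borel" and e: "e > 0" for A e
  proof -
    have "(INF V\<in>{V. A \<subseteq> V \<and> open V}. emeasure \<mu> V) < emeasure \<mu> A + ennreal (e / 2)"
      using e ennreal_add_left_cancel_less[of "emeasure \<mu> A" 0 "ennreal (e / 2)"]
      by (subst outer_regular[OF sets_mu _ A, symmetric]) auto
    then obtain V where V: "A \<subseteq> V" "open V" "emeasure \<mu> V < emeasure \<mu> A + ennreal (e / 2)"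
      unfolding INF_less_iff by blast
    have "prob V < prob A + e / 2"
      using V(3) e by (simp add: emeasure_eq_measure ennreal_less_iff flip: ennreal_plus)
    then have VA: "prob (V - A) < e / 2"
      using V A by (subst finite_measure_Diff) auto
    define K where "K n = filter (\<lambda>i. B i \<subseteq> V) [0..<n]" for n
    have "(\<Union>n. E (K n)) = V"
    proof
      show "V \<subseteq> (\<Union>n. E (K n))"
      proof
        fix x assume "x \<in> V"
        then obtain b where "b \<in> B0" "x \<in> b" "b \<subseteq> V"
          using topological_basisE[OF B0(2) V(2)] by blast
        then obtain i where "x \<in> B i" "B i \<subseteq> V" using from_nat_into_surj[OF B0(1)] unfolding B_def by metis
        then show "x \<in> (\<Union>n. E (K n))" by (intro UN_I[of "Suc i"]) (auto simp: E_def K_def)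
      qed
    qed (auto simp: E_def K_def)
    moreover have "incseq (\<lambda>n. E (K n))" by (intro incseq_SucI) (auto simp: E_def K_def)
    ultimately have "(\<lambda>n. prob (E (K n))) \<longlonglongrightarrow> prob V"
      using finite_Lim_measure_incseq[of "\<lambda>n. E (K n)"] E by (simp add: image_subset_iff)
    then have "\<forall>\<^sub>F n in sequentially. prob V - e / 2 < prob (E (K n))"
      by (rule order_tendstoD) (use e in simp)
    then obtain n where n: "prob V - e / 2 < prob (E (K n))"
      by (auto simp: eventually_sequentially)
    have sub: "E (K n) \<subseteq> V" by (auto simp: E_def K_def)
    have "prob (A - E (K n)) \<le> prob (V - E (K n))"
      using V by (intro finite_measure_mono) auto
    also have "\<dots> < e / 2"
      using n sub V by (subst finite_measure_Diff) auto
    finally have "prob (A - E (K n)) < e / 2" .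
    moreover have "prob (E (K n) - A) \<le> prob (V - A)"
      using sub V A by (intro finite_measure_mono) auto
    ultimately show ?thesis using VA by (intro exI[of _ "K n"]) linarith
  qed
  \<comment> \<open>The sets in a list may overlap; the first pair whose set contains
    \<open>x\<close> decides the value, with \<open>q 0\<close> as default.\<close>
  define s where "s c x = (case find (\<lambda>p. x \<in> E (fst p)) c of None \<Rightarrow> q 0 | Some p \<Rightarrow> q (snd p))"
    for c :: "(nat list \<times> nat) list" and x
  have sm: "s c \<in> borel \<rightarrow>\<^sub>M borel" for c
  proof (induction c)
    case (Cons p c)
    have "s (p # c) = (\<lambda>x. if x \<in> E (fst p) then q (snd p) else s c x)"
      by (auto simp: s_def fun_eq_iff)
    then show ?case using Cons E by (simp add: measurable_If_set)
  qed (simp add: s_def)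
  have dense: "\<exists>c\<in>range (\<lambda>c. ae_class M (s c)). L0_dist \<delta> \<mu> c F < e" if F: "F \<in> L0 M" and e: "e > 0" for F e
  proof -
    obtain f where f [measurable]: "f \<in> borel \<rightarrow>\<^sub>M borel" and Ff: "F = ae_class M f"
      using F unfolding mem_L0_iff by blast
    define A where "A k = {x. dist (q k) (f x) < e / 3}" for k
    have A [measurable]: "A k \<in> sets borel" for k
    proof -
      have "{x \<in> space borel. dist (q k) (f x) < e / 3} \<in> sets borel" by measurable
      then show ?thesis by (simp add: A_def)
    qed
    have "(\<Union>k. A k) = UNIV" using q[of "e / 3"] e by (auto simp: A_def)
    then have "(\<Union>n. \<Union>k<n. A k) = UNIV" by blast
    moreover have "incseq (\<lambda>n. \<Union>k<n. A k)" by (intro incseq_SucI UN_mono) auto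
    ultimately have "(\<lambda>n. prob (\<Union>k<n. A k)) \<longlonglongrightarrow> prob UNIV"
      using finite_Lim_measure_incseq[of "\<lambda>n. \<Union>k<n. A k"] A by (simp add: image_subset_iff)
    then have "\<forall>\<^sub>F n in sequentially. prob UNIV - e / 3 < prob (\<Union>k<n. A k)"
      by (rule order_tendstoD) (use e in simp)
    then have "\<forall>\<^sub>F n in sequentially. prob UNIV - e / 3 < prob (\<Union>k<n. A k) \<and> 0 < n"
      using eventually_gt_at_top[of 0] by eventually_elim simp
    then obtain n where n: "prob UNIV - e / 3 < prob (\<Union>k<n. A k)" "0 < n"
      by (auto simp: eventually_sequentially)
    have "\<forall>k. \<exists>I. prob (A k - E I) + prob (E I - A k) < e / 3 / n"
      using approx[OF A] e n(2) by simp
    then obtain I where I: "\<And>k. prob (A k - E (I k)) + prob (E (I k) - A k) < e / 3 / n" by metis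
    define c where "c = map (\<lambda>k. (I k, k)) [0..<n]"
    \<comment> \<open>The uncovered points and the \<open>n\<close> symmetric differences contribute
      \<open>e / 3\<close> each to the measure of \<open>Z\<close>. Off \<open>Z\<close> the pair
      found by \<open>s\<close> may differ from the expected one, but membership in its
      \<open>E (I k')\<close> still implies membership in \<open>A k'\<close>, so the error is below
      the remaining \<open>e / 3\<close>.\<close>
    define Z where "Z = (UNIV - (\<Union>k<n. A k)) \<union> (\<Union>k<n. (A k - E (I k)) \<union> (E (I k) - A k))"
    have Zm [measurable]: "Z \<in> sets borel" by (simp add: Z_def)
    have "prob Z \<le> prob (UNIV - (\<Union>k<n. A k)) + prob (\<Union>k<n. (A k - E (I k)) \<union> (E (I k) - A k))"
      unfolding Z_def by (intro measure_Un_le) auto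
    also have "prob (UNIV - (\<Union>k<n. A k)) < e / 3"
      using n(1) by (subst finite_measure_Diff) auto
    also have "prob (\<Union>k<n. (A k - E (I k)) \<union> (E (I k) - A k)) \<le> (\<Sum>k<n. prob ((A k - E (I k)) \<union> (E (I k) - A k)))"
      by (intro measure_UNION_le) auto
    also have "\<dots> \<le> (\<Sum>k<n. e / 3 / n)"
    proof (rule sum_mono)
      fix k
      have "prob ((A k - E (I k)) \<union> (E (I k) - A k)) \<le> prob (A k - E (I k)) + prob (E (I k) - A k)"
        by (intro measure_Un_le) auto
      then show "prob ((A k - E (I k)) \<union> (E (I k) - A k)) \<le> e / 3 / n" using I[of k] by linarith
    qed
    also have "\<dots> = e / 3" using n(2) by simp
    finally have Z: "prob Z < 2 * (e / 3)" by simp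
    have close: "\<delta> (s c x) (f x) \<le> e / 3 + indicator Z x" for x
    proof (cases "x \<in> Z")
      case True
      then show ?thesis using e by (simp add: \<delta>_def)
    next
      case False
      then obtain k where k: "k < n" "x \<in> A k" "x \<in> E (I k)" unfolding Z_def by blast
      then have "(I k, k) \<in> set c" by (simp add: c_def)
      then have "find (\<lambda>p. x \<in> E (fst p)) c \<noteq> None"
        using k(3) unfolding find_None_iff by (intro notI) (metis fst_conv)
      then obtain p where p: "find (\<lambda>p. x \<in> E (fst p)) c = Some p" by auto
      then have "p \<in> set c" "x \<in> E (fst p)"
        unfolding find_Some_iff by auto
      then obtain k' where "k' < n" "x \<in> E (I k')" "p = (I k', k')"
        by (auto simp: c_def)
      then have "x \<in> A k'" using False unfolding Z_def by blast
      then show ?thesis using p \<open>p = (I k', k')\<close> False by (simp add: s_def A_def \<delta>_def)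
    qed
    have "L0_dist \<delta> \<mu> (ae_class M (s c)) F = (\<integral>x. \<delta> (s c x) (f x) \<partial>\<mu>)"
      unfolding Ff by (rule L0_dist_ae_class[OF \<delta> sm f])
    also have "\<dots> \<le> (\<integral>x. e / 3 + indicator Z x \<partial>\<mu>)"
      using close by (intro integral_mono integrable_d[OF \<delta> sm f]) (auto simp: emeasure_eq_measure)
    also have "\<dots> = e / 3 + prob Z"
      by (simp add: emeasure_eq_measure prob_space[simplified])
    also have "\<dots> < e" using Z by simp
    finally show ?thesis by blast
  qed
  have "second_countable L.mtopology"
  proof (rule L.second_countable_of_dense[OF _ _ dense])
    show "countable (range (\<lambda>c. ae_class M (s c)))" by simp
    show "range (\<lambda>c. ae_class M (s c)) \<subseteq> L0 M" using sm by auto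
  qed
  then show ?thesis
    unfolding L0_topology_cong[OF d \<delta>] unfolding L0_topology_def .
qed

end

section \<open>Automorphisms\<close>

lemma open_map_prod:
  assumes f: "open_map X X' f" and g: "open_map Y Y' g"
  shows "open_map (prod_topology X Y) (prod_topology X' Y') (\<lambda>(x, y). (f x, g y))"
  unfolding open_map_def
proof (intro allI impI)
  fix W assume W: "openin (prod_topology X Y) W"
  show "openin (prod_topology X' Y') ((\<lambda>(x, y). (f x, g y)) ` W)"
    unfolding openin_prod_topology_alt
  proof (intro allI impI)
    fix a b assume "(a, b) \<in> (\<lambda>(x, y). (f x, g y)) ` W"
    then obtain x y where xy: "(x, y) \<in> W" "a = f x" "b = g y" by auto
    from W[unfolded openin_prod_topology_alt, rule_format, OF xy(1)]
    obtain U V where UV: "openin X U" "openin Y V" "x \<in> U" "y \<in> V" "U \<times> V \<subseteq> W"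
      by blast
    have "openin X' (f ` U)" "openin Y' (g ` V)"
      using f g UV by (auto simp: open_map_def)
    moreover have "f ` U \<times> g ` V \<subseteq> (\<lambda>(x, y). (f x, g y)) ` W"
      using UV(5) by force
    ultimately show "\<exists>U V. openin X' U \<and> openin Y' V \<and> a \<in> U \<and> b \<in> V \<and> U \<times> V \<subseteq> (\<lambda>(x, y). (f x, g y)) ` W"
      using xy UV by (intro exI[of _ "f ` U"] exI[of _ "g ` V"]) auto
  qed
qed

text \<open>Continuity gives a neighbourhood \<open>V\<close> of \<open>x\<close> such that all
  products z b^-1 x with z, b in \<open>V\<close> lie in \<open>U\<close>. For \<open>y\<close> in
  the closure of \<open>V\<close>, translation by x y^-1 sends points near \<open>y\<close> close to
  \<open>x\<close>, so some z in \<open>V\<close> has b = x y^-1 z in \<open>V\<close>; then y = z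
  b^-1 x lies in \<open>U\<close>.\<close>

lemma topological_group_imp_regular_space:
  assumes G: "group G" and top: "topspace T = carrier G"
    and mult: "continuous_map (prod_topology T T) T (\<lambda>(g, h). g \<otimes>\<^bsub>G\<^esub> h)"
    and inv: "continuous_map T T (\<lambda>g. inv\<^bsub>G\<^esub> g)"
  shows "regular_space T"
  unfolding regular_space_def
proof (intro allI impI)
  interpret group G by fact
  fix C x assume "closedin T C \<and> x \<in> topspace T - C"
  then have C: "closedin T C" and x: "x \<in> carrier G" "x \<notin> C" by (auto simp: top)
  define U where "U = topspace T - C"
  have "openin T U" unfolding U_def using C by (intro openin_diff openin_topspace)
  then have U: "openin T U" "x \<in> U" using x by (auto simp: U_def top)
  define c where "c p = fst p \<otimes>\<^bsub>G\<^esub> (inv\<^bsub>G\<^esub> (snd p) \<otimes>\<^bsub>G\<^esub> x)" for p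
  have m2: "continuous_map Z T (\<lambda>z. p z \<otimes>\<^bsub>G\<^esub> q z)" if "continuous_map Z T p" "continuous_map Z T q" for Z :: "('a \<times> 'a) topology" and p q
  proof -
    have "continuous_map Z T ((\<lambda>(g, h). g \<otimes>\<^bsub>G\<^esub> h) \<circ> (\<lambda>z. (p z, q z)))"
      using that by (intro continuous_map_compose[OF _ mult]) (simp add: continuous_map_pairwise o_def)
    then show ?thesis by (simp add: o_def)
  qed
  have "continuous_map (prod_topology T T) T c"
  proof -
    have "continuous_map (prod_topology T T) T (\<lambda>p. inv\<^bsub>G\<^esub> (snd p))"
      using continuous_map_compose[OF continuous_map_snd inv] by (simp add: o_def)
    then show ?thesis
      unfolding c_def using x by (intro m2 continuous_map_fst) (auto simp: top)
  qed
  then have "openin (prod_topology T T) {p \<in> topspace (prod_topology T T). c p \<in> U}"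
    using U(1) by (rule openin_continuous_map_preimage)
  moreover have "(x, x) \<in> {p \<in> topspace (prod_topology T T). c p \<in> U}"
    using x U by (simp add: c_def top)
  ultimately obtain W1 W2 where W: "openin T W1" "openin T W2" "x \<in> W1" "x \<in> W2"
    "W1 \<times> W2 \<subseteq> {p \<in> topspace (prod_topology T T). c p \<in> U}"
    unfolding openin_prod_topology_alt by meson
  define V where "V = W1 \<inter> W2"
  have V: "openin T V" "x \<in> V" using W by (auto simp: V_def)
  have VG: "V \<subseteq> carrier G" using openin_subset[OF V(1)] top by simp
  have "T closure_of V \<subseteq> U"
  proof
    fix y assume y: "y \<in> T closure_of V"
    then have yG: "y \<in> carrier G" using closure_of_subset_topspace[of T V] top by auto
    define Q where "Q = {z \<in> topspace T. x \<otimes>\<^bsub>G\<^esub> inv\<^bsub>G\<^esub> y \<otimes>\<^bsub>G\<^esub> z \<in> V}"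
    have "continuous_map T T (\<lambda>z. x \<otimes>\<^bsub>G\<^esub> inv\<^bsub>G\<^esub> y \<otimes>\<^bsub>G\<^esub> z)"
      using x yG continuous_map_compose[of T "prod_topology T T" "\<lambda>z. (x \<otimes>\<^bsub>G\<^esub> inv\<^bsub>G\<^esub> y, z)", OF _ mult]
      by (simp add: o_def continuous_map_pairwise top)
    then have "openin T Q" unfolding Q_def using V(1) by (rule openin_continuous_map_preimage)
    moreover have "y \<in> Q" using V x yG by (simp add: Q_def top m_assoc)
    ultimately obtain z where z: "z \<in> V" "z \<in> Q" using y unfolding in_closure_of by blast
    define b where "b = x \<otimes>\<^bsub>G\<^esub> inv\<^bsub>G\<^esub> y \<otimes>\<^bsub>G\<^esub> z"
    have zG: "z \<in> carrier G" and b: "b \<in> V" using z VG by (auto simp: Q_def b_def)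
    have "z \<otimes>\<^bsub>G\<^esub> (inv\<^bsub>G\<^esub> z \<otimes>\<^bsub>G\<^esub> y) = y"
      using m_assoc[of z "inv\<^bsub>G\<^esub> z" y] zG yG by simp
    then have "c (z, b) = y"
      using x yG zG by (simp add: c_def b_def inv_mult_group m_assoc)
    moreover have "c (z, b) \<in> U" using W(5) z(1) b by (auto simp: V_def)
    ultimately show "y \<in> U" by simp
  qed
  then have "C \<subseteq> topspace T - T closure_of V"
    using closedin_subset[OF C] by (auto simp: U_def)
  moreover have "disjnt V (topspace T - T closure_of V)"
    using closure_of_subset[OF openin_subset[OF V(1)]] by (auto simp: disjnt_iff)
  moreover have "openin T (topspace T - T closure_of V)" by (simp add: openin_diff)
  ultimately show "\<exists>U V. openin T U \<and> openin T V \<and> x \<in> U \<and> C \<subseteq> V \<and> disjnt U V"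
    using V by blast
qed

section \<open>Measure preserving bijections\<close>

lemma mp_bijectionsD:
  assumes "T \<in> mp_bijections M"
  shows "bij T" "T \<in> borel \<rightarrow>\<^sub>M borel" "inv_into UNIV T \<in> borel \<rightarrow>\<^sub>M borel" "mp_map M T" "mp_map M (inv_into UNIV T)"
    "\<And>x. T (inv_into UNIV T x) = x" "\<And>x. inv_into UNIV T (T x) = x"
proof -
  show T: "bij T" "T \<in> borel \<rightarrow>\<^sub>M borel" "inv_into UNIV T \<in> borel \<rightarrow>\<^sub>M borel"
    using assms by (auto simp: mp_bijections_def)
  show "mp_map M T" using assms by (auto simp: mp_bijections_def mp_map_def)
  have "inv_into UNIV T -` A = T ` A" for A using T(1) by (metis bij_vimage_eq_inv_image bij_imp_bij_inv inv_inv_eq)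
  then show "mp_map M (inv_into UNIV T)" using assms by (auto simp: mp_bijections_def mp_map_def)
  show "\<And>x. T (inv_into UNIV T x) = x" "\<And>x. inv_into UNIV T (T x) = x"
    using T(1) by (simp_all add: bij_is_inj bij_is_surj surj_f_inv_f)
qed

lemma mp_bijectionsI:
  assumes T: "mp_map M T" and R: "mp_map M R" and TR: "\<And>x. T (R x) = x" "\<And>x. R (T x) = x"
  shows "T \<in> mp_bijections M" "inv_into UNIV T = R"
proof -
  have b: "bij T" by (rule o_bij[of R]) (auto simp: TR)
  show inv: "inv_into UNIV T = R" using TR by (intro inv_equality) auto
  have "T ` A = R -` A" for A
  proof (rule Set.set_eqI)
    show "x \<in> T ` A \<longleftrightarrow> x \<in> R -` A" for x by (metis TR image_iff vimage_eq)
  qed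
  then show "T \<in> mp_bijections M"
    using T R b by (auto simp: mp_bijections_def mp_map_def inv)
qed

lemma mp_map_id: "mp_map M id"
  by (simp add: mp_map_def)

lemma mp_map_comp:
  assumes S: "mp_map M S" and T: "mp_map M T"
  shows "mp_map M (S \<circ> T)"
  unfolding mp_map_def
proof (intro conjI ballI)
  have m: "S \<in> borel \<rightarrow>\<^sub>M borel" "T \<in> borel \<rightarrow>\<^sub>M borel" using S T by (simp_all add: mp_map_def)
  show "S \<circ> T \<in> borel \<rightarrow>\<^sub>M borel" by (rule measurable_comp[OF m(2,1)])
  fix A :: "'a set" assume A: "A \<in> sets borel"
  have "S -` A \<in> sets borel" using measurable_sets[OF m(1) A] by simp
  then show "emeasure M ((S \<circ> T) -` A) = emeasure M A"
    using S T A unfolding mp_map_def vimage_comp[symmetric] by simp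
qed

lemma mp_bijections_id: "id \<in> mp_bijections M"
  by (rule mp_bijectionsI(1)[OF mp_map_id mp_map_id]) auto

lemma mp_bijections_inv: "T \<in> mp_bijections M \<Longrightarrow> inv_into UNIV T \<in> mp_bijections M"
  by (rule mp_bijectionsI(1)[of M "inv_into UNIV T" T]) (simp_all add: mp_bijectionsD)

lemma mp_bijections_comp:
  assumes "S \<in> mp_bijections M" "T \<in> mp_bijections M"
  shows "S \<circ> T \<in> mp_bijections M"
  by (rule mp_bijectionsI(1)[of M "S \<circ> T" "inv_into UNIV T \<circ> inv_into UNIV S"])
    (simp_all add: mp_map_comp mp_bijectionsD[OF assms(1)] mp_bijectionsD[OF assms(2)])

context locally_finite_borel
begin

text \<open>An inequality is assumed because for limits of measure preserving maps nothing more is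
  known at first; it suffices to pull null sets back to null sets.\<close>

lemma AE_compose_nonsingular:
  assumes T: "T \<in> borel \<rightarrow>\<^sub>M borel" and le: "\<And>A. A \<in> sets borel \<Longrightarrow> emeasure M (T -` A) \<le> emeasure M A"
    and P: "AE x in M. P x"
  shows "AE x in M. P (T x)"
proof -
  obtain N where N: "{x \<in> space M. \<not> P x} \<subseteq> N" "N \<in> sets M" "emeasure M N = 0"
    using P by (auto elim: AE_E)
  have NB: "N \<in> sets borel" using N(2) by simp
  have "T -` N \<in> null_sets M"
    using le[OF NB] N(3) measurable_sets[OF T NB] by (auto intro!: null_setsI)
  then show ?thesis
  proof (rule AE_I')
    show "{x \<in> space M. \<not> P (T x)} \<subseteq> T -` N" using N(1) by auto
  qed
qed

lemma AE_compose_mp: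
  assumes "mp_map M T" "AE x in M. P x"
  shows "AE x in M. P (T x)"
  by (rule AE_compose_nonsingular[OF _ _ assms(2)]) (use assms(1) in \<open>simp_all add: mp_map_def\<close>)

text \<open>
  The set \<open>Z\<close> below is invariant under both maps, so replacing them by the identity off \<open>Z\<close>
  yields honest mutually inverse bijections; no isomorphism of the exceptional null sets is needed.
\<close>

lemma ex_mp_bijection:
  assumes T: "T \<in> borel \<rightarrow>\<^sub>M borel" and R: "R \<in> borel \<rightarrow>\<^sub>M borel"
    and leT: "\<And>A. A \<in> sets borel \<Longrightarrow> emeasure M (T -` A) \<le> emeasure M A"
    and leR: "\<And>A. A \<in> sets borel \<Longrightarrow> emeasure M (R -` A) \<le> emeasure M A"
    and RT: "AE x in M. R (T x) = x" and TR: "AE x in M. T (R x) = x"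
  shows "\<exists>T'\<in>mp_bijections M. (AE x in M. T x = T' x) \<and> (AE x in M. R x = inv_into UNIV T' x)"
proof -
  note [measurable] = T R
  define Z0 where "Z0 = {x. R (T x) = x \<and> T (R x) = x}"
  have Z0: "Z0 \<in> sets borel"
  proof -
    have "{x \<in> space borel. R (T x) = x \<and> T (R x) = x} \<in> sets borel" by measurable
    then show ?thesis by (simp add: Z0_def)
  qed
  \<comment> \<open>Membership in stage \<open>Suc n\<close> puts both images into stage
    \<open>n\<close>, so it is the intersection \<open>Y\<close> of all stages that both maps send
    into itself.\<close>
  define Z where "Z = rec_nat Z0 (\<lambda>n A. A \<inter> T -` A \<inter> R -` A)"
  have ZS: "Z 0 = Z0" "Z (Suc n) = Z n \<inter> T -` Z n \<inter> R -` Z n" for n by (simp_all add: Z_def)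
  have vm: "h -` A \<in> sets borel" if "h \<in> borel \<rightarrow>\<^sub>M borel" "A \<in> sets borel" for h :: "'x \<Rightarrow> 'x" and A
    using measurable_sets[OF that] by simp
  have Zn: "Z n \<in> sets borel \<and> (AE x in M. x \<in> Z n)" for n
  proof (induction n)
    case 0
    have "AE x in M. x \<in> Z0" using RT TR by eventually_elim (simp add: Z0_def)
    then show ?case using Z0 by (simp add: ZS)
  next
    case (Suc n)
    then have n: "AE x in M. x \<in> Z n" by simp
    have "AE x in M. T x \<in> Z n" by (rule AE_compose_nonsingular[OF T leT n])
    moreover have "AE x in M. R x \<in> Z n" by (rule AE_compose_nonsingular[OF R leR n])
    ultimately have "AE x in M. x \<in> Z (Suc n)" using n by eventually_elim (simp add: ZS)
    then show ?case using Suc vm[OF T, of "Z n"] vm[OF R, of "Z n"] by (auto simp: ZS)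
  qed
  define Y where "Y = (\<Inter>n. Z n)"
  have Y [measurable]: "Y \<in> sets borel" using Zn by (auto simp: Y_def)
  have aeY: "AE x in M. x \<in> Y"
    using Zn by (simp add: Y_def AE_all_countable)
  have inv: "T x \<in> Y" "R x \<in> Y" if "x \<in> Y" for x
  proof -
    have "x \<in> Z (Suc n)" for n using that by (auto simp: Y_def)
    then show "T x \<in> Y" "R x \<in> Y" by (auto simp: Y_def ZS)
  qed
  have id: "R (T x) = x" "T (R x) = x" if "x \<in> Y" for x
    using that ZS(1) by (auto simp: Y_def Z0_def)
  define T' where "T' x = (if x \<in> Y then T x else x)" for x
  define R' where "R' x = (if x \<in> Y then R x else x)" for x
  have TR': "T' (R' x) = x" "R' (T' x) = x" for x
    using inv id by (auto simp: T'_def R'_def)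
  have m: "T' \<in> borel \<rightarrow>\<^sub>M borel" "R' \<in> borel \<rightarrow>\<^sub>M borel"
    unfolding T'_def R'_def by measurable
  have ae: "AE x in M. T x = T' x" "AE x in M. R x = R' x"
    using aeY by (auto elim!: eventually_mono simp: T'_def R'_def)
  have le: "emeasure M (T' -` A) \<le> emeasure M A" "emeasure M (R' -` A) \<le> emeasure M A"
    if A: "A \<in> sets borel" for A
  proof -
    have "emeasure M (T' -` A) = emeasure M (T -` A)"
      by (rule emeasure_eq_AE) (use ae(1) A vm T m in \<open>auto elim!: eventually_mono\<close>)
    then show "emeasure M (T' -` A) \<le> emeasure M A" using leT[OF A] by simp
    have "emeasure M (R' -` A) = emeasure M (R -` A)"
      by (rule emeasure_eq_AE) (use ae(2) A vm R m in \<open>auto elim!: eventually_mono\<close>)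
    then show "emeasure M (R' -` A) \<le> emeasure M A" using leR[OF A] by simp
  qed
  \<comment> \<open>The inequality for one map, applied to the preimage of \<open>A\<close> under
    its inverse, is the reverse inequality for the other.\<close>
  have mp: "mp_map M T'" "mp_map M R'"
  proof -
    have "emeasure M A \<le> emeasure M (T' -` A)" "emeasure M A \<le> emeasure M (R' -` A)" if A: "A \<in> sets borel" for A
    proof -
      have "R' -` T' -` A = A" "T' -` R' -` A = A" by (auto simp: TR')
      then show "emeasure M A \<le> emeasure M (T' -` A)" "emeasure M A \<le> emeasure M (R' -` A)"
        using le(2)[of "T' -` A"] le(1)[of "R' -` A"] vm m A by auto
    qed
    then show "mp_map M T'" "mp_map M R'"
      using le m by (auto simp: mp_map_def intro: antisym)
  qed
  show ?thesis
    using mp_bijectionsI[OF mp TR'] ae by (intro bexI[of _ T']) auto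
qed

end

section \<open>Cocycles\<close>

locale polish_action = locally_finite_borel M \<mu> for M \<mu> :: "'x::polish_space measure" +
  fixes G :: "'g::polish_space monoid" and \<phi> :: "'g \<Rightarrow> 'x \<Rightarrow> 'x" and d :: "'g \<Rightarrow> 'g \<Rightarrow> real"
  assumes polish_group: "polish_group G euclidean"
    and action: "group_action G UNIV \<phi>"
    and continuous_action: "continuous_on UNIV (\<lambda>(g, x). \<phi> g x)"
    and metric: "compatible_bounded_metric d"
begin

sublocale group G
  using polish_group by (simp add: polish_group_def)

lemma carrier_G [simp]: "carrier G = UNIV"
  using polish_group by (simp add: polish_group_def)

lemma action_mult [simp]: "\<phi> (g \<otimes>\<^bsub>G\<^esub> h) x = \<phi> g (\<phi> h x)"
  using group_action.composition_rule[OF action, of x g h] by simp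

lemma action_one [simp]: "\<phi> \<one>\<^bsub>G\<^esub> x = x"
  using group_action.id_eq_one[OF action] by (metis UNIV_I restrict_apply)

lemma action_inv [simp]: "\<phi> (inv\<^bsub>G\<^esub> g) (\<phi> g x) = x" "\<phi> g (\<phi> (inv\<^bsub>G\<^esub> g) x) = x"
  unfolding action_mult[symmetric] by simp_all

lemma orbit_eq: "orbit G \<phi> x = range (\<lambda>g. \<phi> g x)"
  by (auto simp: orbit_def)

lemma continuous_mult_fst_snd: "continuous_on UNIV (\<lambda>p. fst p \<otimes>\<^bsub>G\<^esub> snd p)"
  using polish_group by (simp add: polish_group_def split_beta prod_topology_euclidean)

lemma continuous_inv: "continuous_on UNIV (\<lambda>g. inv\<^bsub>G\<^esub> g)"
  using polish_group by (simp add: polish_group_def)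

lemma continuous_action_fst_snd: "continuous_on UNIV (\<lambda>p. \<phi> (fst p) (snd p))"
  using continuous_action by (simp add: split_beta)

lemma tendsto_mult_G: "u \<longlonglongrightarrow> a \<Longrightarrow> v \<longlonglongrightarrow> b \<Longrightarrow> (\<lambda>n. u n \<otimes>\<^bsub>G\<^esub> v n) \<longlonglongrightarrow> a \<otimes>\<^bsub>G\<^esub> b"
  using continuous_on_tendsto_compose[OF continuous_mult_fst_snd, of "\<lambda>n. (u n, v n)" "(a, b)" sequentially]
  by (simp add: tendsto_Pair)

lemma tendsto_inv_G: "u \<longlonglongrightarrow> a \<Longrightarrow> (\<lambda>n. inv\<^bsub>G\<^esub> (u n)) \<longlonglongrightarrow> inv\<^bsub>G\<^esub> a"
  using continuous_on_tendsto_compose[OF continuous_inv, of u a sequentially] by simp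

lemma tendsto_action: "u \<longlonglongrightarrow> a \<Longrightarrow> v \<longlonglongrightarrow> x \<Longrightarrow> (\<lambda>n. \<phi> (u n) (v n)) \<longlonglongrightarrow> \<phi> a x"
  using continuous_on_tendsto_compose[OF continuous_action_fst_snd, of "\<lambda>n. (u n, v n)" "(a, x)" sequentially]
  by (simp add: tendsto_Pair)

lemma measurable_mult_G:
  "f \<in> borel \<rightarrow>\<^sub>M borel \<Longrightarrow> h \<in> borel \<rightarrow>\<^sub>M borel \<Longrightarrow> (\<lambda>x. f x \<otimes>\<^bsub>G\<^esub> h x) \<in> borel \<rightarrow>\<^sub>M borel" for f h :: "'x \<Rightarrow> 'g"
  by (rule borel_measurable_continuous_Pair[OF _ _ continuous_mult_fst_snd])

lemma measurable_inv_G: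
  "f \<in> borel \<rightarrow>\<^sub>M borel \<Longrightarrow> (\<lambda>x. inv\<^bsub>G\<^esub> (f x)) \<in> borel \<rightarrow>\<^sub>M borel" for f :: "'x \<Rightarrow> 'g"
  by (rule measurable_compose[OF _ borel_measurable_continuous_onI[OF continuous_inv]])

lemma measurable_action:
  "f \<in> borel \<rightarrow>\<^sub>M borel \<Longrightarrow> h \<in> borel \<rightarrow>\<^sub>M borel \<Longrightarrow> (\<lambda>x. \<phi> (f x) (h x)) \<in> borel \<rightarrow>\<^sub>M borel" for f :: "'x \<Rightarrow> 'g" and h :: "'x \<Rightarrow> 'x"
  by (rule borel_measurable_continuous_Pair[OF _ _ continuous_action_fst_snd])

abbreviation ofg :: "('x \<Rightarrow> 'x) set monoid" where "ofg \<equiv> orbit_full_group G \<phi> M"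
abbreviation ofg_topology :: "('x \<Rightarrow> 'x) set topology" where "ofg_topology \<equiv> orbital_topology G \<phi> M d \<mu>"
abbreviation L0_top :: "('x \<Rightarrow> 'g) set topology" where "L0_top \<equiv> L0_topology M d \<mu>"
abbreviation cocycle_topology :: "('x \<Rightarrow> 'g) set topology" where
  "cocycle_topology \<equiv> subtopology L0_top (orbit_cocycles \<phi> M)"

text \<open>Pairs a Borel representative with a genuine bijection, so that composition and inversion
  can be carried out pointwise; the link between the two holds only almost everywhere.\<close>

definition cocycle :: "('x \<Rightarrow> 'g) \<Rightarrow> ('x \<Rightarrow> 'x) \<Rightarrow> bool" where
  "cocycle f T \<longleftrightarrow> f \<in> borel \<rightarrow>\<^sub>M borel \<and> T \<in> mp_bijections M \<and> (AE x in M. \<phi> (f x) x = T x)"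

lemma orbit_map_ae_class: "orbit_map \<phi> M (ae_class M f) = ae_class M (\<lambda>x. \<phi> (f x) x)"
  unfolding orbit_map_def ae_class_eq_iff using AE_ae_rep[of M f] by eventually_elim simp

lemma carrier_Aut: "carrier (Aut M) = ae_class M ` mp_bijections M"
  by (simp add: Aut_def)

lemma carrier_ofg: "carrier ofg = ae_class M ` {T \<in> mp_bijections M. AE x in M. T x \<in> orbit G \<phi> x}"
  by (simp add: orbit_full_group_def)

lemma orbit_map_cocycle: "cocycle f T \<Longrightarrow> orbit_map \<phi> M (ae_class M f) = ae_class M T"
  by (simp add: orbit_map_ae_class cocycle_def ae_class_eq_iff)

lemma mem_orbit_cocycles_iff: "F \<in> orbit_cocycles \<phi> M \<longleftrightarrow> (\<exists>f T. cocycle f T \<and> F = ae_class M f)"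
proof
  assume "F \<in> orbit_cocycles \<phi> M"
  then have F: "F \<in> L0 M" "orbit_map \<phi> M F \<in> ae_class M ` mp_bijections M"
    by (auto simp: orbit_cocycles_def carrier_Aut)
  obtain f where f: "f \<in> borel \<rightarrow>\<^sub>M borel" "F = ae_class M f" using F(1) unfolding mem_L0_iff by blast
  obtain T where T: "T \<in> mp_bijections M" "orbit_map \<phi> M F = ae_class M T" using F(2) by blast
  then have "cocycle f T" using f by (simp add: cocycle_def orbit_map_ae_class ae_class_eq_iff)
  then show "\<exists>f T. cocycle f T \<and> F = ae_class M f" using f(2) by blast
next
  assume "\<exists>f T. cocycle f T \<and> F = ae_class M f"
  then obtain f T where f: "cocycle f T" "F = ae_class M f" by blast
  then show "F \<in> orbit_cocycles \<phi> M"
    using orbit_map_cocycle[OF f(1)] by (auto simp: orbit_cocycles_def carrier_Aut cocycle_def)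
qed

lemma ae_class_cocycle: "cocycle f T \<Longrightarrow> ae_class M f \<in> orbit_cocycles \<phi> M"
  unfolding mem_orbit_cocycles_iff by blast

lemma cocycle_in_carrier: "cocycle f T \<Longrightarrow> ae_class M T \<in> carrier ofg"
  unfolding carrier_ofg
proof (rule imageI, clarify, intro conjI)
  assume "cocycle f T"
  then show "T \<in> mp_bijections M" "AE x in M. T x \<in> orbit G \<phi> x"
    unfolding cocycle_def orbit_eq by (auto elim!: eventually_mono) (metis rangeI)
qed

text \<open>
  A measurable choice of group elements moving \<open>x\<close> to \<open>T x\<close>: the relation \<open>\<phi> g x = y\<close> is closed, so a
  selector exists almost everywhere for the distribution of \<open>(x, T x)\<close>.
\<close>

lemma ex_cocycle:
  assumes T: "T \<in> mp_bijections M" and orb: "AE x in M. T x \<in> orbit G \<phi> x"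
  shows "\<exists>f. cocycle f T"
proof -
  interpret prob_space \<mu> by (rule prob_mu)
  have Tm: "T \<in> borel \<rightarrow>\<^sub>M borel" using T by (rule mp_bijectionsD)
  have pm: "(\<lambda>x. (x, T x)) \<in> borel \<rightarrow>\<^sub>M borel"
    using Tm by (simp add: borel_prod[symmetric])
  then have pm\<mu>: "(\<lambda>x. (x, T x)) \<in> \<mu> \<rightarrow>\<^sub>M borel" by simp
  define \<nu> where "\<nu> = distr \<mu> borel (\<lambda>x. (x, T x))"
  define R where "R = {p :: ('x \<times> 'x) \<times> 'g. \<phi> (snd p) (fst (fst p)) = snd (fst p)}"
  have "continuous_on UNIV (\<lambda>p :: ('x \<times> 'x) \<times> 'g. \<phi> (snd p) (fst (fst p)))"
    using continuous_on_compose2[OF continuous_action_fst_snd, of UNIV "\<lambda>p :: ('x \<times> 'x) \<times> 'g. (snd p, fst (fst p))"]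
    by (simp add: continuous_intros)
  then have "closed R"
    unfolding R_def by (intro closed_Collect_eq) (auto intro!: continuous_intros)
  moreover have "finite_measure \<nu>"
    unfolding \<nu>_def by (rule finite_measure_distr[OF pm\<mu>])
  ultimately obtain f where f: "f \<in> borel \<rightarrow>\<^sub>M borel" "AE y in \<nu>. y \<in> fst ` R \<longrightarrow> (y, f y) \<in> R"
    using measurable_selection_closed[of \<nu> R] by (auto simp: \<nu>_def)
  have "AE x in \<mu>. (x, T x) \<in> fst ` R \<longrightarrow> ((x, T x), f (x, T x)) \<in> R"
    using f(2) unfolding \<nu>_def by (rule AE_distrD[OF pm\<mu>])
  then have "AE x in M. (x, T x) \<in> fst ` R \<longrightarrow> ((x, T x), f (x, T x)) \<in> R"
    by (simp only: AE_mu_iff)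
  then have "AE x in M. \<phi> (f (x, T x)) x = T x"
    using orb
  proof eventually_elim
    case (elim x)
    then obtain g where "T x = \<phi> g x" unfolding orbit_eq by blast
    then have "((x, T x), g) \<in> R" by (simp add: R_def)
    then have "(x, T x) \<in> fst ` R" by force
    then show ?case using elim(1) by (simp add: R_def)
  qed
  then have "cocycle (\<lambda>x. f (x, T x)) T"
    unfolding cocycle_def using T measurable_compose[OF pm f(1)] by auto
  then show ?thesis by blast
qed

lemma carrier_ofg_eq: "carrier ofg = {ae_class M T |f T. cocycle f T}"
proof
  show "carrier ofg \<subseteq> {ae_class M T |f T. cocycle f T}"
    unfolding carrier_ofg using ex_cocycle by fastforce
qed (use cocycle_in_carrier in auto)

lemma orbit_map_image: "orbit_map \<phi> M ` orbit_cocycles \<phi> M = carrier ofg"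
proof
  show "orbit_map \<phi> M ` orbit_cocycles \<phi> M \<subseteq> carrier ofg"
    using cocycle_in_carrier by (auto simp: mem_orbit_cocycles_iff orbit_map_cocycle)
  show "carrier ofg \<subseteq> orbit_map \<phi> M ` orbit_cocycles \<phi> M"
  proof
    fix C assume "C \<in> carrier ofg"
    then obtain f T where "C = ae_class M T" "cocycle f T" unfolding carrier_ofg_eq by blast
    then show "C \<in> orbit_map \<phi> M ` orbit_cocycles \<phi> M"
      using orbit_map_cocycle ae_class_cocycle by (metis imageI)
  qed
qed

text \<open>The cocycle identity: \<open>h x\<close> moves \<open>x\<close> to \<open>T x\<close>,
  and from there \<open>f (T x)\<close> moves on to \<open>S (T x)\<close>. Since the equation for
  \<open>f\<close> fails on a null set, that set is pulled back along \<open>T\<close>.\<close>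

lemma cocycle_mult:
  assumes f: "cocycle f S" and h: "cocycle h T"
  shows "cocycle (\<lambda>x. f (T x) \<otimes>\<^bsub>G\<^esub> h x) (S \<circ> T)"
proof -
  have T: "T \<in> mp_bijections M" using h by (simp add: cocycle_def)
  have 1: "AE x in M. \<phi> (f x) x = S x" and 2: "AE x in M. \<phi> (h x) x = T x"
    using f h by (simp_all add: cocycle_def)
  from AE_compose_mp[OF mp_bijectionsD(4)[OF T] 1] 2
  have "AE x in M. \<phi> (f (T x) \<otimes>\<^bsub>G\<^esub> h x) x = (S \<circ> T) x"
    by eventually_elim simp
  moreover have "(\<lambda>x. f (T x) \<otimes>\<^bsub>G\<^esub> h x) \<in> borel \<rightarrow>\<^sub>M borel"
    using f h measurable_compose[OF mp_bijectionsD(2)[OF T]] by (intro measurable_mult_G) (auto simp: cocycle_def)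
  ultimately show ?thesis
    using f h by (simp add: cocycle_def mp_bijections_comp)
qed

lemma cocycle_inverse:
  assumes f: "cocycle f S"
  shows "cocycle (\<lambda>x. inv\<^bsub>G\<^esub> (f (inv_into UNIV S x))) (inv_into UNIV S)"
proof -
  have S: "S \<in> mp_bijections M" using f by (simp add: cocycle_def)
  note S' = mp_bijectionsD[OF S]
  have "AE x in M. \<phi> (f x) x = S x" using f by (simp add: cocycle_def)
  from AE_compose_mp[OF S'(5) this]
  have "AE x in M. \<phi> (inv\<^bsub>G\<^esub> (f (inv_into UNIV S x))) x = inv_into UNIV S x"
  proof eventually_elim
    case (elim x)
    then show ?case using action_inv(1)[of "f (inv_into UNIV S x)" "inv_into UNIV S x"] by (simp add: S'(6))
  qed
  moreover have "(\<lambda>x. inv\<^bsub>G\<^esub> (f (inv_into UNIV S x))) \<in> borel \<rightarrow>\<^sub>M borel"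
    using f measurable_compose[OF S'(3)] by (intro measurable_inv_G) (auto simp: cocycle_def)
  ultimately show ?thesis
    using S by (simp add: cocycle_def mp_bijections_inv)
qed

lemma cocycle_one: "cocycle (\<lambda>x. \<one>\<^bsub>G\<^esub>) id"
  by (simp add: cocycle_def mp_bijections_id)

lemma ofg_mult: "T \<in> mp_bijections M \<Longrightarrow> ae_class M S \<otimes>\<^bsub>ofg\<^esub> ae_class M T = ae_class M (S \<circ> T)"
  using Aut_mult_ae_class[OF sets_M, of T S] by (simp add: orbit_full_group_def)

lemma ofg_one: "\<one>\<^bsub>ofg\<^esub> = ae_class M id"
  by (simp add: orbit_full_group_def Aut_def)

lemma group_ofg: "group ofg"
proof (rule groupI)
  show "\<one>\<^bsub>ofg\<^esub> \<in> carrier ofg"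
    unfolding ofg_one by (rule cocycle_in_carrier[OF cocycle_one])
  fix A assume "A \<in> carrier ofg"
  then obtain f S where A: "cocycle f S" "A = ae_class M S" unfolding carrier_ofg_eq by blast
  have S: "S \<in> mp_bijections M" using A by (simp add: cocycle_def)
  show "\<one>\<^bsub>ofg\<^esub> \<otimes>\<^bsub>ofg\<^esub> A = A" by (simp add: ofg_one A(2) ofg_mult[OF S])
  have "ae_class M (inv_into UNIV S) \<otimes>\<^bsub>ofg\<^esub> A = \<one>\<^bsub>ofg\<^esub>"
  proof -
    have "inv_into UNIV S \<circ> S = id" using mp_bijectionsD(7)[OF S] by auto
    then show ?thesis by (simp add: ofg_one A(2) ofg_mult[OF S])
  qed
  then show "\<exists>B\<in>carrier ofg. B \<otimes>\<^bsub>ofg\<^esub> A = \<one>\<^bsub>ofg\<^esub>"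
    using cocycle_in_carrier[OF cocycle_inverse[OF A(1)]] by blast
  fix B assume "B \<in> carrier ofg"
  then obtain h T where B: "cocycle h T" "B = ae_class M T" unfolding carrier_ofg_eq by blast
  have T: "T \<in> mp_bijections M" using B by (simp add: cocycle_def)
  show "A \<otimes>\<^bsub>ofg\<^esub> B \<in> carrier ofg"
    unfolding A(2) B(2) ofg_mult[OF T] by (rule cocycle_in_carrier[OF cocycle_mult[OF A(1) B(1)]])
  fix C assume "C \<in> carrier ofg"
  then obtain k U where C: "cocycle k U" "C = ae_class M U" unfolding carrier_ofg_eq by blast
  have U: "U \<in> mp_bijections M" using C by (simp add: cocycle_def)
  show "A \<otimes>\<^bsub>ofg\<^esub> B \<otimes>\<^bsub>ofg\<^esub> C = A \<otimes>\<^bsub>ofg\<^esub> (B \<otimes>\<^bsub>ofg\<^esub> C)"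
    by (simp add: A(2) B(2) C(2) ofg_mult T U mp_bijections_comp o_assoc)
qed

lemma ofg_inv:
  assumes "cocycle f S"
  shows "inv\<^bsub>ofg\<^esub> (ae_class M S) = ae_class M (inv_into UNIV S)"
proof -
  have S: "S \<in> mp_bijections M" using assms by (simp add: cocycle_def)
  have "inv_into UNIV S \<circ> S = id" using mp_bijectionsD(7)[OF S] by auto
  then have "ae_class M (inv_into UNIV S) \<otimes>\<^bsub>ofg\<^esub> ae_class M S = \<one>\<^bsub>ofg\<^esub>"
    by (simp add: ofg_one ofg_mult[OF S])
  then show ?thesis
    using group.inv_equality[OF group_ofg] cocycle_in_carrier[OF assms] cocycle_in_carrier[OF cocycle_inverse[OF assms]]
    by blast
qed

text \<open>Continuity of the action carries convergence from \<open>G\<close> to the topology of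
  the space, which supplies the hypothesis on the inner maps in
  \<open>conv_measure_compose\<close>.\<close>

lemma conv_measure_cocycle:
  assumes f: "\<And>n. cocycle (f n) (S n)" and g: "cocycle g T" and c: "conv_measure M f g"
  shows "conv_measure M S T"
proof (rule conv_measure_cong_AE)
  show "AE x in M. \<phi> (f n x) x = S n x" for n using f by (simp add: cocycle_def)
  show "AE x in M. \<phi> (g x) x = T x" using g by (simp add: cocycle_def)
  show "conv_measure M (\<lambda>n x. \<phi> (f n x) x) (\<lambda>x. \<phi> (g x) x)"
    by (rule conv_measure_map2[OF c c, where F = "\<lambda>x a b. \<phi> a x"]) (rule tendsto_action, auto)
qed

lemma conv_measure_cocycle_mult:
  assumes f: "\<And>n. cocycle (f n) (S n)" "cocycle f' S'" "conv_measure M f f'"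
    and h: "\<And>n. cocycle (h n) (T n)" "cocycle h' T'" "conv_measure M h h'"
  shows "conv_measure M (\<lambda>n x. f n (T n x) \<otimes>\<^bsub>G\<^esub> h n x) (\<lambda>x. f' (T' x) \<otimes>\<^bsub>G\<^esub> h' x)"
proof -
  have "conv_measure M (\<lambda>n x. f n (T n x)) (\<lambda>x. f' (T' x))"
  proof (rule conv_measure_compose)
    show "mp_map M (T n)" "f n \<in> borel \<rightarrow>\<^sub>M borel" for n
      using f h by (auto simp: cocycle_def intro: mp_bijectionsD)
    show "T' \<in> borel \<rightarrow>\<^sub>M borel" "f' \<in> borel \<rightarrow>\<^sub>M borel"
      using f h by (auto simp: cocycle_def intro: mp_bijectionsD)
    show "conv_measure M T T'" by (rule conv_measure_cocycle[OF h])
  qed fact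
  then show ?thesis
    using h(3) by (rule conv_measure_map2[where F = "\<lambda>x a b. a \<otimes>\<^bsub>G\<^esub> b"]) (rule tendsto_mult_G)
qed

lemma conv_measure_inverse_bijections:
  assumes f: "\<And>n. cocycle (f n) (S n)" "cocycle f' S'" "conv_measure M f f'"
  shows "conv_measure M (\<lambda>n. inv_into UNIV (S n)) (inv_into UNIV S')"
proof (rule conv_measure_inverse)
  have S: "S n \<in> mp_bijections M" "S' \<in> mp_bijections M" for n using f by (auto simp: cocycle_def)
  show "mp_map M (S n)" "mp_map M (inv_into UNIV (S n))" "S n (inv_into UNIV (S n) x) = x" for n x
    by (rule mp_bijectionsD[OF S(1)])+
  show "mp_map M S'" "mp_map M (inv_into UNIV S')" "inv_into UNIV S' (S' x) = x" for x
    by (rule mp_bijectionsD[OF S(2)])+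
  show "conv_measure M S S'" by (rule conv_measure_cocycle[OF f])
qed

lemma conv_measure_cocycle_inverse:
  assumes f: "\<And>n. cocycle (f n) (S n)" "cocycle f' S'" "conv_measure M f f'"
  shows "conv_measure M (\<lambda>n x. inv\<^bsub>G\<^esub> (f n (inv_into UNIV (S n) x))) (\<lambda>x. inv\<^bsub>G\<^esub> (f' (inv_into UNIV S' x)))"
proof -
  have S: "S n \<in> mp_bijections M" "S' \<in> mp_bijections M" for n using f by (auto simp: cocycle_def)
  have "conv_measure M (\<lambda>n x. f n (inv_into UNIV (S n) x)) (\<lambda>x. f' (inv_into UNIV S' x))"
  proof (rule conv_measure_compose[OF mp_bijectionsD(5)[OF S(1)] mp_bijectionsD(3)[OF S(2)]])
    show "conv_measure M (\<lambda>n. inv_into UNIV (S n)) (inv_into UNIV S')"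
      by (rule conv_measure_inverse_bijections[OF f])
  qed (use f in \<open>auto simp: cocycle_def\<close>)
  from conv_measure_map2[OF this this, where F = "\<lambda>x a b. inv\<^bsub>G\<^esub> a"]
  show ?thesis using tendsto_inv_G by blast
qed

end

section \<open>The topology of the orbit full group\<close>

context polish_action
begin

lemma topspace_L0_top [simp]: "topspace L0_top = L0 M"
  by (rule topspace_L0[OF metric])

lemma L0_Int_orbit_cocycles [simp]: "L0 M \<inter> orbit_cocycles \<phi> M = orbit_cocycles \<phi> M"
  by (auto simp: orbit_cocycles_def)

lemma topspace_cocycle: "topspace cocycle_topology = orbit_cocycles \<phi> M"
  by simp

lemma quotient_map_orbit_map: "quotient_map cocycle_topology ofg_topology (orbit_map \<phi> M)"
  unfolding orbital_topology_def
  by (rule quotient_map_quotient_topology) (simp only: topspace_cocycle orbit_map_image)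

lemma topspace_ofg [simp]: "topspace ofg_topology = carrier ofg"
  using quotient_imp_surjective_map[OF quotient_map_orbit_map] by (simp add: orbit_map_image)

lemma continuous_orbit_map: "continuous_map cocycle_topology ofg_topology (orbit_map \<phi> M)"
  using quotient_imp_continuous_map[OF quotient_map_orbit_map] .

lemma limitin_cocycle_iff:
  assumes "\<And>n. cocycle (f n) (S n)" "cocycle g T"
  shows "limitin cocycle_topology (\<lambda>n. ae_class M (f n)) (ae_class M g) sequentially \<longleftrightarrow> conv_measure M f g"
proof -
  have "f n \<in> borel \<rightarrow>\<^sub>M borel" "g \<in> borel \<rightarrow>\<^sub>M borel" for n using assms by (auto simp: cocycle_def)
  then show ?thesis
    using limitin_L0_iff[OF metric, of f g] ae_class_cocycle[OF assms(1)] ae_class_cocycle[OF assms(2)]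
    by (simp add: limitin_subtopology)
qed

lemma limitin_ofg:
  assumes f: "\<And>n. cocycle (f n) (S n)" "cocycle g T" and c: "conv_measure M f g"
  shows "limitin ofg_topology (\<lambda>n. ae_class M (S n)) (ae_class M T) sequentially"
proof -
  have "limitin cocycle_topology (\<lambda>n. ae_class M (f n)) (ae_class M g) sequentially"
    using limitin_cocycle_iff[OF f] c by simp
  from continuous_map_limit[OF continuous_orbit_map this]
  show ?thesis by (simp add: o_def orbit_map_cocycle[OF f(1)] orbit_map_cocycle[OF f(2)])
qed

lemma metrizable_cocycle: "metrizable_space cocycle_topology"
  by (rule metrizable_space_subtopology[OF metrizable_L0[OF metric]])

lemma second_countable_cocycle: "second_countable cocycle_topology"
  by (rule second_countable_subtopology[OF second_countable_L0[OF metric]])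

lemma cocycle_sequence:
  assumes "range \<sigma> \<subseteq> orbit_cocycles \<phi> M"
  obtains f S where "\<And>n. cocycle (f n) (S n)" "\<sigma> = (\<lambda>n. ae_class M (f n))"
proof -
  have "\<forall>n. \<exists>f S. cocycle f S \<and> \<sigma> n = ae_class M f"
  proof
    show "\<exists>f S. cocycle f S \<and> \<sigma> n = ae_class M f" for n
      using range_subsetD[OF assms, of n] unfolding mem_orbit_cocycles_iff .
  qed
  then obtain f S where "\<And>n. cocycle (f n) (S n) \<and> \<sigma> n = ae_class M (f n)" by metis
  then show ?thesis using that[of f S] by auto
qed

text \<open>Sequences suffice because the space of cocycles is metrizable. Through the quotient map
  the criterion also serves maps out of the orbit full group, whose metrizability is still
  unknown.\<close>

lemma continuous_map_cocycle:
  assumes h: "h \<in> orbit_cocycles \<phi> M \<rightarrow> topspace Y"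
    and lim: "\<And>f S g T. (\<And>n. cocycle (f n) (S n)) \<Longrightarrow> cocycle g T \<Longrightarrow> conv_measure M f g \<Longrightarrow>
      limitin Y (\<lambda>n. h (ae_class M (f n))) (h (ae_class M g)) sequentially"
  shows "continuous_map cocycle_topology Y h"
proof (rule continuous_map_sequentially_from_metrizable[OF metrizable_cocycle])
  show "h \<in> topspace cocycle_topology \<rightarrow> topspace Y" using h by simp
  fix \<sigma> l assume \<sigma>: "range \<sigma> \<subseteq> topspace cocycle_topology" and l: "limitin cocycle_topology \<sigma> l sequentially"
  obtain f S where f: "\<And>n. cocycle (f n) (S n)" "\<sigma> = (\<lambda>n. ae_class M (f n))"
    using cocycle_sequence \<sigma> by (metis topspace_cocycle)
  have "l \<in> orbit_cocycles \<phi> M" using limitin_topspace[OF l] by simp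
  then obtain g T where g: "cocycle g T" "l = ae_class M g" unfolding mem_orbit_cocycles_iff by blast
  have "conv_measure M f g" using l limitin_cocycle_iff[OF f(1) g(1)] f(2) g(2) by simp
  from lim[OF f(1) g(1) this] show "limitin Y (\<lambda>n. h (\<sigma> n)) (h l) sequentially" by (simp add: f(2) g(2))
qed

text \<open>
  Two cocycles \<open>f\<close> and \<open>f'\<close> of the same transformation differ by the map \<open>x \<mapsto> (f x)\<inverse> f' x\<close> into the
  stabilizers; multiplying by it on the right is a continuous map that preserves the fibres of \<open>orbit_map\<close>.
\<close>

lemma open_map_orbit_map: "open_map cocycle_topology ofg_topology (orbit_map \<phi> M)"
  unfolding open_map_def
proof (intro allI impI)
  fix U assume U: "openin cocycle_topology U"
  have UD: "U \<subseteq> orbit_cocycles \<phi> M" using openin_subset[OF U] by simp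
  show "openin ofg_topology (orbit_map \<phi> M ` U)"
    unfolding orbital_topology_def openin_quotient_topology
  proof
    show "orbit_map \<phi> M ` U \<subseteq> carrier ofg" using UD orbit_map_image by blast
    show "openin cocycle_topology {F \<in> topspace cocycle_topology. orbit_map \<phi> M F \<in> orbit_map \<phi> M ` U}"
    proof (subst openin_subopen, intro ballI)
      fix F assume "F \<in> {F \<in> topspace cocycle_topology. orbit_map \<phi> M F \<in> orbit_map \<phi> M ` U}"
      then obtain F' where F: "F \<in> orbit_cocycles \<phi> M" "F' \<in> U" "orbit_map \<phi> M F = orbit_map \<phi> M F'" by auto
      obtain f S where f: "cocycle f S" "F = ae_class M f" using F(1) unfolding mem_orbit_cocycles_iff by blast
      obtain f' S' where f': "cocycle f' S'" "F' = ae_class M f'" using F(2) UD unfolding mem_orbit_cocycles_iff[symmetric]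
        by (metis mem_orbit_cocycles_iff subsetD)
      define k where "k x = inv\<^bsub>G\<^esub> (f x) \<otimes>\<^bsub>G\<^esub> f' x" for x
      have km: "k \<in> borel \<rightarrow>\<^sub>M borel"
        unfolding k_def using f f' by (intro measurable_mult_G measurable_inv_G) (auto simp: cocycle_def)
      have "AE x in M. S x = S' x"
        using F(3) f f' by (simp add: orbit_map_cocycle ae_class_eq_iff)
      moreover have "AE x in M. \<phi> (f x) x = S x" "AE x in M. \<phi> (f' x) x = S' x"
        using f f' by (simp_all add: cocycle_def)
      ultimately have kx: "AE x in M. \<phi> (k x) x = x"
      proof eventually_elim
        case (elim x)
        then have "\<phi> (f' x) x = \<phi> (f x) x" by simp
        then show ?case by (simp add: k_def)
      qed
      have co: "cocycle (\<lambda>x. e x \<otimes>\<^bsub>G\<^esub> k x) R" if e: "cocycle e R" for e R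
      proof -
        have "AE x in M. \<phi> (e x) x = R x" using e by (simp add: cocycle_def)
        with kx have "AE x in M. \<phi> (e x \<otimes>\<^bsub>G\<^esub> k x) x = R x" by eventually_elim simp
        then show ?thesis using e km by (simp add: cocycle_def measurable_mult_G)
      qed
      define r where "r E = ae_class M (\<lambda>x. ae_rep E x \<otimes>\<^bsub>G\<^esub> k x)" for E
      have r: "r (ae_class M e) = ae_class M (\<lambda>x. e x \<otimes>\<^bsub>G\<^esub> k x)" for e
        unfolding r_def ae_class_eq_iff using AE_ae_rep[of M e] by eventually_elim simp
      have "continuous_map cocycle_topology cocycle_topology r"
      proof (rule continuous_map_cocycle)
        show "r \<in> orbit_cocycles \<phi> M \<rightarrow> topspace cocycle_topology"
          using co by (auto simp: mem_orbit_cocycles_iff r L0_Int_orbit_cocycles) blast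
        fix e R a T assume e: "\<And>n. cocycle (e n) (R n)" "cocycle a T" and c: "conv_measure M e a"
        have "conv_measure M (\<lambda>n x. e n x \<otimes>\<^bsub>G\<^esub> k x) (\<lambda>x. a x \<otimes>\<^bsub>G\<^esub> k x)"
          using c conv_measure_const by (rule conv_measure_map2[where F = "\<lambda>x a b. a \<otimes>\<^bsub>G\<^esub> b"]) (rule tendsto_mult_G)
        then show "limitin cocycle_topology (\<lambda>n. r (ae_class M (e n))) (r (ae_class M a)) sequentially"
          unfolding r using limitin_cocycle_iff[OF co[OF e(1)] co[OF e(2)]] by simp
      qed
      from openin_continuous_map_preimage[OF this U]
      have "openin cocycle_topology {E \<in> orbit_cocycles \<phi> M. r E \<in> U}" by simp
      moreover have "r F = F'"
      proof -
        have "f x \<otimes>\<^bsub>G\<^esub> k x = f' x" for x by (simp add: k_def m_assoc[symmetric])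
        then show ?thesis by (simp add: f(2) f'(2) r)
      qed
      then have "F \<in> {E \<in> orbit_cocycles \<phi> M. r E \<in> U}" using F by simp
      moreover have "orbit_map \<phi> M (r E) = orbit_map \<phi> M E" if "E \<in> orbit_cocycles \<phi> M" for E
      proof -
        from that obtain e R where "cocycle e R" "E = ae_class M e" unfolding mem_orbit_cocycles_iff by blast
        then show ?thesis using co by (simp add: r orbit_map_cocycle)
      qed
      then have "{E \<in> orbit_cocycles \<phi> M. r E \<in> U} \<subseteq>
          {F \<in> topspace cocycle_topology. orbit_map \<phi> M F \<in> orbit_map \<phi> M ` U}"
        by clarsimp (metis imageI)
      ultimately show "\<exists>W. openin cocycle_topology W \<and> F \<in> W \<and>
          W \<subseteq> {F \<in> topspace cocycle_topology. orbit_map \<phi> M F \<in> orbit_map \<phi> M ` U}"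
        by blast
    qed
  qed
qed

text \<open>Classes of transformations are also points of the metrizable space of measurable
  self-maps of the underlying space. The inclusion is injective and, by
  \<open>conv_measure_cocycle\<close>, continuous, so separation is inherited.\<close>

lemma Hausdorff_ofg: "Hausdorff_space ofg_topology"
proof (rule Hausdorff_space_injective_preimage)
  define dX where "dX = (\<lambda>x y :: 'x. min 1 (dist x y))"
  have dX: "compatible_bounded_metric dX" unfolding dX_def by (rule compatible_truncated_dist)
  show "Hausdorff_space (L0_topology M dX \<mu>)"
    by (rule metrizable_imp_Hausdorff_space[OF metrizable_L0[OF dX]])
  show "continuous_map ofg_topology (L0_topology M dX \<mu>) (\<lambda>C. C)"
  proof (rule continuous_compose_quotient_map[OF quotient_map_orbit_map])
    show "continuous_map cocycle_topology (L0_topology M dX \<mu>) ((\<lambda>C. C) \<circ> orbit_map \<phi> M)"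
    proof (rule continuous_map_cocycle)
      show "(\<lambda>C. C) \<circ> orbit_map \<phi> M \<in> orbit_cocycles \<phi> M \<rightarrow> topspace (L0_topology M dX \<mu>)"
      proof
        fix F assume "F \<in> orbit_cocycles \<phi> M"
        then obtain f S where f: "cocycle f S" "F = ae_class M f" unfolding mem_orbit_cocycles_iff by blast
        then have "S \<in> borel \<rightarrow>\<^sub>M borel" by (auto simp: cocycle_def intro: mp_bijectionsD)
        then show "((\<lambda>C. C) \<circ> orbit_map \<phi> M) F \<in> topspace (L0_topology M dX \<mu>)"
          by (simp add: topspace_L0[OF dX] f(2) orbit_map_cocycle[OF f(1)])
      qed
      fix f S g T assume f: "\<And>n. cocycle (f n) (S n)" "cocycle g T" "conv_measure M f g"
      have "S n \<in> borel \<rightarrow>\<^sub>M borel" "T \<in> borel \<rightarrow>\<^sub>M borel" for n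
        using f by (auto simp: cocycle_def intro: mp_bijectionsD)
      then show "limitin (L0_topology M dX \<mu>) (\<lambda>n. ((\<lambda>C. C) \<circ> orbit_map \<phi> M) (ae_class M (f n)))
          (((\<lambda>C. C) \<circ> orbit_map \<phi> M) (ae_class M g)) sequentially"
        using conv_measure_cocycle[OF f] limitin_L0_iff[OF dX, of S T]
        by (simp add: orbit_map_cocycle[OF f(1)] orbit_map_cocycle[OF f(2)])
    qed
  qed
qed (simp add: inj_on_def)

text \<open>Inverting requires a genuine bijection, which a class does not determine, hence the
  choice of a pair; \<open>cocycle_inv_ae_class\<close> shows the result to be independent of
  it.\<close>

definition cocycle_inv :: "('x \<Rightarrow> 'g) set \<Rightarrow> ('x \<Rightarrow> 'g) set" where
  "cocycle_inv F = (let p = SOME p. cocycle (fst p) (snd p) \<and> F = ae_class M (fst p)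
     in ae_class M (\<lambda>x. inv\<^bsub>G\<^esub> (fst p (inv_into UNIV (snd p) x))))"

lemma cocycle_inv_ae_class:
  assumes f: "cocycle f S"
  shows "cocycle_inv (ae_class M f) = ae_class M (\<lambda>x. inv\<^bsub>G\<^esub> (f (inv_into UNIV S x)))"
proof -
  define p where "p = (SOME p. cocycle (fst p) (snd p) \<and> ae_class M f = ae_class M (fst p))"
  have p: "cocycle (fst p) (snd p) \<and> ae_class M f = ae_class M (fst p)"
    unfolding p_def by (rule someI[of _ "(f, S)"]) (simp add: f)
  define h R where "h = fst p" "R = snd p"
  have h: "cocycle h R" "AE x in M. f x = h x" using p by (simp_all add: h_R_def ae_class_eq_iff)
  have S: "S \<in> mp_bijections M" "R \<in> mp_bijections M" using f h by (simp_all add: cocycle_def)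
  have "AE x in M. \<phi> (f x) x = S x" "AE x in M. \<phi> (h x) x = R x" using f h by (simp_all add: cocycle_def)
  with h(2) have "AE x in M. S x = R x" by eventually_elim simp
  from AE_compose_mp[OF mp_bijectionsD(5)[OF S(1)] this]
  have "AE x in M. inv_into UNIV S x = inv_into UNIV R x"
  proof eventually_elim
    case (elim x)
    then have "R (inv_into UNIV S x) = x" by (simp add: mp_bijectionsD(6)[OF S(1)])
    then show ?case using mp_bijectionsD(7)[OF S(2), of "inv_into UNIV S x"] by simp
  qed
  moreover have "AE x in M. f (inv_into UNIV S x) = h (inv_into UNIV S x)"
    by (rule AE_compose_mp[OF mp_bijectionsD(5)[OF S(1)] h(2)])
  ultimately have "AE x in M. inv\<^bsub>G\<^esub> (h (inv_into UNIV R x)) = inv\<^bsub>G\<^esub> (f (inv_into UNIV S x))"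
    by eventually_elim simp
  then have "ae_class M (\<lambda>x. inv\<^bsub>G\<^esub> (h (inv_into UNIV R x))) = ae_class M (\<lambda>x. inv\<^bsub>G\<^esub> (f (inv_into UNIV S x)))"
    by (simp add: ae_class_eq_iff)
  then show ?thesis
    unfolding cocycle_inv_def p_def[symmetric] Let_def h_R_def .
qed

lemma continuous_cocycle_inv: "continuous_map cocycle_topology L0_top cocycle_inv"
proof (rule continuous_map_cocycle)
  have *: "(\<lambda>x. inv\<^bsub>G\<^esub> (f (inv_into UNIV S x))) \<in> borel \<rightarrow>\<^sub>M borel" if "cocycle f S" for f S
    using cocycle_inverse[OF that] by (simp add: cocycle_def)
  show "cocycle_inv \<in> orbit_cocycles \<phi> M \<rightarrow> topspace L0_top"
    using * by (auto simp: topspace_L0[OF metric] mem_orbit_cocycles_iff cocycle_inv_ae_class)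
  fix f S g T assume f: "\<And>n. cocycle (f n) (S n)" "cocycle g T" "conv_measure M f g"
  show "limitin L0_top (\<lambda>n. cocycle_inv (ae_class M (f n))) (cocycle_inv (ae_class M g)) sequentially"
    unfolding cocycle_inv_ae_class[OF f(1)] cocycle_inv_ae_class[OF f(2)]
      limitin_L0_iff[OF metric *[OF f(1)] *[OF f(2)]]
    by (rule conv_measure_cocycle_inverse[OF f])
qed

text \<open>The limits \<open>a\<close> and \<open>b\<close> define maps \<open>T\<close> and
  \<open>R\<close>, and the composition lemma makes them inverse to each other almost everywhere.
  Both satisfy the Fatou inequality, so \<open>ex_mp_bijection\<close> replaces them by a genuine
  bijection and its inverse; uniqueness of limits then identifies \<open>b\<close>.\<close>

lemma conv_measure_pair_limit:
  assumes f: "\<And>n. cocycle (f n) (S n)" and a: "a \<in> borel \<rightarrow>\<^sub>M borel" and b: "b \<in> borel \<rightarrow>\<^sub>M borel"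
    and fa: "conv_measure M f a"
    and hb: "conv_measure M (\<lambda>n x. inv\<^bsub>G\<^esub> (f n (inv_into UNIV (S n) x))) b"
  shows "\<exists>T. cocycle a T \<and> (AE x in M. b x = inv\<^bsub>G\<^esub> (a (inv_into UNIV T x)))"
proof -
  have S: "S n \<in> mp_bijections M" for n using f by (simp add: cocycle_def)
  note S' = mp_bijectionsD[OF S]
  define h where "h n x = inv\<^bsub>G\<^esub> (f n (inv_into UNIV (S n) x))" for n x
  have h: "cocycle (h n) (inv_into UNIV (S n))" for n
    unfolding h_def by (rule cocycle_inverse[OF f])
  define T where "T x = \<phi> (a x) x" for x
  define R where "R x = \<phi> (b x) x" for x
  have m: "T \<in> borel \<rightarrow>\<^sub>M borel" "R \<in> borel \<rightarrow>\<^sub>M borel"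
    unfolding T_def R_def using a b by (auto intro: measurable_action)
  have ST: "conv_measure M S T"
  proof (rule conv_measure_cong_AE)
    show "AE x in M. \<phi> (f n x) x = S n x" for n using f by (simp add: cocycle_def)
    show "conv_measure M (\<lambda>n x. \<phi> (f n x) x) T"
      unfolding T_def by (rule conv_measure_map2[OF fa fa, where F = "\<lambda>x a b. \<phi> a x"]) (rule tendsto_action, auto)
  qed simp
  have SR: "conv_measure M (\<lambda>n. inv_into UNIV (S n)) R"
  proof (rule conv_measure_cong_AE)
    show "AE x in M. \<phi> (h n x) x = inv_into UNIV (S n) x" for n using h by (simp add: cocycle_def)
    have hb': "conv_measure M h b" using hb by (simp add: h_def[abs_def])
    show "conv_measure M (\<lambda>n x. \<phi> (h n x) x) R"
      unfolding R_def by (rule conv_measure_map2[OF hb' hb', where F = "\<lambda>x a b. \<phi> a x"]) (rule tendsto_action, auto)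
  qed simp
  have "conv_measure M (\<lambda>n x. inv_into UNIV (S n) (S n x)) (\<lambda>x. R (T x))"
    by (rule conv_measure_compose[OF S'(4) m(1) ST S'(3) m(2) SR])
  then have RT: "AE x in M. R (T x) = x"
    using conv_measure_unique[OF _ conv_measure_const[of M "\<lambda>x. x"]] by (simp add: S'(7))
  have "conv_measure M (\<lambda>n x. S n (inv_into UNIV (S n) x)) (\<lambda>x. T (R x))"
    by (rule conv_measure_compose[OF S'(5) m(2) SR S'(2) m(1) ST])
  then have TR: "AE x in M. T (R x) = x"
    using conv_measure_unique[OF _ conv_measure_const[of M "\<lambda>x. x"]] by (simp add: S'(6))
  obtain T' where T': "T' \<in> mp_bijections M" "AE x in M. T x = T' x" "AE x in M. R x = inv_into UNIV T' x"
    using ex_mp_bijection[OF m emeasure_vimage_limit_le[OF S'(4) m(1) ST] emeasure_vimage_limit_le[OF S'(5) m(2) SR] RT TR]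
    by blast
  have coc: "cocycle a T'" using a T' by (simp add: cocycle_def T_def)
  have "conv_measure M h (\<lambda>x. inv\<^bsub>G\<^esub> (a (inv_into UNIV T' x)))"
    unfolding h_def[abs_def] by (rule conv_measure_cocycle_inverse[OF f coc fa])
  then have "AE x in M. b x = inv\<^bsub>G\<^esub> (a (inv_into UNIV T' x))"
    using conv_measure_unique hb unfolding h_def[abs_def] by blast
  then show ?thesis using coc by blast
qed

lemma completely_metrizable_cocycle: "completely_metrizable_space cocycle_topology"
proof -
  define \<gamma> where "\<gamma> F = (F, cocycle_inv F)" for F
  define \<Gamma> where "\<Gamma> = \<gamma> ` orbit_cocycles \<phi> M"
  have "embedding_map cocycle_topology (prod_topology cocycle_topology L0_top) \<gamma>"
    using embedding_map_graph[of cocycle_topology L0_top cocycle_inv] continuous_cocycle_inv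
    by (simp add: \<gamma>_def[abs_def])
  \<comment> \<open>The first factor is enlarged from cocycles to all of \<open>L0 M\<close>, whose
    complete metrizability is known; the graph keeps its topology.\<close>
  then have "homeomorphic_map cocycle_topology
      (subtopology (subtopology (prod_topology L0_top L0_top) (orbit_cocycles \<phi> M \<times> topspace L0_top)) \<Gamma>) \<gamma>"
    unfolding embedding_map_def prod_topology_subtopology by (simp add: \<Gamma>_def)
  moreover have "(orbit_cocycles \<phi> M \<times> topspace L0_top) \<inter> \<Gamma> = \<Gamma>"
    using continuous_map_image_subset_topspace[OF continuous_cocycle_inv] by (auto simp: \<Gamma>_def \<gamma>_def)
  ultimately have hom: "homeomorphic_map cocycle_topology (subtopology (prod_topology L0_top L0_top) \<Gamma>) \<gamma>"
    by (simp add: subtopology_subtopology)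
  have cm: "completely_metrizable_space (prod_topology L0_top L0_top)"
    using completely_metrizable_L0[OF metric] by (simp add: completely_metrizable_space_prod_topology)
  have "closedin (prod_topology L0_top L0_top) \<Gamma>"
  proof -
    obtain A D where "Metric_space A D" and Peq: "prod_topology L0_top L0_top = Metric_space.mtopology A D"
      using completely_metrizable_imp_metrizable_space[OF cm] unfolding metrizable_space_def by blast
    interpret P: Metric_space A D by fact
    show ?thesis
      unfolding Peq P.metric_closedin_iff_sequentially_closed
    proof (intro conjI allI impI)
      show "\<Gamma> \<subseteq> A"
        using continuous_map_image_subset_topspace[OF continuous_cocycle_inv] P.topspace_mtopology
        unfolding Peq[symmetric] by (auto simp: \<Gamma>_def \<gamma>_def topspace_L0[OF metric] orbit_cocycles_def)
      fix \<sigma> l assume "range \<sigma> \<subseteq> \<Gamma> \<and> limitin P.mtopology \<sigma> l sequentially"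
      then have \<sigma>: "range \<sigma> \<subseteq> \<Gamma>" and l: "limitin (prod_topology L0_top L0_top) \<sigma> l sequentially"
        by (simp_all add: Peq)
      have fs: "\<sigma> n = \<gamma> (fst (\<sigma> n))" "fst (\<sigma> n) \<in> orbit_cocycles \<phi> M" for n
        using range_subsetD[OF \<sigma>, of n] by (auto simp: \<Gamma>_def \<gamma>_def)
      then obtain f S where f: "\<And>n. cocycle (f n) (S n)" "(\<lambda>n. fst (\<sigma> n)) = (\<lambda>n. ae_class M (f n))"
        using cocycle_sequence[of "\<lambda>n. fst (\<sigma> n)"] by blast
      have snd: "snd (\<sigma> n) = ae_class M (\<lambda>x. inv\<^bsub>G\<^esub> (f n (inv_into UNIV (S n) x)))" for n
        using fs(1)[of n] fun_cong[OF f(2), of n] cocycle_inv_ae_class[OF f(1)] by (metis \<gamma>_def snd_conv)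
      have "fst l \<in> L0 M" "snd l \<in> L0 M"
        using limitin_topspace[OF l] by (auto simp: topspace_L0[OF metric])
      then obtain a b where ab: "a \<in> borel \<rightarrow>\<^sub>M borel" "fst l = ae_class M a" "b \<in> borel \<rightarrow>\<^sub>M borel" "snd l = ae_class M b"
        unfolding mem_L0_iff by blast
      have fm: "f n \<in> borel \<rightarrow>\<^sub>M borel" "(\<lambda>x. inv\<^bsub>G\<^esub> (f n (inv_into UNIV (S n) x))) \<in> borel \<rightarrow>\<^sub>M borel" for n
        using f(1)[of n] cocycle_inverse[OF f(1)[of n]] by (simp_all add: cocycle_def)
      have l2: "limitin L0_top (\<lambda>n. ae_class M (f n)) (ae_class M a) sequentially"
        "limitin L0_top (\<lambda>n. ae_class M (\<lambda>x. inv\<^bsub>G\<^esub> (f n (inv_into UNIV (S n) x)))) (ae_class M b) sequentially"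
        using l f(2) unfolding limitin_pairwise o_def snd ab(2,4) by simp_all
      have "conv_measure M f a" "conv_measure M (\<lambda>n x. inv\<^bsub>G\<^esub> (f n (inv_into UNIV (S n) x))) b"
        using l2 limitin_L0_iff[OF metric fm(1) ab(1)] limitin_L0_iff[OF metric fm(2) ab(3)] by simp_all
      from conv_measure_pair_limit[OF f(1) ab(1,3) this]
      obtain T where T: "cocycle a T" "AE x in M. b x = inv\<^bsub>G\<^esub> (a (inv_into UNIV T x))" by blast
      have "l = \<gamma> (fst l)"
        unfolding \<gamma>_def prod_eq_iff fst_conv snd_conv
        using T(2) by (simp add: ab cocycle_inv_ae_class[OF T(1)] ae_class_eq_iff)
      moreover have "fst l \<in> orbit_cocycles \<phi> M" using ae_class_cocycle[OF T(1)] ab(2) by simp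
      ultimately show "l \<in> \<Gamma>"
        unfolding \<Gamma>_def by (rule image_eqI)
    qed
  qed
  then have "completely_metrizable_space (subtopology (prod_topology L0_top L0_top) \<Gamma>)"
    by (rule completely_metrizable_space_closedin[OF cm])
  then show ?thesis
    using homeomorphic_completely_metrizable_space[OF homeomorphic_map_imp_homeomorphic_space[OF hom]] by simp
qed

lemma continuous_inv_ofg: "continuous_map ofg_topology ofg_topology (\<lambda>C. inv\<^bsub>ofg\<^esub> C)"
proof (rule continuous_compose_quotient_map[OF quotient_map_orbit_map], rule continuous_map_cocycle)
  show "(\<lambda>C. inv\<^bsub>ofg\<^esub> C) \<circ> orbit_map \<phi> M \<in> orbit_cocycles \<phi> M \<rightarrow> topspace ofg_topology"
  proof
    fix F assume "F \<in> orbit_cocycles \<phi> M"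
    then have "orbit_map \<phi> M F \<in> carrier ofg" using orbit_map_image by blast
    then show "((\<lambda>C. inv\<^bsub>ofg\<^esub> C) \<circ> orbit_map \<phi> M) F \<in> topspace ofg_topology"
      using group.inv_closed[OF group_ofg] by simp
  qed
  fix f S g T assume f: "\<And>n. cocycle (f n) (S n)" "cocycle g T" "conv_measure M f g"
  have "limitin ofg_topology (\<lambda>n. ae_class M (inv_into UNIV (S n))) (ae_class M (inv_into UNIV T)) sequentially"
    by (rule limitin_ofg[OF cocycle_inverse[OF f(1)] cocycle_inverse[OF f(2)] conv_measure_cocycle_inverse[OF f]])
  then show "limitin ofg_topology (\<lambda>n. ((\<lambda>C. inv\<^bsub>ofg\<^esub> C) \<circ> orbit_map \<phi> M) (ae_class M (f n)))
      (((\<lambda>C. inv\<^bsub>ofg\<^esub> C) \<circ> orbit_map \<phi> M) (ae_class M g)) sequentially"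
    by (simp add: orbit_map_cocycle[OF f(1)] orbit_map_cocycle[OF f(2)] ofg_inv[OF f(1)] ofg_inv[OF f(2)])
qed

lemma continuous_mult_ofg:
  "continuous_map (prod_topology ofg_topology ofg_topology) ofg_topology (\<lambda>(A, B). A \<otimes>\<^bsub>ofg\<^esub> B)"
proof -
  define \<Phi> where "\<Phi> = (\<lambda>(F, E). (orbit_map \<phi> M F, orbit_map \<phi> M E))"
  \<comment> \<open>A product of quotient maps need not be a quotient map; openness of
    \<open>orbit_map\<close> makes it one, so that continuity can be tested on pairs of
    cocycles.\<close>
  have q: "quotient_map (prod_topology cocycle_topology cocycle_topology) (prod_topology ofg_topology ofg_topology) \<Phi>"
  proof (rule continuous_open_imp_quotient_map)
    show "open_map (prod_topology cocycle_topology cocycle_topology) (prod_topology ofg_topology ofg_topology) \<Phi>"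
      unfolding \<Phi>_def by (rule open_map_prod[OF open_map_orbit_map open_map_orbit_map])
    show "continuous_map (prod_topology cocycle_topology cocycle_topology) (prod_topology ofg_topology ofg_topology) \<Phi>"
      using continuous_map_compose[OF continuous_map_fst continuous_orbit_map, of cocycle_topology]
        continuous_map_compose[OF continuous_map_snd continuous_orbit_map, of cocycle_topology]
      by (simp add: continuous_map_pairwise \<Phi>_def o_def split_beta)
    show "\<Phi> ` topspace (prod_topology cocycle_topology cocycle_topology) = topspace (prod_topology ofg_topology ofg_topology)"
      unfolding topspace_prod_topology topspace_cocycle topspace_ofg orbit_map_image[symmetric] \<Phi>_def by force
  qed
  show ?thesis
  proof (rule continuous_compose_quotient_map[OF q], rule continuous_map_sequentially_from_metrizable)
    show "metrizable_space (prod_topology cocycle_topology cocycle_topology)"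
      using metrizable_cocycle by (simp add: metrizable_space_prod_topology)
    show "(\<lambda>(A, B). A \<otimes>\<^bsub>ofg\<^esub> B) \<circ> \<Phi> \<in> topspace (prod_topology cocycle_topology cocycle_topology) \<rightarrow> topspace ofg_topology"
    proof
      fix p assume "p \<in> topspace (prod_topology cocycle_topology cocycle_topology)"
      then have "orbit_map \<phi> M (fst p) \<in> carrier ofg" "orbit_map \<phi> M (snd p) \<in> carrier ofg"
        using orbit_map_image by auto
      then show "((\<lambda>(A, B). A \<otimes>\<^bsub>ofg\<^esub> B) \<circ> \<Phi>) p \<in> topspace ofg_topology"
        using monoid.m_closed[OF group.is_monoid[OF group_ofg]] by (simp add: \<Phi>_def split_beta)
    qed
    fix \<sigma> l assume \<sigma>: "range \<sigma> \<subseteq> topspace (prod_topology cocycle_topology cocycle_topology)"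
      and l: "limitin (prod_topology cocycle_topology cocycle_topology) \<sigma> l sequentially"
    have "range (\<lambda>n. fst (\<sigma> n)) \<subseteq> orbit_cocycles \<phi> M" "range (\<lambda>n. snd (\<sigma> n)) \<subseteq> orbit_cocycles \<phi> M"
      using \<sigma> by (auto simp: topspace_prod_topology image_subset_iff mem_Times_iff)
    then obtain f S h T where f: "\<And>n. cocycle (f n) (S n)" "(\<lambda>n. fst (\<sigma> n)) = (\<lambda>n. ae_class M (f n))"
      and h: "\<And>n. cocycle (h n) (T n)" "(\<lambda>n. snd (\<sigma> n)) = (\<lambda>n. ae_class M (h n))"
      using cocycle_sequence by metis
    have "fst l \<in> orbit_cocycles \<phi> M" "snd l \<in> orbit_cocycles \<phi> M"
      using limitin_topspace[OF l] by (auto simp: topspace_prod_topology mem_Times_iff)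
    then obtain f' S' h' T' where f': "cocycle f' S'" "fst l = ae_class M f'"
      and h': "cocycle h' T'" "snd l = ae_class M h'"
      unfolding mem_orbit_cocycles_iff by metis
    have "limitin cocycle_topology (\<lambda>n. ae_class M (f n)) (ae_class M f') sequentially"
      "limitin cocycle_topology (\<lambda>n. ae_class M (h n)) (ae_class M h') sequentially"
      using l f(2) h(2) f'(2) h'(2) by (simp_all add: limitin_pairwise o_def)
    then have cf: "conv_measure M f f'" and ch: "conv_measure M h h'"
      using limitin_cocycle_iff[OF f(1) f'(1)] limitin_cocycle_iff[OF h(1) h'(1)] by simp_all
    have T: "T n \<in> mp_bijections M" "T' \<in> mp_bijections M" for n using h(1) h'(1) by (simp_all add: cocycle_def)
    have "\<sigma> n = (ae_class M (f n), ae_class M (h n))" for n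
      using fun_cong[OF f(2), of n] fun_cong[OF h(2), of n] by (metis prod.collapse)
    moreover have "l = (ae_class M f', ae_class M h')" using f'(2) h'(2) by (metis prod.collapse)
    moreover have "limitin ofg_topology (\<lambda>n. ae_class M (S n \<circ> T n)) (ae_class M (S' \<circ> T')) sequentially"
      by (rule limitin_ofg[OF cocycle_mult[OF f(1) h(1)] cocycle_mult[OF f'(1) h'(1)]
          conv_measure_cocycle_mult[OF f(1) f'(1) cf h(1) h'(1) ch]])
    ultimately show "limitin ofg_topology (\<lambda>n. ((\<lambda>(A, B). A \<otimes>\<^bsub>ofg\<^esub> B) \<circ> \<Phi>) (\<sigma> n))
        (((\<lambda>(A, B). A \<otimes>\<^bsub>ofg\<^esub> B) \<circ> \<Phi>) l) sequentially"
      by (simp add: \<Phi>_def orbit_map_cocycle[OF f(1)] orbit_map_cocycle[OF f'(1)] orbit_map_cocycle[OF h(1)]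
          orbit_map_cocycle[OF h'(1)] ofg_mult[OF T(1)] ofg_mult[OF T(2)])
  qed
qed

theorem polish_group_ofg: "polish_group ofg ofg_topology"
proof -
  have "regular_space ofg_topology"
    by (rule topological_group_imp_regular_space[OF group_ofg topspace_ofg continuous_mult_ofg continuous_inv_ofg])
  then have "completely_metrizable_space ofg_topology" "separable_space ofg_topology"
    using polish_space_open_map_image[OF completely_metrizable_cocycle second_countable_cocycle _ Hausdorff_ofg
        continuous_orbit_map open_map_orbit_map]
      quotient_imp_surjective_map[OF quotient_map_orbit_map] by auto
  then show ?thesis
    unfolding polish_group_def polish_topology_def
    using group_ofg continuous_mult_ofg continuous_inv_ofg by simp
qed

section \<open>The embedding of the acting group\<close>

lemma continuous_on_action: "continuous_on UNIV (\<phi> g)"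
  using continuous_on_compose2[OF continuous_action_fst_snd, of UNIV "\<lambda>x. (g, x)"]
  by (simp add: continuous_intros)

context
  assumes mp: "measure_preserving_action G \<phi> M"
begin

lemma cocycle_action: "cocycle (\<lambda>x. g) (\<phi> g)"
proof -
  have mpg: "mp_map M (\<phi> g)" for g
    unfolding mp_map_def
  proof (intro conjI ballI)
    show "\<phi> g \<in> borel \<rightarrow>\<^sub>M borel" by (rule borel_measurable_continuous_onI[OF continuous_on_action])
    fix A :: "'x set" assume A: "A \<in> sets borel"
    have "\<phi> g -` A = \<phi> (inv\<^bsub>G\<^esub> g) ` A"
    proof (rule Set.set_eqI)
      show "x \<in> \<phi> g -` A \<longleftrightarrow> x \<in> \<phi> (inv\<^bsub>G\<^esub> g) ` A" for x
        by (metis action_inv image_iff vimage_eq)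
    qed
    then show "emeasure M (\<phi> g -` A) = emeasure M A"
      using mp A by (simp add: measure_preserving_action_def)
  qed
  have "\<phi> g \<in> mp_bijections M"
    by (rule mp_bijectionsI(1)[OF mpg mpg[of "inv\<^bsub>G\<^esub> g"]]) simp_all
  then show ?thesis by (simp add: cocycle_def)
qed

lemma action_hom: "(\<lambda>g. ae_class M (\<phi> g)) \<in> hom G ofg"
proof (rule homI)
  show "ae_class M (\<phi> g) \<in> carrier ofg" for g by (rule cocycle_in_carrier[OF cocycle_action])
  fix g h
  have "\<phi> h \<in> mp_bijections M" using cocycle_action[of h] by (simp add: cocycle_def)
  moreover have "\<phi> (g \<otimes>\<^bsub>G\<^esub> h) = \<phi> g \<circ> \<phi> h" by auto
  ultimately show "ae_class M (\<phi> (g \<otimes>\<^bsub>G\<^esub> h)) = ae_class M (\<phi> g) \<otimes>\<^bsub>ofg\<^esub> ae_class M (\<phi> h)"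
    by (simp add: ofg_mult)
qed

text \<open>If \<open>f x\<close> and \<open>e x\<close> move a point of the free part to the same
  place, then the quotient of the two fixes it and is therefore trivial.\<close>

lemma orbit_map_inj:
  assumes free: "essentially_free_action G \<phi> M"
  shows "inj_on (orbit_map \<phi> M) (orbit_cocycles \<phi> M)"
proof (rule inj_onI)
  fix F E assume "F \<in> orbit_cocycles \<phi> M" "E \<in> orbit_cocycles \<phi> M" and eq: "orbit_map \<phi> M F = orbit_map \<phi> M E"
  then obtain f S e T where f: "cocycle f S" "F = ae_class M f" and e: "cocycle e T" "E = ae_class M e"
    unfolding mem_orbit_cocycles_iff by blast
  obtain A where A: "AE x in M. x \<in> A" "\<And>g x. g \<noteq> \<one>\<^bsub>G\<^esub> \<Longrightarrow> x \<in> A \<Longrightarrow> \<phi> g x \<noteq> x"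
    using free by (auto simp: essentially_free_action_def)
  have "AE x in M. \<phi> (f x) x = \<phi> (e x) x"
    using eq by (simp add: f(2) e(2) orbit_map_ae_class ae_class_eq_iff)
  with A(1) have "AE x in M. f x = e x"
  proof eventually_elim
    case (elim x)
    have "\<phi> (inv\<^bsub>G\<^esub> (f x) \<otimes>\<^bsub>G\<^esub> e x) x = x"
      by (simp add: elim(2)[symmetric])
    then have "inv\<^bsub>G\<^esub> (f x) \<otimes>\<^bsub>G\<^esub> e x = \<one>\<^bsub>G\<^esub>" using A(2) elim(1) by blast
    then have "f x \<otimes>\<^bsub>G\<^esub> (inv\<^bsub>G\<^esub> (f x) \<otimes>\<^bsub>G\<^esub> e x) = f x" by simp
    then show ?case by (simp add: m_assoc[symmetric])
  qed
  then show "F = E" by (simp add: f(2) e(2) ae_class_eq_iff)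
qed

text \<open>\<open>\<mu>\<close> has total mass 1, so an almost everywhere statement that does not
  involve \<open>x\<close> holds outright.\<close>

lemma tendsto_of_conv_measure_const:
  assumes "conv_measure M (\<lambda>n x. u n) (\<lambda>x. a)"
  shows "u \<longlonglongrightarrow> a"
proof (rule tendsto_subseq_of_subseq)
  fix r :: "nat \<Rightarrow> nat" assume "strict_mono r"
  from conv_measureD[OF assms this] obtain s where s: "strict_mono s" "AE x in M. (\<lambda>n. u (r (s n))) \<longlonglongrightarrow> a" by blast
  interpret prob_space \<mu> by (rule prob_mu)
  have "AE x in \<mu>. (\<lambda>n. u (r (s n))) \<longlonglongrightarrow> a" using s(2) by (simp only: AE_mu_iff)
  then have "(\<lambda>n. u (r (s n))) \<longlonglongrightarrow> a" by simp
  then show "\<exists>s. strict_mono s \<and> (\<lambda>n. u (r (s n))) \<longlonglongrightarrow> a" using s(1) by blast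
qed

lemma action_embedding:
  assumes free: "essentially_free_action G \<phi> M"
  shows "embedding_map euclidean ofg_topology (\<lambda>g. ae_class M (\<phi> g))"
proof -
  define \<kappa> where "\<kappa> g = ae_class M (\<lambda>x :: 'x. g)" for g :: 'g
  have \<kappa>D: "\<kappa> g \<in> orbit_cocycles \<phi> M" for g unfolding \<kappa>_def by (rule ae_class_cocycle[OF cocycle_action])
  have lim: "limitin cocycle_topology (\<lambda>n. \<kappa> (u n)) (\<kappa> a) sequentially \<longleftrightarrow> u \<longlonglongrightarrow> a" for u a
    unfolding \<kappa>_def limitin_cocycle_iff[OF cocycle_action cocycle_action]
    using tendsto_of_conv_measure_const conv_measure_AE[where M = M and f = "\<lambda>n x. u n" and g = "\<lambda>x. a"] by auto
  have inj: "inj \<kappa>"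
  proof (rule injI)
    interpret prob_space \<mu> by (rule prob_mu)
    fix g h assume "\<kappa> g = \<kappa> h"
    then have "AE x in \<mu>. g = h" unfolding \<kappa>_def ae_class_eq_iff by (simp only: AE_mu_iff)
    then show "g = h" by simp
  qed
  have "homeomorphic_maps euclidean (subtopology cocycle_topology (range \<kappa>)) \<kappa> (inv_into UNIV \<kappa>)"
    unfolding homeomorphic_maps_def
  proof (intro conjI)
    show "continuous_map euclidean (subtopology cocycle_topology (range \<kappa>)) \<kappa>"
    proof (rule continuous_map_into_subtopology)
      show "continuous_map euclidean cocycle_topology \<kappa>"
        by (rule continuous_map_sequentially_from_metrizable[OF metrizable_space_euclidean]) (auto simp: \<kappa>D lim)
    qed simp
    show "continuous_map (subtopology cocycle_topology (range \<kappa>)) euclidean (inv_into UNIV \<kappa>)"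
    proof (rule continuous_map_sequentially_from_metrizable[OF metrizable_space_subtopology[OF metrizable_cocycle]])
      fix \<sigma> l assume \<sigma>: "range \<sigma> \<subseteq> topspace (subtopology cocycle_topology (range \<kappa>))"
        and l: "limitin (subtopology cocycle_topology (range \<kappa>)) \<sigma> l sequentially"
      have s: "\<sigma> n = \<kappa> (inv_into UNIV \<kappa> (\<sigma> n))" for n
      proof -
        have "\<sigma> n \<in> range \<kappa>" using range_subsetD[OF \<sigma>, of n] by simp
        then show ?thesis by (simp only: f_inv_into_f)
      qed
      have l': "l = \<kappa> (inv_into UNIV \<kappa> l)" "limitin cocycle_topology \<sigma> l sequentially"
      proof -
        have *: "l \<in> range \<kappa> \<and> limitin cocycle_topology \<sigma> l sequentially"
          using l unfolding limitin_subtopology[of cocycle_topology "range \<kappa>"] by blast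
        then show "l = \<kappa> (inv_into UNIV \<kappa> l)" by (simp only: f_inv_into_f)
        show "limitin cocycle_topology \<sigma> l sequentially" using * by blast
      qed
      have "limitin cocycle_topology (\<lambda>n. \<kappa> (inv_into UNIV \<kappa> (\<sigma> n))) (\<kappa> (inv_into UNIV \<kappa> l)) sequentially"
        using l' s by (simp only: s[symmetric] l'(1)[symmetric])
      then show "limitin euclidean (\<lambda>n. inv_into UNIV \<kappa> (\<sigma> n)) (inv_into UNIV \<kappa> l) sequentially"
        by (simp add: lim)
    qed simp
  qed (auto simp: inj f_inv_into_f)
  then have "embedding_map euclidean cocycle_topology \<kappa>"
    unfolding embedding_map_def homeomorphic_map_maps by auto
  \<comment> \<open>An injective quotient map is a homeomorphism, and freeness supplies the
    injectivity.\<close>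
  moreover have hm: "homeomorphic_map cocycle_topology ofg_topology (orbit_map \<phi> M)"
    unfolding homeomorphic_map_def using quotient_map_orbit_map orbit_map_inj[OF free] by simp
  have "embedding_map cocycle_topology ofg_topology (orbit_map \<phi> M)"
    unfolding embedding_map_def homeomorphic_imp_surjective_map[OF hm] subtopology_topspace by (rule hm)
  ultimately have "embedding_map euclidean ofg_topology (orbit_map \<phi> M \<circ> \<kappa>)"
    by (rule embedding_map_compose)
  moreover have "orbit_map \<phi> M \<circ> \<kappa> = (\<lambda>g. ae_class M (\<phi> g))"
    by (auto simp: \<kappa>_def orbit_map_cocycle[OF cocycle_action])
  ultimately show ?thesis by simp
qed

end

end

theorem theorem2:
  fixes G :: "'g::polish_space monoid"
    and \<phi> :: "'g \<Rightarrow> 'x::polish_space \<Rightarrow> 'x"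
    and M :: "'x measure"
    and d :: "'g \<Rightarrow> 'g \<Rightarrow> real"
    and \<mu> :: "'x measure"
  assumes "polish_group G euclidean"
    and "group_action G UNIV \<phi>"
    and "continuous_on UNIV (\<lambda>(g, x). \<phi> g x)"
    and "sets M = sets borel"
    and "atomless M"
    and "sigma_finite_measure M"
    and "emeasure M (space M) = \<infinity>"
    and "locally_finite_measure M"
    and "compatible_bounded_metric d"
    and "equivalent_probability M \<mu>"
  shows "polish_group (orbit_full_group G \<phi> M) (orbital_topology G \<phi> M d \<mu>) \<and>
    (measure_preserving_action G \<phi> M \<and> essentially_free_action G \<phi> M \<longrightarrow>
       (\<lambda>g. ae_class M (\<phi> g)) \<in> hom G (orbit_full_group G \<phi> M) \<and>
       embedding_map euclidean (orbital_topology G \<phi> M d \<mu>) (\<lambda>g. ae_class M (\<phi> g)))"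
proof -
  interpret polish_action M \<mu> G \<phi> d
    using assms by (intro polish_action.intro locally_finite_borel.intro polish_action_axioms.intro)
  show ?thesis
    using polish_group_ofg action_hom action_embedding by blast
qed

end
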